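(* Every finite purely quantum program $P\in\mathbf{QProg}$ (i.e. a program containing no iteration or recursion) is equivalent to a normal form, i.e. to an if-statement $$\mathbf{if}\,M[\bar q](\square m\to C_m)\,\mathbf{fi}$$ where $M=\{M_m\}$ is a quantum measurement on a register $\bar q$ and each $C_m$ is either $\mathbf{abort}$ or a quantum circuit.
   Context: A set $QV$ of quantum variables is given; each quantum variable $q$ has a Hilbert space $\mathcal H_q$; a register $\bar q=q_1,\dots,q_n$ is a sequence of distinct variables, with space $\mathcal H_{\bar q}=\bigotimes_i\mathcal H_{q_i}$. $\mathcal H_{QV}$ is the state space of the composite system of all variables in $QV$; an operator on $\mathcal H_{\bar q}$ is identified with its extension by the identity to $\mathcal H_{QV}$. $\mathcal D(\mathcal H_{QV})$ is the set of partial density operators (positive operators of trace $\le 1$) on $\mathcal H_{QV}$. Circuits: $C::=\mathbf{skip}\mid U[\bar q]\mid C_1;C_2\mid \mathbf{qif}\,[\bar q](\square_{i=1}^d|\psi_i\rangle\to C_i)\,\mathbf{fiq}$, where $U$ ranges over a given set $\mathcal U$ of unitary constants (type matching $\bar q$), and in the last clause $\{|\psi_i\rangle\}$ is an orthonormal basis of $\mathcal H_{\bar q}$ and $\bar q$ is disjoint from the variables of all $C_i$. Their semantics are unitaries: $[\![\mathbf{skip}]\!]=I$, $[\![U[\bar q]]\!]=U_{\bar q}$, $[\![C_1;C_2]\!]=[\![C_2]\!][\![C_1]\!]$, $[\![\mathbf{qif}\cdots\mathbf{fiq}]\!]=\sum_i|\psi_i\rangle_{\bar q}\langle\psi_i|\otimes[\![C_i]\!]$.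 A quantum measurement on $\bar q$ is a family $M=\{M_m\}$ of linear operators on $\mathcal H_{\bar q}$ with $\sum_m M_m^\dagger M_m=I$. Finite programs: $P::=\mathbf{skip}\mid\mathbf{abort}\mid\bar q:=|\psi\rangle\mid C\mid P_1;P_2\mid\mathbf{if}\,M[\bar q](\square m\to P_m)\,\mathbf{fi}$, where $|\psi\rangle$ is a pure state (unit vector) of $\mathcal H_{\bar q}$ ($\mathbf{QProg}$ also has while-loops, excluded here by finiteness). Semantics $[\![P]\!]:\mathcal D(\mathcal H_{QV})\to\mathcal D(\mathcal H_{QV})$: $[\![\mathbf{skip}]\!](\rho)=\rho$; $[\![\mathbf{abort}]\!](\rho)=0$; $[\![\bar q:=|\psi\rangle]\!](\rho)=\sum_n|\psi\rangle_{\bar q}\langle n|\rho|n\rangle_{\bar q}\langle\psi|$ with $\{|n\rangle\}$ an orthonormal basis of $\mathcal H_{\bar q}$; $[\![C]\!](\rho)=[\![C]\!]\rho[\![C]\!]^\dagger$; $[\![P_1;P_2]\!](\rho)=[\![P_2]\!]([\![P_1]\!](\rho))$; $[\![\mathbf{if}\,M[\bar q](\square m\to P_m)\,\mathbf{fi}]\!](\rho)=\sum_m[\![P_m]\!](M_m\rho M_m^\dagger)$. Programs are equivalent, $P\equiv Q$, iff $[\![P]\!](\rho)=[\![Q]\!](\rho)$ for all $\rho\in\mathcal D(\mathcal H_{QV})$. *)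

theory Defs
  imports "HOL-Analysis.Analysis" "HOL-Library.Infinite_Typeclass"
begin

section \<open>Hilbert spaces and operators\<close>

text \<open>
  Every Hilbert space is, up to unitary equivalence, the space of square-summable families
  over an index set of arbitrary cardinality. A vector is a function vanishing outside the
  index set; what an operator does outside the space is irrelevant.
\<close>

type_synonym 'a vec = "'a \<Rightarrow> complex"
type_synonym 'a oper = "'a vec \<Rightarrow> 'a vec"

definition ell2 :: "'a set \<Rightarrow> 'a vec set" where
  "ell2 X = {x. (\<forall>i. i \<notin> X \<longrightarrow> x i = 0) \<and> (\<lambda>i. (cmod (x i))\<^sup>2) summable_on X}"

definition ip :: "'a set \<Rightarrow> 'a vec \<Rightarrow> 'a vec \<Rightarrow> complex" where
  "ip X x y = (\<Sum>\<^sub>\<infinity>i\<in>X. cnj (x i) * y i)"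

definition ell2_norm :: "'a set \<Rightarrow> 'a vec \<Rightarrow> real" where
  "ell2_norm X x = sqrt (\<Sum>\<^sub>\<infinity>i\<in>X. (cmod (x i))\<^sup>2)"

definition ket :: "'a \<Rightarrow> 'a vec" where
  "ket i = (\<lambda>j. if j = i then 1 else 0)"

definition bounded_oper :: "'a set \<Rightarrow> 'a oper \<Rightarrow> bool" where
  "bounded_oper X T \<longleftrightarrow>
     (\<forall>x\<in>ell2 X. T x \<in> ell2 X) \<and>
     (\<forall>x\<in>ell2 X. \<forall>y\<in>ell2 X. T (\<lambda>i. x i + y i) = (\<lambda>i. T x i + T y i)) \<and>
     (\<forall>c. \<forall>x\<in>ell2 X. T (\<lambda>i. c * x i) = (\<lambda>i. c * T x i)) \<and>
     (\<exists>K. \<forall>x\<in>ell2 X. ell2_norm X (T x) \<le> K * ell2_norm X x)"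

text \<open>The coordinate of \<open>T\<^sup>\<dagger> y\<close> at \<open>i\<close> is \<open>\<langle>i|T\<^sup>\<dagger> y\<rangle> = \<langle>T i|y\<rangle>\<close>.\<close>

definition adj :: "'a set \<Rightarrow> 'a oper \<Rightarrow> 'a oper" where
  "adj X T = (\<lambda>y i. if i \<in> X then ip X (T (ket i)) y else 0)"

definition unitary_oper :: "'a set \<Rightarrow> 'a oper \<Rightarrow> bool" where
  "unitary_oper X U \<longleftrightarrow>
     bounded_oper X U \<and> (\<forall>x\<in>ell2 X. adj X U (U x) = x \<and> U (adj X U x) = x)"

definition ketbra :: "'a set \<Rightarrow> 'a vec \<Rightarrow> 'a vec \<Rightarrow> 'a oper" where
  "ketbra X \<phi> \<psi> = (\<lambda>x i. ip X \<psi> x * \<phi> i)"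

definition orthonormal_basis :: "'a set \<Rightarrow> nat \<Rightarrow> (nat \<Rightarrow> 'a vec) \<Rightarrow> bool" where
  "orthonormal_basis X d \<psi> \<longleftrightarrow>
     (\<forall>i<d. \<psi> i \<in> ell2 X) \<and>
     (\<forall>i<d. \<forall>j<d. ip X (\<psi> i) (\<psi> j) = (if i = j then 1 else 0)) \<and>
     (\<forall>x\<in>ell2 X. x = (\<lambda>k. \<Sum>i<d. ip X (\<psi> i) x * \<psi> i k))"

definition partial_density :: "'a set \<Rightarrow> 'a oper \<Rightarrow> bool" where
  "partial_density X \<rho> \<longleftrightarrow>
     bounded_oper X \<rho> \<and>
     (\<forall>x\<in>ell2 X. ip X x (\<rho> x) \<in> \<real>\<^sub>\<ge>\<^sub>0) \<and>
     (\<lambda>i. Re (ip X (ket i) (\<rho> (ket i)))) summable_on X \<and>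
     (\<Sum>\<^sub>\<infinity>i\<in>X. Re (ip X (ket i) (\<rho> (ket i)))) \<le> 1"

text \<open>
  The outcome set \<open>J\<close> may be infinite, and \<open>\<Sum>\<^sub>m M\<^sub>m\<^sup>\<dagger>M\<^sub>m = I\<close> is read coordinatewise. The partial
  sums are increasing and bounded by \<open>I\<close>, so this is the same as weak or strong convergence.
\<close>

definition measurement :: "'a set \<Rightarrow> 'm set \<Rightarrow> ('m \<Rightarrow> 'a oper) \<Rightarrow> bool" where
  "measurement X J M \<longleftrightarrow>
     (\<forall>m\<in>J. bounded_oper X (M m)) \<and>
     (\<forall>x\<in>ell2 X. \<forall>i\<in>X. ((\<lambda>m. adj X (M m) (M m x) i) has_sum x i) J)"


section \<open>Registers\<close>

text \<open>
  The elements of type \<open>'v\<close> are the quantum variables, and the space of \<open>q\<close> is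
  \<open>ell2 (B q)\<close>. The space of a register is the tensor product of the spaces of its variables,
  in the order of the list, so its standard basis is indexed by lists of labels. The space of
  all variables has one basis vector for each assignment of labels; if there are infinitely
  many variables, this is the closed span of the product basis vectors inside the infinite
  tensor product.
\<close>

definition reg :: "('v \<Rightarrow> 'b set) \<Rightarrow> 'v list \<Rightarrow> 'b list set" where
  "reg B qs = listset (map B qs)"

definition mems :: "('v \<Rightarrow> 'b set) \<Rightarrow> ('v \<Rightarrow> 'b) set" where
  "mems B = {s. \<forall>q. s q \<in> B q}"

definition put :: "'v list \<Rightarrow> 'b list \<Rightarrow> ('v \<Rightarrow> 'b) \<Rightarrow> ('v \<Rightarrow> 'b)" where
  "put qs bs s = (\<lambda>q. case map_of (zip qs bs) q of None \<Rightarrow> s q | Some b \<Rightarrow> b)"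

text \<open>
  The extension \<open>T \<otimes> I\<close> of an operator on a register: with the labels of all other variables
  kept fixed as in \<open>s\<close>, the vector \<open>x\<close> becomes a vector of the register, and \<open>T\<close> acts on it.
\<close>

definition lift :: "('v \<Rightarrow> 'b set) \<Rightarrow> 'v list \<Rightarrow> 'b list oper \<Rightarrow> ('v \<Rightarrow> 'b) oper" where
  "lift B qs T = (\<lambda>x s. if s \<in> mems B
     then T (\<lambda>bs. if bs \<in> reg B qs then x (put qs bs s) else 0) (map s qs) else 0)"


section \<open>Circuits\<close>

text \<open>In \<open>CQif qs d \<psi> C\<close> only the values of \<open>\<psi>\<close> and \<open>C\<close> at indices below \<open>d\<close> matter.\<close>

datatype ('v, 'b) circuit =
    CSkip
  | CUnitary "'b list oper" "'v list"
  | CSeq "('v, 'b) circuit" "('v, 'b) circuit"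
  | CQif "'v list" nat "nat \<Rightarrow> 'b list vec" "nat \<Rightarrow> ('v, 'b) circuit"

primrec cvars :: "('v, 'b) circuit \<Rightarrow> 'v set" where
  "cvars CSkip = {}"
| "cvars (CUnitary U qs) = set qs"
| "cvars (CSeq C1 C2) = cvars C1 \<union> cvars C2"
| "cvars (CQif qs d \<psi> C) = set qs \<union> (\<Union>i<d. cvars (C i))"

text \<open>
  A unitary constant comes with its type, the list of the basis sets of its arguments;
  it may be applied to the registers of exactly this type.
\<close>

primrec is_circuit ::
  "('v \<Rightarrow> 'b set) \<Rightarrow> ('b set list \<times> 'b list oper) set \<Rightarrow> ('v, 'b) circuit \<Rightarrow> bool" where
  "is_circuit B \<U> CSkip \<longleftrightarrow> True"
| "is_circuit B \<U> (CUnitary U qs) \<longleftrightarrow> distinct qs \<and> (map B qs, U) \<in> \<U>"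
| "is_circuit B \<U> (CSeq C1 C2) \<longleftrightarrow> is_circuit B \<U> C1 \<and> is_circuit B \<U> C2"
| "is_circuit B \<U> (CQif qs d \<psi> C) \<longleftrightarrow>
     distinct qs \<and> orthonormal_basis (reg B qs) d \<psi> \<and>
     (\<forall>i<d. is_circuit B \<U> (C i) \<and> set qs \<inter> cvars (C i) = {})"

text \<open>
  On disjoint variables \<open>|\<psi>\<^sub>i\<rangle>\<langle>\<psi>\<^sub>i| \<otimes> C\<^sub>i\<close> is the product of the extended operators.
\<close>

primrec csem :: "('v \<Rightarrow> 'b set) \<Rightarrow> ('v, 'b) circuit \<Rightarrow> ('v \<Rightarrow> 'b) oper" where
  "csem B CSkip = id"
| "csem B (CUnitary U qs) = lift B qs U"
| "csem B (CSeq C1 C2) = csem B C2 \<circ> csem B C1"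
| "csem B (CQif qs d \<psi> C) =
     (\<lambda>x s. \<Sum>i<d. lift B qs (ketbra (reg B qs) (\<psi> i) (\<psi> i)) (csem B (C i) x) s)"


section \<open>Finite programs\<close>

text \<open>
  In \<open>If qs J M P\<close> the outcomes are the elements of \<open>J\<close>; values of \<open>M\<close> and \<open>P\<close> outside \<open>J\<close>
  do not matter. Outcomes are taken from the type \<open>'b\<close> of basis labels. Since \<open>'b\<close> can be
  chosen as large as needed, this is no restriction as long as it is infinite.
\<close>

datatype ('v, 'b) prog =
    Skip
  | Abort
  | Init "'v list" "'b list vec"
  | Circ "('v, 'b) circuit"
  | Seq "('v, 'b) prog" "('v, 'b) prog"
  | If "'v list" "'b set" "'b \<Rightarrow> 'b list oper" "'b \<Rightarrow> ('v, 'b) prog"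

primrec pvars :: "('v, 'b) prog \<Rightarrow> 'v set" where
  "pvars Skip = {}"
| "pvars Abort = {}"
| "pvars (Init qs \<psi>) = set qs"
| "pvars (Circ C) = cvars C"
| "pvars (Seq P1 P2) = pvars P1 \<union> pvars P2"
| "pvars (If qs J M P) = set qs \<union> (\<Union>m\<in>J. pvars (P m))"

primrec well_formed ::
  "('v \<Rightarrow> 'b set) \<Rightarrow> ('b set list \<times> 'b list oper) set \<Rightarrow> ('v, 'b) prog \<Rightarrow> bool" where
  "well_formed B \<U> Skip \<longleftrightarrow> True"
| "well_formed B \<U> Abort \<longleftrightarrow> True"
| "well_formed B \<U> (Init qs \<psi>) \<longleftrightarrow>
     distinct qs \<and> \<psi> \<in> ell2 (reg B qs) \<and> ell2_norm (reg B qs) \<psi> = 1"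
| "well_formed B \<U> (Circ C) \<longleftrightarrow> is_circuit B \<U> C"
| "well_formed B \<U> (Seq P1 P2) \<longleftrightarrow> well_formed B \<U> P1 \<and> well_formed B \<U> P2"
| "well_formed B \<U> (If qs J M P) \<longleftrightarrow>
     distinct qs \<and> measurement (reg B qs) J M \<and> (\<forall>m\<in>J. well_formed B \<U> (P m))"

text \<open>
  A program, being a finite piece of text, mentions finitely many variables. This has to be said
  because a measurement on an infinite-dimensional register may have infinitely many branches;
  otherwise these could use infinitely many variables, which no single register contains.
\<close>

definition is_program ::
  "('v \<Rightarrow> 'b set) \<Rightarrow> ('b set list \<times> 'b list oper) set \<Rightarrow> ('v, 'b) prog \<Rightarrow> bool" where
  "is_program B \<U> P \<longleftrightarrow> well_formed B \<U> P \<and> finite (pvars P)"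

definition conjugate :: "('v \<Rightarrow> 'b set) \<Rightarrow> ('v \<Rightarrow> 'b) oper \<Rightarrow> ('v \<Rightarrow> 'b) oper \<Rightarrow> ('v \<Rightarrow> 'b) oper" where
  "conjugate B T \<rho> = T \<circ> \<rho> \<circ> adj (mems B) T"

text \<open>
  Initialisation uses the standard basis of the register. Sums of operators are taken
  coordinatewise.
\<close>

primrec psem :: "('v \<Rightarrow> 'b set) \<Rightarrow> ('v, 'b) prog \<Rightarrow> ('v \<Rightarrow> 'b) oper \<Rightarrow> ('v \<Rightarrow> 'b) oper" where
  "psem B Skip = (\<lambda>\<rho>. \<rho>)"
| "psem B Abort = (\<lambda>\<rho> x s. 0)"
| "psem B (Init qs \<psi>) = (\<lambda>\<rho> x s. \<Sum>\<^sub>\<infinity>n\<in>reg B qs.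
     (lift B qs (ketbra (reg B qs) \<psi> (ket n)) \<circ> \<rho> \<circ>
      lift B qs (ketbra (reg B qs) (ket n) \<psi>)) x s)"
| "psem B (Circ C) = (\<lambda>\<rho>. conjugate B (csem B C) \<rho>)"
| "psem B (Seq P1 P2) = (\<lambda>\<rho>. psem B P2 (psem B P1 \<rho>))"
| "psem B (If qs J M P) = (\<lambda>\<rho> x s. \<Sum>\<^sub>\<infinity>m\<in>J.
     psem B (P m) (conjugate B (lift B qs (M m)) \<rho>) x s)"

definition prog_equiv :: "('v \<Rightarrow> 'b set) \<Rightarrow> ('v, 'b) prog \<Rightarrow> ('v, 'b) prog \<Rightarrow> bool" where
  "prog_equiv B P Q \<longleftrightarrow>
     (\<forall>\<rho>. partial_density (mems B) \<rho> \<longrightarrow> (\<forall>x\<in>ell2 (mems B). psem B P \<rho> x = psem B Q \<rho> x))"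

definition normal_form ::
  "('v \<Rightarrow> 'b set) \<Rightarrow> ('b set list \<times> 'b list oper) set \<Rightarrow> ('v, 'b) prog \<Rightarrow> bool" where
  "normal_form B \<U> N \<longleftrightarrow> is_program B \<U> N \<and>
     (\<exists>qs J M C. N = If qs J M C \<and> (\<forall>m\<in>J. C m = Abort \<or> (\<exists>D. C m = Circ D)))"

end

theory Submission
  imports Defs
begin

text \<open>
  Every finite program \<open>P\<close> acts as \<open>\<rho> \<mapsto> \<Sum>\<^sub>m\<^sub>\<notin>\<^sub>A L\<^sub>m \<rho> L\<^sub>m\<^sup>\<dagger>\<close> for a family of operators \<open>L\<^sub>m\<close> on its register with
  \<open>\<Sum>\<^sub>m L\<^sub>m\<^sup>\<dagger>L\<^sub>m = I\<close> and a set \<open>A\<close> of aborted outcomes: a circuit contributes a single unitary,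
  initialisation the operators \<open>|\<psi>\<rangle>\<langle>n|\<close>, and sequencing and branching multiply the operators of their
  parts. Hence \<open>P\<close> is equivalent to measuring \<open>L\<close> and then aborting if \<open>m \<in> A\<close> and skipping otherwise.

  The infinite sums over outcomes are controlled by writing a density operator as
  \<open>\<rho> = \<Sum>\<^sub>k |v\<^sub>k\<rangle>\<langle>v\<^sub>k|\<close> with \<open>\<Sum>\<^sub>k \<parallel>v\<^sub>k\<parallel>\<^sup>2 < \<infinity>\<close>. No spectral theorem is needed: only countably many diagonal
  entries of \<open>\<rho>\<close> are non-zero, and eliminating them one after the other gives a Cholesky decomposition.
  Since \<open>\<Sum>\<^sub>m \<parallel>L\<^sub>m x\<parallel>\<^sup>2 = \<parallel>x\<parallel>\<^sup>2\<close>, the vectors \<open>L\<^sub>m v\<^sub>k\<close> are again square-summable, so all sums converge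
  absolutely and can be rearranged.
\<close>

section \<open>The space of square-summable families\<close>

text \<open>Programs act on the space of all memories, whereas a normal form needs a measurement on
  one register. The operators of a family are therefore kept local to the register of all program
  variables, and the isometry property is brought down to that register at the end by tensoring with
  one fixed memory. This requires a memory to exist, hence the separate case
  \<open>mems B = {}\<close>. The completeness relation is handled as an identity between squared
  norms: composing measurements then means iterating sums of nonnegative reals, with no question of
  operator convergence. The invariant for a program speaks about every decomposition of its input,
  so intermediate results never have to be shown to be density operators. Outcomes must have type
  \<open>'b\<close>, while composed families are indexed by pairs. Infinity of \<open>'b\<close>
  lets pairs be coded in it; the same coding keeps the index set of the vectors in a fixed
  type.\<close>

lemma ell2_outside: "x \<in> ell2 X \<Longrightarrow> i \<notin> X \<Longrightarrow> x i = 0"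
  by (simp add: ell2_def)

lemma ell2_norm_nonneg [simp]: "0 \<le> ell2_norm X x"
  by (simp add: ell2_norm_def infsum_nonneg)

lemma ell2_norm_sq: "(ell2_norm X x)\<^sup>2 = (\<Sum>\<^sub>\<infinity>i\<in>X. (cmod (x i))\<^sup>2)"
  by (simp add: ell2_norm_def infsum_nonneg)

lemma ell2_norm_has_sum:
  assumes "x \<in> ell2 X"
  shows "((\<lambda>i. (cmod (x i))\<^sup>2) has_sum (ell2_norm X x)\<^sup>2) X"
  using assms by (simp add: ell2_def ell2_norm_sq)

lemma ell2I_has_sum:
  assumes "\<And>i. i \<notin> X \<Longrightarrow> x i = 0" and "((\<lambda>i. (cmod (x i))\<^sup>2) has_sum c) X"
  shows "x \<in> ell2 X" and "(ell2_norm X x)\<^sup>2 = c"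
  using assms by (auto simp: ell2_def ell2_norm_sq has_sum_imp_summable infsumI)

lemma ell2_finite_support:
  assumes "finite F" "F \<subseteq> X" "\<And>i. i \<notin> F \<Longrightarrow> x i = 0"
  shows "x \<in> ell2 X" and "(ell2_norm X x)\<^sup>2 = (\<Sum>i\<in>F. (cmod (x i))\<^sup>2)"
proof -
  have "((\<lambda>i. (cmod (x i))\<^sup>2) has_sum (\<Sum>i\<in>F. (cmod (x i))\<^sup>2)) X"
    by (rule has_sum_finite_neutralI) (use assms in auto)
  then show "x \<in> ell2 X" "(ell2_norm X x)\<^sup>2 = (\<Sum>i\<in>F. (cmod (x i))\<^sup>2)"
    using assms(2,3) by (auto intro!: ell2I_has_sum)
qed

lemma ell2_zero [simp]: "(\<lambda>i. 0) \<in> ell2 X"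
  by (simp add: ell2_def)

lemma ell2_norm_zero [simp]: "ell2_norm X (\<lambda>i. 0) = 0"
  by (simp add: ell2_norm_def)

lemma ell2_empty: "x \<in> ell2 {} \<Longrightarrow> x = (\<lambda>i. 0)"
  by (auto simp: ell2_def)

lemma ket_ell2 [simp]: "i \<in> X \<Longrightarrow> ket i \<in> ell2 X"
  by (rule ell2_finite_support[of "{i}"]) (auto simp: ket_def)

lemma ell2_add:
  assumes "x \<in> ell2 X" "y \<in> ell2 X"
  shows "(\<lambda>i. x i + y i) \<in> ell2 X"
proof -
  have "(\<lambda>i. 2 * (cmod (x i))\<^sup>2 + 2 * (cmod (y i))\<^sup>2) summable_on X"
    using assms by (intro summable_on_add summable_on_cmult_right) (auto simp: ell2_def)
  moreover have "(cmod (x i + y i))\<^sup>2 \<le> 2 * (cmod (x i))\<^sup>2 + 2 * (cmod (y i))\<^sup>2" for i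
  proof -
    have "(cmod (x i + y i))\<^sup>2 \<le> (cmod (x i) + cmod (y i))\<^sup>2"
      by (simp add: norm_triangle_ineq power_mono)
    also have "\<dots> \<le> 2 * (cmod (x i))\<^sup>2 + 2 * (cmod (y i))\<^sup>2"
      using sum_squares_bound[of "cmod (x i)" "cmod (y i)"] by (simp add: power2_sum)
    finally show ?thesis .
  qed
  ultimately have "(\<lambda>i. (cmod (x i + y i))\<^sup>2) summable_on X"
    by (rule summable_on_comparison_test) auto
  then show ?thesis using assms by (auto simp: ell2_def)
qed

lemma ell2_scale:
  assumes "x \<in> ell2 X"
  shows "(\<lambda>i. c * x i) \<in> ell2 X" and "ell2_norm X (\<lambda>i. c * x i) = cmod c * ell2_norm X x"
proof -
  have *: "((\<lambda>i. (cmod (c * x i))\<^sup>2) has_sum (cmod c)\<^sup>2 * (ell2_norm X x)\<^sup>2) X"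
    unfolding norm_mult power_mult_distrib
    by (intro has_sum_cmult_right ell2_norm_has_sum assms)
  show "(\<lambda>i. c * x i) \<in> ell2 X"
    by (rule ell2I_has_sum(1)[OF _ *]) (use assms in \<open>auto simp: ell2_def\<close>)
  have "(ell2_norm X (\<lambda>i. c * x i))\<^sup>2 = (cmod c)\<^sup>2 * (ell2_norm X x)\<^sup>2"
    by (rule ell2I_has_sum(2)[OF _ *]) (use assms in \<open>auto simp: ell2_def\<close>)
  then have "(ell2_norm X (\<lambda>i. c * x i))\<^sup>2 = (cmod c * ell2_norm X x)\<^sup>2"
    by (simp add: power_mult_distrib)
  then show "ell2_norm X (\<lambda>i. c * x i) = cmod c * ell2_norm X x"
    by (simp add: power2_eq_iff_nonneg)
qed

lemma ell2_add_scale: "x \<in> ell2 X \<Longrightarrow> y \<in> ell2 X \<Longrightarrow> (\<lambda>i. x i + c * y i) \<in> ell2 X"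
  by (intro ell2_add ell2_scale(1))

lemma ell2_diff: "x \<in> ell2 X \<Longrightarrow> y \<in> ell2 X \<Longrightarrow> (\<lambda>i. x i - y i) \<in> ell2 X"
  using ell2_add_scale[of x X y "-1"] by simp

lemma ell2_sum:
  assumes "\<And>j. j \<in> A \<Longrightarrow> f j \<in> ell2 X"
  shows "(\<lambda>i. \<Sum>j\<in>A. f j i) \<in> ell2 X"
  using assms by (induction A rule: infinite_finite_induct) (auto intro: ell2_add)

lemma ip_abs_summable:
  assumes "x \<in> ell2 X" "y \<in> ell2 X"
  shows "(\<lambda>i. cmod (cnj (x i) * y i)) summable_on X"
proof (rule summable_on_comparison_test)
  show "(\<lambda>i. (cmod (x i))\<^sup>2 + (cmod (y i))\<^sup>2) summable_on X"
    using assms by (intro summable_on_add) (auto simp: ell2_def)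
  show "cmod (cnj (x i) * y i) \<le> (cmod (x i))\<^sup>2 + (cmod (y i))\<^sup>2" for i
    using sum_squares_bound[of "cmod (x i)" "cmod (y i)"]
      mult_nonneg_nonneg[OF norm_ge_zero[of "x i"] norm_ge_zero[of "y i"]]
    unfolding norm_mult complex_mod_cnj by linarith
qed simp

lemma ip_has_sum:
  assumes "x \<in> ell2 X" "y \<in> ell2 X"
  shows "((\<lambda>i. cnj (x i) * y i) has_sum ip X x y) X"
  unfolding ip_def using abs_summable_summable[OF ip_abs_summable[OF assms]] by simp

lemma ip_cnj: "cnj (ip X x y) = ip X y x"
  unfolding ip_def by (subst infsum_cnj[symmetric]) (simp add: mult.commute)

lemma ip_add_scale_right:
  assumes "u \<in> ell2 X" "x \<in> ell2 X" "y \<in> ell2 X"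
  shows "ip X u (\<lambda>i. x i + c * y i) = ip X u x + c * ip X u y"
proof -
  have "((\<lambda>i. cnj (u i) * x i + c * (cnj (u i) * y i)) has_sum ip X u x + c * ip X u y) X"
    by (intro has_sum_add has_sum_cmult_right ip_has_sum assms)
  then show ?thesis
    unfolding ip_def[of X u "\<lambda>i. x i + c * y i"] by (simp add: algebra_simps infsumI)
qed

lemma ip_add_scale_left:
  assumes "u \<in> ell2 X" "x \<in> ell2 X" "y \<in> ell2 X"
  shows "ip X (\<lambda>i. x i + c * y i) u = ip X x u + cnj c * ip X y u"
  using arg_cong[OF ip_add_scale_right[OF assms, of c], of cnj] by (simp add: ip_cnj)

lemma ip_zero_right [simp]: "ip X x (\<lambda>i. 0) = 0"
  by (simp add: ip_def)

lemma ip_zero_left [simp]: "ip X (\<lambda>i. 0) x = 0"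
  by (simp add: ip_def)

lemma ip_scale_right: "ip X x (\<lambda>i. c * y i) = c * ip X x y"
  unfolding ip_def by (subst infsum_cmult_right'[symmetric]) (simp add: mult.left_commute)

lemma ip_scale_left: "ip X (\<lambda>i. c * x i) y = cnj c * ip X x y"
  using arg_cong[OF ip_scale_right[of X y c x], of cnj] by (simp add: ip_cnj)

lemma ip_add_right:
  assumes "u \<in> ell2 X" "x \<in> ell2 X" "y \<in> ell2 X"
  shows "ip X u (\<lambda>i. x i + y i) = ip X u x + ip X u y"
  using ip_add_scale_right[OF assms, of 1] by simp

lemma ip_diff_right:
  assumes "u \<in> ell2 X" "x \<in> ell2 X" "y \<in> ell2 X"
  shows "ip X u (\<lambda>i. x i - y i) = ip X u x - ip X u y"
  using ip_add_scale_right[OF assms, of "-1"] by simp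

lemma ip_diff_left:
  assumes "u \<in> ell2 X" "x \<in> ell2 X" "y \<in> ell2 X"
  shows "ip X (\<lambda>i. x i - y i) u = ip X x u - ip X y u"
  using ip_add_scale_left[OF assms, of "-1"] by simp

lemma ip_sum_right:
  assumes "u \<in> ell2 X" "\<And>j. j \<in> A \<Longrightarrow> f j \<in> ell2 X"
  shows "ip X u (\<lambda>i. \<Sum>j\<in>A. f j i) = (\<Sum>j\<in>A. ip X u (f j))"
  using assms(2)
proof (induction A rule: infinite_finite_induct)
  case (insert j A)
  have "(\<lambda>i. \<Sum>j\<in>insert j A. f j i) = (\<lambda>i. f j i + (\<Sum>j\<in>A. f j i))"
    using insert by simp
  moreover have "ip X u (\<lambda>i. f j i + (\<Sum>j\<in>A. f j i)) = ip X u (f j) + ip X u (\<lambda>i. \<Sum>j\<in>A. f j i)"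
    by (rule ip_add_right[OF assms(1)]) (use insert.prems in \<open>auto intro!: ell2_sum\<close>)
  ultimately show ?case using insert by simp
qed simp_all

lemma ip_self:
  assumes "x \<in> ell2 X"
  shows "ip X x x = of_real ((ell2_norm X x)\<^sup>2)"
proof -
  have "cnj (x i) * x i = of_real ((cmod (x i))\<^sup>2)" for i
    by (simp only: mult.commute[of "cnj (x i)"] complex_norm_square)
  then have "ip X x x = (\<Sum>\<^sub>\<infinity>i\<in>X. of_real ((cmod (x i))\<^sup>2))"
    unfolding ip_def by (simp only:)
  also have "\<dots> = of_real (\<Sum>\<^sub>\<infinity>i\<in>X. (cmod (x i))\<^sup>2)"
    by (rule infsumI, rule has_sum_of_real) (use assms in \<open>simp add: ell2_def\<close>)
  finally show ?thesis by (simp only: ell2_norm_sq)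
qed

lemma ip_self_Re: "x \<in> ell2 X \<Longrightarrow> Re (ip X x x) = (ell2_norm X x)\<^sup>2"
  by (simp add: ip_self)

lemma ip_finite_left:
  assumes "finite F" "F \<subseteq> X" "\<And>i. i \<notin> F \<Longrightarrow> y i = 0"
  shows "ip X y x = (\<Sum>i\<in>F. cnj (y i) * x i)"
  unfolding ip_def
  by (rule infsumI, rule has_sum_finite_neutralI) (use assms in auto)

lemma ip_ket_left: "i \<in> X \<Longrightarrow> ip X (ket i) x = x i"
  by (subst ip_finite_left[of "{i}"]) (auto simp: ket_def)

lemma ip_ket_right: "i \<in> X \<Longrightarrow> ip X x (ket i) = cnj (x i)"
  using ip_ket_left[of i X x] ip_cnj by metis

subsection \<open>Positive forms\<close>

text \<open>Polarisation with the scalars 1 and \<i> yields the symmetry from positivity alone, and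
  the discriminant argument yields the inequality. The abstract \<open>h\<close> covers the inner
  product as well as the possibly degenerate forms of positive operators.\<close>

lemma positive_form:
  fixes h :: "'a vec \<Rightarrow> 'a vec \<Rightarrow> complex"
  assumes V: "\<And>u v c. u \<in> V \<Longrightarrow> v \<in> V \<Longrightarrow> (\<lambda>i. u i + c * v i) \<in> V"
    and right: "\<And>u v w c. u \<in> V \<Longrightarrow> v \<in> V \<Longrightarrow> w \<in> V \<Longrightarrow> h u (\<lambda>i. v i + c * w i) = h u v + c * h u w"
    and left: "\<And>u v w c. u \<in> V \<Longrightarrow> v \<in> V \<Longrightarrow> w \<in> V \<Longrightarrow> h (\<lambda>i. v i + c * w i) u = h v u + cnj c * h w u"
    and pos: "\<And>u. u \<in> V \<Longrightarrow> h u u \<in> \<real>\<^sub>\<ge>\<^sub>0"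
    and x: "x \<in> V" and y: "y \<in> V"
  shows "h y x = cnj (h x y)" and "(cmod (h x y))\<^sup>2 \<le> Re (h x x) * Re (h y y)"
proof -
  have real: "Im (h u u) = 0" "Re (h u u) \<ge> 0" if "u \<in> V" for u
    using pos[OF that] by (auto simp: complex_nonneg_Reals_iff)
  have expand: "h (\<lambda>i. x i + c * y i) (\<lambda>i. x i + c * y i)
      = h x x + c * h x y + cnj c * h y x + cnj c * c * h y y" for c
    using x y by (simp add: left right V algebra_simps)
  have "Im (h x y + h y x) = 0"
    using expand[of 1] real(1)[OF V[OF x y, of 1]] real(1)[OF x] real(1)[OF y] by simp
  moreover have "Re (h x y - h y x) = 0"
    using expand[of \<i>] real(1)[OF V[OF x y, of \<i>]] real(1)[OF x] real(1)[OF y] by simp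
  ultimately show sym: "h y x = cnj (h x y)"
    by (simp add: complex_eq_iff)
  define a b g where "a = Re (h x x)" and "b = Re (h y y)" and "g = (cmod (h x y))\<^sup>2"
  have ab: "a \<ge> 0" "b \<ge> 0" "g \<ge> 0" using real x y by (auto simp: a_def b_def g_def)
  \<comment> \<open>This is the value of the form at x + c y with c = -t * cnj (h x y); the phase of
    c makes both cross terms real and equal to -t g.\<close>
  have quad: "0 \<le> a - 2 * t * g + t\<^sup>2 * g * b" for t :: real
  proof -
    define c where "c = - of_real t * cnj (h x y)"
    have g: "of_real g = h x y * cnj (h x y)"
      unfolding g_def by (rule complex_norm_square)
    have 1: "c * h x y = - of_real (t * g)" and 2: "cnj c * h y x = - of_real (t * g)"
      and 3: "cnj c * c = of_real (t\<^sup>2 * g)"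
      unfolding sym c_def of_real_mult g by (simp_all add: power2_eq_square)
    have "0 \<le> Re (h x x + c * h x y + cnj c * h y x + cnj c * c * h y y)"
      using real(2)[OF V[OF x y, of c]] expand by metis
    also have "\<dots> = a - 2 * t * g + t\<^sup>2 * g * b"
      unfolding 1 2 3 by (simp add: a_def b_def)
    finally show ?thesis .
  qed
  show "(cmod (h x y))\<^sup>2 \<le> Re (h x x) * Re (h y y)"
  proof (cases "b = 0")
    case True
    \<comment> \<open>With b = 0 the bound is linear in t, and t = (a + 1) / g would bring it down
      to -a - 2.\<close>
    have "g = 0"
    proof (rule ccontr)
      assume "g \<noteq> 0"
      then have "2 * ((a + 1) / g) * g = 2 * a + 2" by simp
      then show False using quad[of "(a + 1) / g"] True ab by simp
    qed
    then show ?thesis using ab by (simp add: g_def[symmetric] a_def[symmetric] b_def[symmetric])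
  next
    case False
    \<comment> \<open>The quadratic is smallest at t = 1 / b.\<close>
    then have "g \<le> a * b"
      using quad[of "1 / b"] ab by (simp add: field_simps power2_eq_square)
    then show ?thesis by (simp add: g_def a_def b_def)
  qed
qed

lemma ip_cauchy_schwarz:
  assumes "x \<in> ell2 X" "y \<in> ell2 X"
  shows "cmod (ip X x y) \<le> ell2_norm X x * ell2_norm X y"
proof -
  have "(cmod (ip X x y))\<^sup>2 \<le> Re (ip X x x) * Re (ip X y y)"
    by (rule positive_form(2)[where V = "ell2 X"])
      (use assms in \<open>auto simp: ell2_add_scale ip_add_scale_right ip_add_scale_left ip_self\<close>)
  then have "(cmod (ip X x y))\<^sup>2 \<le> (ell2_norm X x * ell2_norm X y)\<^sup>2"
    by (simp add: ip_self_Re assms power_mult_distrib)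
  then show ?thesis by (rule power2_le_imp_le) simp
qed

lemma ell2_norm_add_sq:
  assumes "x \<in> ell2 X" "y \<in> ell2 X"
  shows "(ell2_norm X (\<lambda>i. x i + y i))\<^sup>2
    = (ell2_norm X x)\<^sup>2 + (ell2_norm X y)\<^sup>2 + 2 * Re (ip X x y)"
proof -
  have "ip X (\<lambda>i. x i + 1 * y i) (\<lambda>i. x i + 1 * y i)
      = ip X x x + ip X y y + (ip X x y + ip X y x)"
    using assms ell2_add_scale[OF assms, of 1]
    by (simp only: ip_add_scale_left ip_add_scale_right) simp
  moreover have "Re (ip X y x) = Re (ip X x y)"
    by (metis ip_cnj complex_cnj(1) complex_eq_iff cnj.simps(1))
  ultimately show ?thesis using assms ell2_add[OF assms] by (simp add: ip_self_Re[symmetric])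
qed

lemma ell2_norm_triangle:
  assumes "x \<in> ell2 X" "y \<in> ell2 X"
  shows "ell2_norm X (\<lambda>i. x i + y i) \<le> ell2_norm X x + ell2_norm X y"
proof (rule power2_le_imp_le)
  show "(ell2_norm X (\<lambda>i. x i + y i))\<^sup>2 \<le> (ell2_norm X x + ell2_norm X y)\<^sup>2"
    using ell2_norm_add_sq[OF assms] ip_cauchy_schwarz[OF assms] complex_Re_le_cmod[of "ip X x y"]
    by (simp add: power2_sum)
qed simp

lemma ell2_coord_le: "x \<in> ell2 X \<Longrightarrow> cmod (x i) \<le> ell2_norm X x"
proof (cases "i \<in> X")
  case True
  assume x: "x \<in> ell2 X"
  have "ell2_norm X (ket i) = 1"
    using ell2_finite_support(2)[of "{i}" X "ket i"] True by (simp add: ket_def power2_eq_1_iff)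
       (smt (verit) ell2_norm_nonneg)
  then show ?thesis
    using ip_cauchy_schwarz[OF ket_ell2[OF True] x] True by (simp add: ip_ket_left)
qed (simp add: ell2_outside)

text \<open>The second assumption says that the functional \<open>\<langle>w|_\<rangle>\<close> is bounded by \<open>C\<close> on the finite truncations
  of \<open>w\<close>.\<close>

lemma ell2I_truncations:
  assumes 0: "\<And>i. i \<notin> X \<Longrightarrow> w i = 0"
    and C: "\<And>F. finite F \<Longrightarrow> F \<subseteq> X \<Longrightarrow> (\<Sum>i\<in>F. (cmod (w i))\<^sup>2) \<le> C * sqrt (\<Sum>i\<in>F. (cmod (w i))\<^sup>2)"
  shows "w \<in> ell2 X"
proof -
  have le: "(\<Sum>i\<in>F. (cmod (w i))\<^sup>2) \<le> C\<^sup>2" if "finite F" "F \<subseteq> X" for F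
  proof -
    define t where "t = sqrt (\<Sum>i\<in>F. (cmod (w i))\<^sup>2)"
    have t: "t \<ge> 0" "(\<Sum>i\<in>F. (cmod (w i))\<^sup>2) = t\<^sup>2" by (auto simp: t_def sum_nonneg)
    show ?thesis
    proof (cases "t = 0")
      case False
      then have "t \<le> C" using C[OF that] t by (simp add: power2_eq_square t_def[symmetric])
      then show ?thesis using t by (simp add: power_mono)
    qed (use t in simp)
  qed
  have sum: "(\<lambda>i. (cmod (w i))\<^sup>2) summable_on X"
    by (rule nonneg_bdd_above_summable_on) (use le in \<open>auto simp: bdd_above_def\<close>)
  then show ?thesis using 0 by (simp add: ell2_def)
qed

text \<open>The truncation and the tail have disjoint supports, so their squared norms add up and
  the error is the defect of a partial sum. This is the density argument by which identities checked
  on kets reach all of \<open>ell2 X\<close>.\<close>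

lemma ell2_truncate:
  assumes x: "x \<in> ell2 X" and e: "e > 0"
  obtains F where "finite F" "F \<subseteq> X" "ell2_norm X (\<lambda>i. x i - (if i \<in> F then x i else 0)) < e"
    "ell2_norm X (\<lambda>i. if i \<in> F then x i else 0) \<le> ell2_norm X x"
proof -
  \<comment> \<open>Half of \<open>e\<^sup>2\<close> is used because the approximation below is
    non-strict and a strict bound is wanted.\<close>
  have "e\<^sup>2 / 2 > 0" using e by simp
  then obtain F where F: "finite F" "F \<subseteq> X" and
      d: "dist (\<Sum>i\<in>F. (cmod (x i))\<^sup>2) ((ell2_norm X x)\<^sup>2) \<le> e\<^sup>2 / 2"
    using has_sum_finite_approximation[OF ell2_norm_has_sum[OF x], of "e\<^sup>2 / 2"] by blast
  let ?y = "\<lambda>i. if i \<in> F then x i else 0"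
  have y: "?y \<in> ell2 X" and ny: "(ell2_norm X ?y)\<^sup>2 = (\<Sum>i\<in>F. (cmod (x i))\<^sup>2)"
    using ell2_finite_support[of F X ?y] F by auto
  have "((\<lambda>i. (cmod (x i))\<^sup>2 - (cmod (?y i))\<^sup>2) has_sum (ell2_norm X x)\<^sup>2 - (ell2_norm X ?y)\<^sup>2) X"
    using has_sum_add[OF ell2_norm_has_sum[OF x] has_sum_uminusI[OF ell2_norm_has_sum[OF y]]]
    by simp
  moreover have "(cmod (x i))\<^sup>2 - (cmod (?y i))\<^sup>2 = (cmod (x i - ?y i))\<^sup>2" for i by simp
  ultimately have s: "((\<lambda>i. (cmod (x i - ?y i))\<^sup>2) has_sum (ell2_norm X x)\<^sup>2 - (ell2_norm X ?y)\<^sup>2) X"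
    by (simp only:)
  have n: "(ell2_norm X (\<lambda>i. x i - ?y i))\<^sup>2 = (ell2_norm X x)\<^sup>2 - (ell2_norm X ?y)\<^sup>2"
    by (rule ell2I_has_sum(2)[OF _ s]) (use x ell2_outside in auto)
  have "(ell2_norm X (\<lambda>i. x i - ?y i))\<^sup>2 \<le> e\<^sup>2 / 2"
    unfolding n ny using d unfolding dist_real_def by linarith
  also have "\<dots> < e\<^sup>2" using e by simp
  finally have "ell2_norm X (\<lambda>i. x i - ?y i) < e"
    using e by (simp add: power2_less_imp_less)
  moreover have "ell2_norm X ?y \<le> ell2_norm X x"
    by (rule power2_le_imp_le) (use n zero_le_power2[of "ell2_norm X (\<lambda>i. x i - ?y i)"] in linarith, simp)
  ultimately show ?thesis using that F by blast
qed

section \<open>Bounded operators\<close>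

lemma bounded_oper_ell2: "bounded_oper X T \<Longrightarrow> x \<in> ell2 X \<Longrightarrow> T x \<in> ell2 X"
  and bounded_oper_add: "bounded_oper X T \<Longrightarrow> x \<in> ell2 X \<Longrightarrow> y \<in> ell2 X \<Longrightarrow> T (\<lambda>i. x i + y i) = (\<lambda>i. T x i + T y i)"
  and bounded_oper_scale: "bounded_oper X T \<Longrightarrow> x \<in> ell2 X \<Longrightarrow> T (\<lambda>i. c * x i) = (\<lambda>i. c * T x i)"
  by (simp_all add: bounded_oper_def)

text \<open>On the zero space the constant in \<open>bounded_oper\<close> may be negative;
  multiplying bounds requires a nonnegative one.\<close>

lemma bounded_oper_bound:
  assumes "bounded_oper X T"
  obtains K where "K \<ge> 0" "\<And>x. x \<in> ell2 X \<Longrightarrow> ell2_norm X (T x) \<le> K * ell2_norm X x"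
proof -
  obtain K where K: "\<And>x. x \<in> ell2 X \<Longrightarrow> ell2_norm X (T x) \<le> K * ell2_norm X x"
    using assms unfolding bounded_oper_def by blast
  have "ell2_norm X (T x) \<le> max K 0 * ell2_norm X x" if "x \<in> ell2 X" for x
    using K[OF that] mult_right_mono[of K "max K 0" "ell2_norm X x"] by simp
  then show ?thesis using that[of "max K 0"] by auto
qed

lemma bounded_oper_zero: "bounded_oper X T \<Longrightarrow> T (\<lambda>i. 0) = (\<lambda>i. 0)"
  using bounded_oper_scale[of X T "\<lambda>i. 0" 0] by simp

lemma bounded_oper_add_scale:
  "bounded_oper X T \<Longrightarrow> x \<in> ell2 X \<Longrightarrow> y \<in> ell2 X \<Longrightarrow> T (\<lambda>i. x i + c * y i) = (\<lambda>i. T x i + c * T y i)"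
  using bounded_oper_add[of X T x "\<lambda>i. c * y i"] bounded_oper_scale[of X T y c]
  by (simp add: ell2_scale)

lemma bounded_oper_diff:
  "bounded_oper X T \<Longrightarrow> x \<in> ell2 X \<Longrightarrow> y \<in> ell2 X \<Longrightarrow> T (\<lambda>i. x i - y i) = (\<lambda>i. T x i - T y i)"
  using bounded_oper_add_scale[of X T x y "-1"] by simp

lemma bounded_oper_sum:
  assumes "bounded_oper X T" "\<And>j. j \<in> A \<Longrightarrow> f j \<in> ell2 X"
  shows "T (\<lambda>i. \<Sum>j\<in>A. f j i) = (\<lambda>i. \<Sum>j\<in>A. T (f j) i)"
  using assms(2)
proof (induction A rule: infinite_finite_induct)
  case (insert j A)
  have "(\<lambda>i. \<Sum>j\<in>insert j A. f j i) = (\<lambda>i. f j i + (\<Sum>j\<in>A. f j i))"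
    using insert by simp
  moreover have "T (\<lambda>i. f j i + (\<Sum>j\<in>A. f j i)) = (\<lambda>i. T (f j) i + T (\<lambda>i. \<Sum>j\<in>A. f j i) i)"
    by (rule bounded_oper_add[OF assms(1)]) (use insert.prems in \<open>auto intro!: ell2_sum\<close>)
  ultimately show ?case using insert by simp
qed (simp_all add: bounded_oper_zero[OF assms(1)])

lemma bounded_operI:
  assumes "\<And>x. x \<in> ell2 X \<Longrightarrow> T x \<in> ell2 X"
    and "\<And>x y c. x \<in> ell2 X \<Longrightarrow> y \<in> ell2 X \<Longrightarrow> T (\<lambda>i. x i + c * y i) = (\<lambda>i. T x i + c * T y i)"
    and "\<And>x. x \<in> ell2 X \<Longrightarrow> ell2_norm X (T x) \<le> K * ell2_norm X x"
  shows "bounded_oper X T"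
proof -
  \<comment> \<open>At x = y = 0 and c = -1 the assumption reads T 0 = T 0 - T 0.\<close>
  have "T (\<lambda>i. 0) = (\<lambda>i. 0)"
    using assms(2)[of "\<lambda>i. 0" "\<lambda>i. 0" "-1"] by (simp add: fun_eq_iff)
  then have "T (\<lambda>i. c * x i) = (\<lambda>i. c * T x i)" if "x \<in> ell2 X" for x c
    using assms(2)[of "\<lambda>i. 0" x c] that by simp
  moreover have "T (\<lambda>i. x i + y i) = (\<lambda>i. T x i + T y i)" if "x \<in> ell2 X" "y \<in> ell2 X" for x y
    using assms(2)[of x y 1] that by simp
  ultimately show ?thesis using assms(1,3) unfolding bounded_oper_def by blast
qed

lemma bounded_oper_id: "bounded_oper X id"
  by (rule bounded_operI[where K = 1]) auto

lemma bounded_oper_comp: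
  assumes S: "bounded_oper X S" and T: "bounded_oper X T"
  shows "bounded_oper X (S \<circ> T)"
proof -
  obtain K where K: "K \<ge> 0" "\<And>x. x \<in> ell2 X \<Longrightarrow> ell2_norm X (S x) \<le> K * ell2_norm X x"
    using bounded_oper_bound[OF S] by blast
  obtain L where L: "L \<ge> 0" "\<And>x. x \<in> ell2 X \<Longrightarrow> ell2_norm X (T x) \<le> L * ell2_norm X x"
    using bounded_oper_bound[OF T] by blast
  show ?thesis
  proof (rule bounded_operI[where K = "K * L"])
    fix x assume x: "x \<in> ell2 X"
    have "ell2_norm X (S (T x)) \<le> K * ell2_norm X (T x)"
      using K x bounded_oper_ell2[OF T] by blast
    also have "\<dots> \<le> K * (L * ell2_norm X x)" using K L x by (intro mult_left_mono) auto
    finally show "ell2_norm X ((S \<circ> T) x) \<le> K * L * ell2_norm X x" by simp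
  qed (simp_all add: bounded_oper_ell2[OF S] bounded_oper_ell2[OF T]
      bounded_oper_add_scale[OF S] bounded_oper_add_scale[OF T])
qed

lemma bounded_oper_add_oper:
  assumes S: "bounded_oper X S" and T: "bounded_oper X T"
  shows "bounded_oper X (\<lambda>x i. S x i + T x i)"
proof -
  obtain K where K: "K \<ge> 0" "\<And>x. x \<in> ell2 X \<Longrightarrow> ell2_norm X (S x) \<le> K * ell2_norm X x"
    using bounded_oper_bound[OF S] by blast
  obtain L where L: "L \<ge> 0" "\<And>x. x \<in> ell2 X \<Longrightarrow> ell2_norm X (T x) \<le> L * ell2_norm X x"
    using bounded_oper_bound[OF T] by blast
  show ?thesis
  proof (rule bounded_operI[where K = "K + L"])
    fix x assume x: "x \<in> ell2 X"
    have "ell2_norm X (\<lambda>i. S x i + T x i) \<le> ell2_norm X (S x) + ell2_norm X (T x)"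
      by (rule ell2_norm_triangle[OF bounded_oper_ell2[OF S x] bounded_oper_ell2[OF T x]])
    also have "\<dots> \<le> (K + L) * ell2_norm X x" using K(2)[OF x] L(2)[OF x] by (simp add: algebra_simps)
    finally show "ell2_norm X (\<lambda>i. S x i + T x i) \<le> (K + L) * ell2_norm X x" .
  qed (simp_all add: ell2_add bounded_oper_ell2[OF S] bounded_oper_ell2[OF T]
      bounded_oper_add_scale[OF S] bounded_oper_add_scale[OF T] algebra_simps)
qed

lemma bounded_oper_zero_oper: "bounded_oper X (\<lambda>x i. 0)"
  by (rule bounded_operI[where K = 0]) auto

lemma bounded_oper_sum_oper:
  assumes "\<And>j. j \<in> A \<Longrightarrow> bounded_oper X (T j)"
  shows "bounded_oper X (\<lambda>x i. \<Sum>j\<in>A. T j x i)"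
  using assms
  by (induction A rule: infinite_finite_induct)
    (auto intro: bounded_oper_zero_oper bounded_oper_add_oper)

lemma bounded_oper_ketbra:
  assumes "\<phi> \<in> ell2 X" "\<psi> \<in> ell2 X"
  shows "bounded_oper X (ketbra X \<phi> \<psi>)"
proof (rule bounded_operI[where K = "ell2_norm X \<psi> * ell2_norm X \<phi>"])
  fix x assume x: "x \<in> ell2 X"
  show "ketbra X \<phi> \<psi> x \<in> ell2 X" unfolding ketbra_def using assms by (intro ell2_scale)
  have "ell2_norm X (ketbra X \<phi> \<psi> x) = cmod (ip X \<psi> x) * ell2_norm X \<phi>"
    unfolding ketbra_def using assms by (intro ell2_scale)
  also have "\<dots> \<le> ell2_norm X \<psi> * ell2_norm X x * ell2_norm X \<phi>"
    using ip_cauchy_schwarz[OF assms(2) x] by (intro mult_right_mono) auto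
  finally show "ell2_norm X (ketbra X \<phi> \<psi> x) \<le> ell2_norm X \<psi> * ell2_norm X \<phi> * ell2_norm X x"
    by (simp add: mult_ac)
qed (use assms in \<open>simp add: ketbra_def ip_add_scale_right algebra_simps\<close>)

lemma finite_support_ket_expansion:
  assumes "finite F" "\<And>i. i \<notin> F \<Longrightarrow> x i = 0"
  shows "x = (\<lambda>k. \<Sum>i\<in>F. x i * ket i k)"
proof
  fix k show "x k = (\<Sum>i\<in>F. x i * ket i k)"
  proof (cases "k \<in> F")
    case True
    then have "(\<Sum>i\<in>F. x i * ket i k) = (\<Sum>i\<in>F. if i = k then x i else 0)"
      by (intro sum.cong) (auto simp: ket_def)
    then show ?thesis using True assms by simp
  next
    case False
    then have "(\<Sum>i\<in>F. x i * ket i k) = 0" by (intro sum.neutral) (auto simp: ket_def)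
    then show ?thesis using False assms by simp
  qed
qed

section \<open>Adjoints of bounded operators\<close>

lemma adj_outside: "i \<notin> X \<Longrightarrow> adj X T y i = 0"
  by (simp add: adj_def)

text \<open>\<open>adj\<close> is defined through the images of kets, so finite combinations of kets
  are the case that linearity alone settles.\<close>

lemma ip_adj_finite:
  assumes T: "bounded_oper X T" and F: "finite F" "F \<subseteq> X" "\<And>i. i \<notin> F \<Longrightarrow> x i = 0" and y: "y \<in> ell2 X"
  shows "ip X (T x) y = ip X x (adj X T y)"
proof -
  have k: "ket i \<in> ell2 X" if "i \<in> F" for i using F that by auto
  have "T x = T (\<lambda>k. \<Sum>i\<in>F. x i * ket i k)"
    using finite_support_ket_expansion[OF F(1,3)] by (rule arg_cong)
  also have "\<dots> = (\<lambda>k. \<Sum>i\<in>F. T (\<lambda>k. x i * ket i k) k)"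
    by (rule bounded_oper_sum[OF T]) (use k ell2_scale in blast)
  also have "\<dots> = (\<lambda>k. \<Sum>i\<in>F. x i * T (ket i) k)"
    by (intro ext sum.cong) (auto simp: bounded_oper_scale[OF T] k)
  finally have Tx: "T x = (\<lambda>k. \<Sum>i\<in>F. x i * T (ket i) k)" .
  have "ip X y (T x) = (\<Sum>i\<in>F. ip X y (\<lambda>k. x i * T (ket i) k))"
    unfolding Tx by (rule ip_sum_right[OF y]) (use k ell2_scale bounded_oper_ell2[OF T] in blast)
  also have "\<dots> = (\<Sum>i\<in>F. x i * ip X y (T (ket i)))" by (simp add: ip_scale_right)
  finally have "cnj (ip X y (T x)) = (\<Sum>i\<in>F. cnj (x i) * cnj (ip X y (T (ket i))))" by simp
  moreover have "ip X x (adj X T y) = (\<Sum>i\<in>F. cnj (x i) * adj X T y i)"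
    by (rule ip_finite_left) (use F in auto)
  moreover have "\<dots> = (\<Sum>i\<in>F. cnj (x i) * ip X (T (ket i)) y)"
    by (rule sum.cong) (use F in \<open>auto simp: adj_def\<close>)
  ultimately show ?thesis by (simp add: ip_cnj)
qed

text \<open>At first \<open>adj X T y\<close> is a mere family of coordinates. Pairing it with its
  own truncation x gives the squared norm of x, but also the inner product of T x and y. Hence all
  truncations have norm at most K times the norm of y.\<close>

lemma adj_ell2:
  assumes T: "bounded_oper X T" and y: "y \<in> ell2 X"
  shows "adj X T y \<in> ell2 X"
proof -
  obtain K where K: "K \<ge> 0" "\<And>x. x \<in> ell2 X \<Longrightarrow> ell2_norm X (T x) \<le> K * ell2_norm X x"
    using bounded_oper_bound[OF T] by blast
  show ?thesis
  proof (rule ell2I_truncations[where C = "K * ell2_norm X y"])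
    fix F :: "'a set" assume F: "finite F" "F \<subseteq> X"
    let ?w = "adj X T y" let ?x = "\<lambda>i. if i \<in> F then ?w i else 0"
    have x: "?x \<in> ell2 X" and nx: "(ell2_norm X ?x)\<^sup>2 = (\<Sum>i\<in>F. (cmod (?w i))\<^sup>2)"
      using ell2_finite_support[of F X ?x] F by auto
    have nx': "ell2_norm X ?x = sqrt (\<Sum>i\<in>F. (cmod (?w i))\<^sup>2)"
      using nx by (metis ell2_norm_nonneg real_sqrt_unique)
    have "ip X ?x ?w = (\<Sum>i\<in>F. cnj (?x i) * ?w i)"
      by (rule ip_finite_left) (use F in auto)
    also have "\<dots> = of_real (\<Sum>i\<in>F. (cmod (?w i))\<^sup>2)"
      unfolding of_real_sum by (intro sum.cong) (simp_all only: if_True complex_norm_square mult.commute)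
    finally have "(\<Sum>i\<in>F. (cmod (?w i))\<^sup>2) = cmod (ip X ?x ?w)"
      by (simp only: norm_of_real) (simp add: sum_nonneg)
    also have "ip X ?x ?w = ip X (T ?x) y"
      by (rule ip_adj_finite[OF T F, symmetric]) (use y in auto)
    also have "cmod \<dots> \<le> ell2_norm X (T ?x) * ell2_norm X y"
      using ip_cauchy_schwarz bounded_oper_ell2[OF T x] y by blast
    also have "\<dots> \<le> K * ell2_norm X ?x * ell2_norm X y"
      using K(2)[OF x] by (intro mult_right_mono) auto
    finally show "(\<Sum>i\<in>F. (cmod (?w i))\<^sup>2) \<le> K * ell2_norm X y * sqrt (\<Sum>i\<in>F. (cmod (?w i))\<^sup>2)"
      unfolding nx' by (simp add: mult_ac)
  qed (simp add: adj_outside)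
qed

text \<open>Both sides are continuous in \<open>x\<close> and agree on truncations of
  \<open>x\<close>.\<close>

lemma ip_adj:
  assumes T: "bounded_oper X T" and x: "x \<in> ell2 X" and y: "y \<in> ell2 X"
  shows "ip X (T x) y = ip X x (adj X T y)"
proof -
  obtain K where K: "K \<ge> 0" "\<And>x. x \<in> ell2 X \<Longrightarrow> ell2_norm X (T x) \<le> K * ell2_norm X x"
    using bounded_oper_bound[OF T] by blast
  note w = adj_ell2[OF T y]
  \<comment> \<open>On the tail d of x the two sides differ by at most the norm of d times the first
    two summands; the 1 keeps the constant positive, so that e can be divided by it.\<close>
  let ?C = "K * ell2_norm X y + ell2_norm X (adj X T y) + 1"
  have C: "?C > 0" using K by (simp add: add_nonneg_pos)
  have "cmod (ip X (T x) y - ip X x (adj X T y)) \<le> e" if e: "e > 0" for e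
  proof -
    obtain F where F: "finite F" "F \<subseteq> X" and lt:
      "ell2_norm X (\<lambda>i. x i - (if i \<in> F then x i else 0)) < e / ?C"
      by (rule ell2_truncate[OF x divide_pos_pos[OF e C]])
    define z where "z = (\<lambda>i. if i \<in> F then x i else 0)"
    have z0: "z i = 0" if "i \<notin> F" for i using that by (simp add: z_def)
    define d where "d = (\<lambda>i. x i - z i)"
    have lt: "ell2_norm X d < e / ?C" using lt by (simp only: d_def z_def)
    have x': "z \<in> ell2 X" using ell2_finite_support(1)[OF F z0] .
    have d: "d \<in> ell2 X" unfolding d_def using x x' by (rule ell2_diff)
    have "ip X (T d) y = ip X (T x) y - ip X (T z) y"
      unfolding d_def bounded_oper_diff[OF T x x']
      by (rule ip_diff_left[OF y bounded_oper_ell2[OF T x] bounded_oper_ell2[OF T x']])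
    moreover have "ip X d (adj X T y) = ip X x (adj X T y) - ip X z (adj X T y)"
      unfolding d_def by (rule ip_diff_left[OF w x x'])
    moreover have "ip X (T z) y = ip X z (adj X T y)"
      by (rule ip_adj_finite[OF T F z0 y])
    ultimately have "cmod (ip X (T x) y - ip X x (adj X T y))
        = cmod (ip X (T d) y - ip X d (adj X T y))"
      by simp
    also have "\<dots> \<le> cmod (ip X (T d) y) + cmod (ip X d (adj X T y))"
      by (rule norm_triangle_ineq4)
    also have "\<dots> \<le> ell2_norm X (T d) * ell2_norm X y + ell2_norm X d * ell2_norm X (adj X T y)"
      by (intro add_mono ip_cauchy_schwarz bounded_oper_ell2[OF T d] d w y)
    also have "\<dots> \<le> K * ell2_norm X d * ell2_norm X y + ell2_norm X d * ell2_norm X (adj X T y)"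
      using K(2)[OF d] by (intro add_right_mono mult_right_mono) auto
    also have "\<dots> \<le> ell2_norm X d * ?C" by (simp add: algebra_simps)
    also have "\<dots> \<le> e / ?C * ?C"
      by (rule mult_right_mono[OF less_imp_le[OF lt] less_imp_le[OF C]])
    also have "\<dots> = e" using C by (metis nonzero_divide_eq_eq less_irrefl)
    finally show ?thesis .
  qed
  then have "cmod (ip X (T x) y - ip X x (adj X T y)) \<le> 0"
    by (rule field_le_epsilon) simp
  then show ?thesis by simp
qed

section \<open>Measurements as isometric families\<close>

text \<open>The completeness relation tested on the diagonal: only nonnegative reals are summed, so
  outcomes may be regrouped and sums interchanged. It is shown below to be equivalent to
  \<open>measurement\<close>.\<close>

definition isometric_family :: "'a set \<Rightarrow> 'm set \<Rightarrow> ('m \<Rightarrow> 'a oper) \<Rightarrow> bool" where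
  "isometric_family X J M \<longleftrightarrow> (\<forall>m\<in>J. bounded_oper X (M m)) \<and>
     (\<forall>x\<in>ell2 X. ((\<lambda>m. (ell2_norm X (M m x))\<^sup>2) has_sum (ell2_norm X x)\<^sup>2) J)"

lemma isometric_familyD:
  assumes "isometric_family X J M"
  shows "m \<in> J \<Longrightarrow> bounded_oper X (M m)"
    and "x \<in> ell2 X \<Longrightarrow> ((\<lambda>m. (ell2_norm X (M m x))\<^sup>2) has_sum (ell2_norm X x)\<^sup>2) J"
  using assms by (auto simp: isometric_family_def)

lemma adj_apply_eq_ip: "i \<in> X \<Longrightarrow> adj X T y i = ip X (T (ket i)) y"
  by (simp add: adj_def)

text \<open>Norms determine inner products by polarisation: the squared norm of u + x yields the
  real part, \<i> x in place of x the imaginary part, and u = \<open>ket i\<close> the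
  coordinates.\<close>

lemma isometric_family_imp_measurement:
  assumes "isometric_family X J M"
  shows "measurement X J M"
proof -
  note M = isometric_familyD[OF assms]
  have Re: "((\<lambda>m. Re (ip X (M m u) (M m x))) has_sum Re (ip X u x)) J"
    if u: "u \<in> ell2 X" and x: "x \<in> ell2 X" for u x
  proof -
    have 1: "((\<lambda>m. (1/2) * ((ell2_norm X (M m (\<lambda>i. u i + x i)))\<^sup>2
          + (- (ell2_norm X (M m u))\<^sup>2 + - (ell2_norm X (M m x))\<^sup>2))) has_sum
        (1/2) * ((ell2_norm X (\<lambda>i. u i + x i))\<^sup>2 + (- (ell2_norm X u)\<^sup>2 + - (ell2_norm X x)\<^sup>2))) J"
      by (intro has_sum_cmult_right has_sum_add has_sum_uminusI M(2) ell2_add u x)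
    have 2: "(1/2) * ((ell2_norm X (M m (\<lambda>i. u i + x i)))\<^sup>2
          + (- (ell2_norm X (M m u))\<^sup>2 + - (ell2_norm X (M m x))\<^sup>2)) = Re (ip X (M m u) (M m x))"
      if "m \<in> J" for m
      using ell2_norm_add_sq[OF bounded_oper_ell2[OF M(1)[OF that] u] bounded_oper_ell2[OF M(1)[OF that] x]]
      by (simp add: bounded_oper_add[OF M(1)[OF that] u x])
    have 3: "(1/2) * ((ell2_norm X (\<lambda>i. u i + x i))\<^sup>2 + (- (ell2_norm X u)\<^sup>2 + - (ell2_norm X x)\<^sup>2))
        = Re (ip X u x)"
      using ell2_norm_add_sq[OF u x] by simp
    from has_sum_cong[THEN iffD1, OF 2 1] show ?thesis unfolding 3 .
  qed
  have sum: "((\<lambda>m. ip X (M m u) (M m x)) has_sum ip X u x) J"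
    if u: "u \<in> ell2 X" and x: "x \<in> ell2 X" for u x
  proof -
    have 1: "((\<lambda>m. - Re (ip X (M m u) (M m (\<lambda>i. \<i> * x i)))) has_sum - Re (ip X u (\<lambda>i. \<i> * x i))) J"
      by (intro has_sum_uminusI Re u ell2_scale x)
    have 2: "- Re (ip X (M m u) (M m (\<lambda>i. \<i> * x i))) = Im (ip X (M m u) (M m x))" if "m \<in> J" for m
      by (simp add: bounded_oper_scale[OF M(1)[OF that] x] ip_scale_right)
    from has_sum_cong[THEN iffD1, OF 2 1]
    have Im: "((\<lambda>m. Im (ip X (M m u) (M m x))) has_sum Im (ip X u x)) J"
      by (simp add: ip_scale_right)
    have "((\<lambda>m. of_real (Re (ip X (M m u) (M m x))) + \<i> * of_real (Im (ip X (M m u) (M m x))))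
        has_sum (of_real (Re (ip X u x)) + \<i> * of_real (Im (ip X u x)))) J"
      by (intro has_sum_add has_sum_cmult_right has_sum_of_real Re[OF u x] Im)
    then show ?thesis by (simp only: complex_eq[symmetric])
  qed
  show ?thesis
    unfolding measurement_def
    using M(1) sum[OF ket_ell2] by (auto simp: adj_apply_eq_ip ip_ket_left)
qed

lemma has_sum_finite_sum:
  fixes f :: "'i \<Rightarrow> 'm \<Rightarrow> 'c::{comm_monoid_add,topological_comm_monoid_add}"
  assumes "\<And>i. i \<in> F \<Longrightarrow> (f i has_sum g i) J"
  shows "((\<lambda>m. \<Sum>i\<in>F. f i m) has_sum (\<Sum>i\<in>F. g i)) J"
  using assms by (induction F rule: infinite_finite_induct) (auto intro: has_sum_add)

lemma ell2_norm_le_add_diff: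
  assumes "x \<in> ell2 X" "y \<in> ell2 X"
  shows "ell2_norm X x \<le> ell2_norm X y + ell2_norm X (\<lambda>i. x i - y i)"
  using ell2_norm_triangle[OF assms(2) ell2_diff[OF assms]] by simp

text \<open>The defining identity of a measurement is bilinear and holds coordinatewise, so it gives the
  isometry on finitely supported vectors; boundedness extends it to all of the space.\<close>

lemma measurement_imp_isometric_family:
  assumes "measurement X J M"
  shows "isometric_family X J M"
proof -
  have M: "bounded_oper X (M m)" if "m \<in> J" for m
    using assms that by (auto simp: measurement_def)
  have sum: "((\<lambda>m. adj X (M m) (M m x) i) has_sum x i) J" if "x \<in> ell2 X" "i \<in> X" for x i
    using assms that unfolding measurement_def by blast
  have fin: "((\<lambda>m. ip X (M m y) (M m x)) has_sum ip X y x) J"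
    if x: "x \<in> ell2 X" and F: "finite F" "F \<subseteq> X" "\<And>i. i \<notin> F \<Longrightarrow> y i = 0" for x y F
  proof -
    have y: "y \<in> ell2 X" using ell2_finite_support(1)[OF F] .
    have 1: "((\<lambda>m. \<Sum>i\<in>F. cnj (y i) * adj X (M m) (M m x) i) has_sum (\<Sum>i\<in>F. cnj (y i) * x i)) J"
      using F(2) by (intro has_sum_finite_sum has_sum_cmult_right sum x) auto
    have 2: "(\<Sum>i\<in>F. cnj (y i) * adj X (M m) (M m x) i) = ip X (M m y) (M m x)" if m: "m \<in> J" for m
      using ip_adj[OF M[OF m] y bounded_oper_ell2[OF M[OF m] x]]
        ip_finite_left[OF F, of "\<lambda>i. i" "adj X (M m) (M m x)"] by simp
    from has_sum_cong[THEN iffD1, OF 2 1] show ?thesis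
      using ip_finite_left[OF F, of "\<lambda>i. i" x] by simp
  qed
  have fin': "((\<lambda>m. (ell2_norm X (M m y))\<^sup>2) has_sum (ell2_norm X y)\<^sup>2) J"
    if F: "finite F" "F \<subseteq> X" "\<And>i. i \<notin> F \<Longrightarrow> y i = 0" for y F
  proof -
    have y: "y \<in> ell2 X" using ell2_finite_support(1)[OF F] .
    have 1: "((\<lambda>m. Re (ip X (M m y) (M m y))) has_sum Re (ip X y y)) J"
      by (intro has_sum_Re fin[OF y F])
    have 2: "Re (ip X (M m y) (M m y)) = (ell2_norm X (M m y))\<^sup>2" if "m \<in> J" for m
      by (rule ip_self_Re[OF bounded_oper_ell2[OF M[OF that] y]])
    from has_sum_cong[THEN iffD1, OF 2 1] show ?thesis unfolding ip_self_Re[OF y] .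
  qed
  \<comment> \<open>Only finitely many outcomes occur in \<open>G\<close>, so the partial sum passes
    to the limit along truncations of \<open>x\<close>. This Bessel-type bound gives summability
    over \<open>J\<close> and one of the two inequalities.\<close>
  have le: "(\<Sum>m\<in>G. (ell2_norm X (M m x))\<^sup>2) \<le> (ell2_norm X x)\<^sup>2"
    if x: "x \<in> ell2 X" and G: "finite G" "G \<subseteq> J" for x G
  proof -
    have "\<exists>y F. finite F \<and> F \<subseteq> X \<and> (\<forall>i. i \<notin> F \<longrightarrow> y i = 0) \<and> ell2_norm X y \<le> ell2_norm X x \<and>
        ell2_norm X (\<lambda>i. x i - y i) < 1 / real (Suc n)" for n
    proof -
      obtain F where "finite F" "F \<subseteq> X" "ell2_norm X (\<lambda>i. x i - (if i \<in> F then x i else 0)) < 1 / real (Suc n)"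
        "ell2_norm X (\<lambda>i. if i \<in> F then x i else 0) \<le> ell2_norm X x"
        by (rule ell2_truncate[OF x, of "1 / real (Suc n)"]) simp_all
      then show ?thesis by (intro exI[of _ "\<lambda>i. if i \<in> F then x i else 0"] exI[of _ F]) auto
    qed
    then obtain y F where F: "\<And>n. finite (F n)" "\<And>n. F n \<subseteq> X" "\<And>n i. i \<notin> F n \<Longrightarrow> y n i = 0"
      and ny: "\<And>n. ell2_norm X (y n) \<le> ell2_norm X x"
      and d: "\<And>n. ell2_norm X (\<lambda>i. x i - y n i) < 1 / real (Suc n)"
      by metis
    have y: "y n \<in> ell2 X" for n using ell2_finite_support(1)[OF F] .
    have lim: "(\<lambda>n. ell2_norm X (M m (y n))) \<longlonglongrightarrow> ell2_norm X (M m x)" if m: "m \<in> J" for m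
    proof -
      note Mm = M[OF m]
      obtain K where K: "K \<ge> 0" "\<And>x. x \<in> ell2 X \<Longrightarrow> ell2_norm X (M m x) \<le> K * ell2_norm X x"
        using bounded_oper_bound[OF Mm] by blast
      have b: "ell2_norm X (M m (\<lambda>i. x i - y n i)) \<le> K * (1 / real (Suc n))" for n
        using K(2)[OF ell2_diff[OF x y]] mult_left_mono[OF less_imp_le[OF d] K(1)] by (rule order_trans)
      have "norm (ell2_norm X (M m (y n)) - ell2_norm X (M m x)) \<le> K * (1 / real (Suc n))" for n
      proof -
        have a: "M m x \<in> ell2 X" "M m (y n) \<in> ell2 X" using bounded_oper_ell2[OF Mm] x y by auto
        have e: "M m (\<lambda>i. x i - y n i) = (\<lambda>i. M m x i - M m (y n) i)"
          by (rule bounded_oper_diff[OF Mm x y])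
        have "ell2_norm X (\<lambda>i. M m (y n) i - M m x i) = ell2_norm X (\<lambda>i. M m x i - M m (y n) i)"
          using ell2_scale(2)[OF ell2_diff[OF a], of "-1"] by (simp add: minus_diff_eq)
        then show ?thesis
          using ell2_norm_le_add_diff[OF a] ell2_norm_le_add_diff[OF a(2,1)] b[of n] e by simp
      qed
      moreover have "(\<lambda>n. K * (1 / real (Suc n))) \<longlonglongrightarrow> 0"
        using tendsto_mult_right_zero[OF LIMSEQ_inverse_real_of_nat, of K] by (simp add: inverse_eq_divide)
      ultimately have "(\<lambda>n. ell2_norm X (M m (y n)) - ell2_norm X (M m x)) \<longlonglongrightarrow> 0"
        by (rule Lim_null_comparison[OF always_eventually[OF allI]])
      then show ?thesis by (simp add: LIM_zero_iff)
    qed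
    have "(\<lambda>n. \<Sum>m\<in>G. (ell2_norm X (M m (y n)))\<^sup>2) \<longlonglongrightarrow> (\<Sum>m\<in>G. (ell2_norm X (M m x))\<^sup>2)"
      using G(2) by (intro tendsto_sum tendsto_power lim) auto
    moreover have "(\<Sum>m\<in>G. (ell2_norm X (M m (y n)))\<^sup>2) \<le> (ell2_norm X x)\<^sup>2" for n
    proof -
      have "(\<Sum>m\<in>G. (ell2_norm X (M m (y n)))\<^sup>2) \<le> (ell2_norm X (y n))\<^sup>2"
        by (rule finite_sum_le_has_sum[OF fin'[OF F] G]) auto
      also have "\<dots> \<le> (ell2_norm X x)\<^sup>2" by (rule power_mono[OF ny]) simp
      finally show ?thesis .
    qed
    ultimately show ?thesis by (intro LIMSEQ_le_const2) auto
  qed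
  have "((\<lambda>m. (ell2_norm X (M m x))\<^sup>2) has_sum (ell2_norm X x)\<^sup>2) J" if x: "x \<in> ell2 X" for x
  proof -
    have s: "(\<lambda>m. (ell2_norm X (M m x))\<^sup>2) summable_on J"
      by (rule nonneg_bdd_above_summable_on) (use le[OF x] in \<open>auto simp: bdd_above_def\<close>)
    define S where "S = (\<Sum>\<^sub>\<infinity>m\<in>J. (ell2_norm X (M m x))\<^sup>2)"
    have S: "((\<lambda>m. (ell2_norm X (M m x))\<^sup>2) has_sum S) J" using s by (simp add: S_def)
    have "S \<le> (ell2_norm X x)\<^sup>2" by (rule has_sum_le_finite_sums[OF S le[OF x]])
    moreover have "ell2_norm X x \<le> sqrt S + e" if e: "e > 0" for e
    proof -
      obtain F where F: "finite F" "F \<subseteq> X" and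
        d: "ell2_norm X (\<lambda>i. x i - (if i \<in> F then x i else 0)) < e"
        by (rule ell2_truncate[OF x e])
      define y where "y = (\<lambda>i. if i \<in> F then x i else 0)"
      have F': "y i = 0" if "i \<notin> F" for i using that by (simp add: y_def)
      have y: "y \<in> ell2 X" using ell2_finite_support(1)[OF F F'] .
      have "ip X y x = ip X y y"
        using ip_finite_left[OF F F', of "\<lambda>i. i" x] ip_finite_left[OF F F', of "\<lambda>i. i" y]
          sum.cong[of F F "\<lambda>i. cnj (y i) * x i" "\<lambda>i. cnj (y i) * y i"] by (simp add: y_def)
      then have yx: "Re (ip X y x) = (ell2_norm X y)\<^sup>2" by (simp add: ip_self_Re[OF y])
      \<comment> \<open>The summands are the expanded squared norms of M m (x - y). For the
        truncation \<open>y\<close>, \<open>yx\<close> turns their total into S minus the squared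
        norm of y, and its nonnegativity gives the reverse inequality.\<close>
      have "((\<lambda>m. (ell2_norm X (M m x))\<^sup>2 + ((ell2_norm X (M m y))\<^sup>2
              + (-2) * Re (ip X (M m y) (M m x)))) has_sum
            (S + ((ell2_norm X y)\<^sup>2 + (-2) * Re (ip X y x)))) J"
        by (intro has_sum_add S fin'[OF F F'] has_sum_cmult_right has_sum_Re fin[OF x F F'])
      moreover have "0 \<le> (ell2_norm X (M m x))\<^sup>2 + ((ell2_norm X (M m y))\<^sup>2
              + (-2) * Re (ip X (M m y) (M m x)))" if "m \<in> J" for m
      proof -
        have *: "M m y \<in> ell2 X" "M m x \<in> ell2 X" using bounded_oper_ell2[OF M[OF that]] x y by auto
        have "2 * Re (ip X (M m y) (M m x)) \<le> 2 * (ell2_norm X (M m y) * ell2_norm X (M m x))"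
          using ip_cauchy_schwarz[OF *] complex_Re_le_cmod[of "ip X (M m y) (M m x)"] by linarith
        also have "\<dots> \<le> (ell2_norm X (M m y))\<^sup>2 + (ell2_norm X (M m x))\<^sup>2"
          using sum_squares_bound[of "ell2_norm X (M m y)" "ell2_norm X (M m x)"] by simp
        finally show ?thesis by simp
      qed
      ultimately have "0 \<le> S + ((ell2_norm X y)\<^sup>2 + (-2) * Re (ip X y x))"
        by (rule has_sum_nonneg)
      then have "(ell2_norm X y)\<^sup>2 \<le> S" using yx by simp
      then have "ell2_norm X y \<le> sqrt S" by (rule real_le_rsqrt)
      then show ?thesis
        using ell2_norm_le_add_diff[OF x y] d by (simp add: y_def)
    qed
    then have "ell2_norm X x \<le> sqrt S" by (rule field_le_epsilon)
    then have "(ell2_norm X x)\<^sup>2 \<le> S"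
      by (metis S has_sum_nonneg ell2_norm_nonneg power_mono real_sqrt_pow2 zero_le_power2)
    ultimately show ?thesis using S by simp
  qed
  then show ?thesis using M by (simp add: isometric_family_def)
qed

lemma isometric_family_singleton:
  assumes "bounded_oper X T" "\<And>x. x \<in> ell2 X \<Longrightarrow> ell2_norm X (T x) = ell2_norm X x"
  shows "isometric_family X {m} (\<lambda>_. T)"
  using assms by (auto simp: isometric_family_def intro!: has_sum_finiteI)

text \<open>Summing over the second outcome first gives the squared norm of \<open>M m x\<close>,
  and nonnegativity merges the iterated sum into one over pairs. \<open>I\<close> depends on
  \<open>m\<close> because the branches of a conditional have their own outcome sets.\<close>

lemma isometric_family_comp:
  assumes M: "isometric_family X J M" and N: "\<And>m. m \<in> J \<Longrightarrow> isometric_family X (I m) (N m)"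
  shows "isometric_family X (Sigma J I) (\<lambda>(m, n). N m n \<circ> M m)"
proof -
  have "((\<lambda>p. (ell2_norm X ((case p of (m, n) \<Rightarrow> N m n \<circ> M m) x))\<^sup>2) has_sum (ell2_norm X x)\<^sup>2) (Sigma J I)"
    if x: "x \<in> ell2 X" for x
  proof -
    have 1: "((\<lambda>n. (ell2_norm X ((case (m, n) of (m, n) \<Rightarrow> N m n \<circ> M m) x))\<^sup>2) has_sum
        (ell2_norm X (M m x))\<^sup>2) (I m)" if m: "m \<in> J" for m
      using isometric_familyD(2)[OF N[OF m] bounded_oper_ell2[OF isometric_familyD(1)[OF M m] x]] by simp
    note 2 = isometric_familyD(2)[OF M x]
    show ?thesis
      by (rule has_sum_SigmaI[OF 1 2 summable_on_SigmaI[OF 1 has_sum_imp_summable[OF 2]]]) auto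
  qed
  then show ?thesis
    using M N by (auto simp: isometric_family_def intro: bounded_oper_comp)
qed

section \<open>Decompositions into rank-one operators\<close>

text \<open>The second clause expresses finite trace. The third describes \<open>\<rho>\<close> on
  \<open>ell2 X\<close> and coordinatewise, in the same way as the sums in \<open>psem\<close> are
  taken.\<close>

definition decomposition :: "'a set \<Rightarrow> 'a oper \<Rightarrow> 'k set \<Rightarrow> ('k \<Rightarrow> 'a vec) \<Rightarrow> bool" where
  "decomposition X \<rho> K v \<longleftrightarrow> (\<forall>k\<in>K. v k \<in> ell2 X) \<and>
     (\<lambda>k. (ell2_norm X (v k))\<^sup>2) summable_on K \<and>
     (\<forall>x\<in>ell2 X. \<forall>s. \<rho> x s = (\<Sum>\<^sub>\<infinity>k\<in>K. ip X (v k) x * v k s))"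

lemma decompositionD:
  assumes "decomposition X \<rho> K v"
  shows "k \<in> K \<Longrightarrow> v k \<in> ell2 X" and "(\<lambda>k. (ell2_norm X (v k))\<^sup>2) summable_on K"
    and "x \<in> ell2 X \<Longrightarrow> \<rho> x s = (\<Sum>\<^sub>\<infinity>k\<in>K. ip X (v k) x * v k s)"
  using assms by (auto simp: decomposition_def)

text \<open>By Cauchy-Schwarz the summand is at most a constant times the squared norm of
  \<open>v k\<close>. In the applications \<open>c k\<close> is a coordinate of \<open>v k\<close>,
  an inner product with it, or a sum of moduli.\<close>

lemma decomposition_abs_summable:
  assumes v: "\<And>k. k \<in> K \<Longrightarrow> v k \<in> ell2 X" and s: "(\<lambda>k. (ell2_norm X (v k))\<^sup>2) summable_on K"
    and x: "x \<in> ell2 X" and c: "\<And>k. k \<in> K \<Longrightarrow> cmod (c k) \<le> C * ell2_norm X (v k)"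
  shows "(\<lambda>k. norm (ip X (v k) x * c k)) summable_on K"
proof (rule summable_on_comparison_test)
  show "(\<lambda>k. ell2_norm X x * C * (ell2_norm X (v k))\<^sup>2) summable_on K"
    by (rule summable_on_cmult_right[OF s])
  show "norm (ip X (v k) x * c k) \<le> ell2_norm X x * C * (ell2_norm X (v k))\<^sup>2" if "k \<in> K" for k
  proof -
    have "norm (ip X (v k) x * c k) \<le> (ell2_norm X (v k) * ell2_norm X x) * (C * ell2_norm X (v k))"
      unfolding norm_mult using ip_cauchy_schwarz[OF v[OF that] x] c[OF that]
      by (intro mult_mono) auto
    then show ?thesis by (simp add: power2_eq_square mult_ac)
  qed
qed simp

lemma decomposition_cong:
  assumes "decomposition X \<rho> K v" "\<And>x s. x \<in> ell2 X \<Longrightarrow> \<rho>' x s = \<rho> x s" "\<And>k. k \<in> K \<Longrightarrow> w k = v k"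
  shows "decomposition X \<rho>' K w"
  using assms by (auto simp: decomposition_def cong: summable_on_cong infsum_cong)

lemma decomposition_reindex:
  assumes "decomposition X \<rho> K v" and f: "bij_betw f I K"
  shows "decomposition X \<rho> I (v \<circ> f)"
  using assms(1) bij_betwE[OF f] summable_on_reindex_bij_betw[OF f, of "\<lambda>k. (ell2_norm X (v k))\<^sup>2"]
    infsum_reindex_bij_betw[OF f, of "\<lambda>k. ip X (v k) x * v k s" for x s]
  by (auto simp: decomposition_def)

text \<open>For a truncation z of \<open>\<rho> x\<close> the squared norm of z is the sum of the
  products \<open>ip X (v k) x * ip X z (v k)\<close>, hence at most S times the norms of x and z.
  The trace S thus bounds the operator.\<close>

lemma decomposition_ell2:
  assumes "decomposition X \<rho> K v" and x: "x \<in> ell2 X"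
  shows "\<rho> x \<in> ell2 X"
proof -
  note v = decompositionD[OF assms(1)]
  define S where "S = (\<Sum>\<^sub>\<infinity>k\<in>K. (ell2_norm X (v k))\<^sup>2)"
  show ?thesis
  proof (rule ell2I_truncations[where C = "ell2_norm X x * S"])
    fix i assume "i \<notin> X"
    then show "\<rho> x i = 0" using v(1)[THEN ell2_outside] by (simp add: v(3)[OF x] cong: infsum_cong)
  next
    fix F assume F: "finite F" "F \<subseteq> X"
    define z where "z = (\<lambda>i. if i \<in> F then \<rho> x i else 0)"
    have F': "z i = 0" if "i \<notin> F" for i using that by (simp add: z_def)
    have z: "z \<in> ell2 X" and nz: "(ell2_norm X z)\<^sup>2 = (\<Sum>i\<in>F. (cmod (\<rho> x i))\<^sup>2)"
      using ell2_finite_support[OF F F'] by (simp_all add: z_def)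
    have nz': "sqrt (\<Sum>i\<in>F. (cmod (\<rho> x i))\<^sup>2) = ell2_norm X z"
      using nz by (metis ell2_norm_nonneg real_sqrt_unique)
    have coord: "((\<lambda>k. ip X (v k) x * v k i) has_sum \<rho> x i) K" for i
    proof -
      have "(\<lambda>k. norm (ip X (v k) x * v k i)) summable_on K"
        by (rule decomposition_abs_summable[where C = 1, OF v(1,2) x])
          (auto intro: ell2_coord_le v(1))
      then show ?thesis by (simp add: v(3)[OF x] abs_summable_summable)
    qed
    have "((\<lambda>k. \<Sum>i\<in>F. cnj (z i) * (ip X (v k) x * v k i)) has_sum (\<Sum>i\<in>F. cnj (z i) * \<rho> x i)) K"
      by (intro has_sum_finite_sum has_sum_cmult_right coord)
    moreover have "(\<Sum>i\<in>F. cnj (z i) * (ip X (v k) x * v k i)) = ip X (v k) x * ip X z (v k)" for k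
      by (simp add: ip_finite_left[OF F F'] sum_distrib_left mult.left_commute)
    moreover have "(\<Sum>i\<in>F. cnj (z i) * \<rho> x i) = of_real ((ell2_norm X z)\<^sup>2)"
      unfolding nz of_real_sum complex_norm_square
      by (rule sum.cong) (simp_all add: z_def mult.commute)
    ultimately have hs: "((\<lambda>k. ip X (v k) x * ip X z (v k)) has_sum of_real ((ell2_norm X z)\<^sup>2)) K"
      by simp
    have as: "(\<lambda>k. norm (ip X (v k) x * ip X z (v k))) summable_on K"
      by (rule decomposition_abs_summable[where C = "ell2_norm X z", OF v(1,2) x])
        (auto intro: ip_cauchy_schwarz z v(1))
    have "(ell2_norm X z)\<^sup>2 = norm (\<Sum>\<^sub>\<infinity>k\<in>K. ip X (v k) x * ip X z (v k))"
      using infsumI[OF hs] by (simp only: norm_of_real) simp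
    also have "\<dots> \<le> (\<Sum>\<^sub>\<infinity>k\<in>K. norm (ip X (v k) x * ip X z (v k)))"
      by (rule norm_infsum_bound[OF as])
    also have "\<dots> \<le> (\<Sum>\<^sub>\<infinity>k\<in>K. (ell2_norm X x * ell2_norm X z) * (ell2_norm X (v k))\<^sup>2)"
    proof (rule infsum_mono[OF as summable_on_cmult_right[OF v(2)]])
      fix k assume k: "k \<in> K"
      have "norm (ip X (v k) x * ip X z (v k))
          \<le> (ell2_norm X (v k) * ell2_norm X x) * (ell2_norm X z * ell2_norm X (v k))"
        unfolding norm_mult
        by (intro mult_mono ip_cauchy_schwarz x z v(1) k) auto
      then show "norm (ip X (v k) x * ip X z (v k))
          \<le> (ell2_norm X x * ell2_norm X z) * (ell2_norm X (v k))\<^sup>2"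
        by (simp add: power2_eq_square mult_ac)
    qed
    also have "\<dots> = ell2_norm X x * ell2_norm X z * S"
      unfolding S_def by (rule infsum_cmult_right') 
    finally show "(\<Sum>i\<in>F. (cmod (\<rho> x i))\<^sup>2) \<le> ell2_norm X x * S * sqrt (\<Sum>i\<in>F. (cmod (\<rho> x i))\<^sup>2)"
      unfolding nz' nz by (simp add: mult_ac)
  qed
qed

text \<open>Cauchy-Schwarz applied to moduli bounds the sum of the moduli of the products, as
  absolute summability of a double sum requires.\<close>

lemma ell2_modulus:
  assumes "x \<in> ell2 X"
  shows "(\<lambda>i. complex_of_real (cmod (x i))) \<in> ell2 X"
    and "ell2_norm X (\<lambda>i. complex_of_real (cmod (x i))) = ell2_norm X x"
  using assms by (simp_all add: ell2_def ell2_norm_def)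

text \<open>The sums over coordinates and over \<open>k\<close> may be exchanged: the moduli, summed
  over the coordinates, are at most a constant times the squared norm of \<open>v k\<close>.\<close>

lemma decomposition_ip:
  assumes "decomposition X \<rho> K v" and x: "x \<in> ell2 X" and a: "a \<in> ell2 X"
  shows "ip X a (\<rho> x) = (\<Sum>\<^sub>\<infinity>k\<in>K. ip X (v k) x * ip X a (v k))"
proof -
  note v = decompositionD[OF assms(1)]
  define f where "f = (\<lambda>(k, i). ip X (v k) x * (cnj (a i) * v k i))"
  define g where "g k = (\<Sum>\<^sub>\<infinity>i\<in>X. cmod (cnj (a i) * v k i))" for k
  have g: "((\<lambda>i. norm (f (k, i))) has_sum norm (ip X (v k) x) * g k) X" if "k \<in> K" for k
    unfolding f_def g_def prod.case norm_mult[of "ip X (v k) x"]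
    by (intro has_sum_cmult_right has_sum_infsum ip_abs_summable a v(1) that)
  have "0 \<le> g k" for k by (simp add: g_def infsum_nonneg)
  moreover have "g k \<le> ell2_norm X a * ell2_norm X (v k)" if "k \<in> K" for k
  proof -
    have "ip X (\<lambda>i. of_real (cmod (a i))) (\<lambda>i. of_real (cmod (v k i))) = of_real (g k)"
      unfolding ip_def g_def
      by (rule infsumI) (simp add: norm_mult has_sum_of_real_iff flip: of_real_mult,
          use ip_abs_summable[OF a v(1)[OF that]] in \<open>simp add: norm_mult\<close>)
    then have "cmod (of_real (g k)) \<le> ell2_norm X a * ell2_norm X (v k)"
      using ip_cauchy_schwarz[OF ell2_modulus(1)[OF a] ell2_modulus(1)[OF v(1)[OF that]]]
        ell2_modulus(2)[OF a] ell2_modulus(2)[OF v(1)[OF that]] by simp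
    then show ?thesis by simp
  qed
  ultimately have "(\<lambda>k. norm (ip X (v k) x * of_real (g k))) summable_on K"
    by (intro decomposition_abs_summable[where C = "ell2_norm X a", OF v(1,2) x]) auto
  then have "(\<lambda>k. norm (ip X (v k) x) * g k) summable_on K"
    using \<open>\<And>k. 0 \<le> g k\<close> by (simp add: norm_mult)
  then have "(\<lambda>p. norm (f p)) summable_on K \<times> X"
    by (intro summable_on_SigmaI[OF g]) auto
  then have "f summable_on K \<times> X" by (rule abs_summable_summable)
  then have s: "(\<lambda>(k, i). ip X (v k) x * (cnj (a i) * v k i)) summable_on K \<times> X" by (simp add: f_def)
  have "ip X a (\<rho> x) = (\<Sum>\<^sub>\<infinity>i\<in>X. \<Sum>\<^sub>\<infinity>k\<in>K. ip X (v k) x * (cnj (a i) * v k i))"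
    unfolding ip_def v(3)[OF x] infsum_cmult_right'[symmetric] by (simp add: mult.left_commute)
  also have "\<dots> = (\<Sum>\<^sub>\<infinity>k\<in>K. \<Sum>\<^sub>\<infinity>i\<in>X. ip X (v k) x * (cnj (a i) * v k i))"
    by (rule infsum_swap_banach[OF s, symmetric])
  also have "\<dots> = (\<Sum>\<^sub>\<infinity>k\<in>K. ip X (v k) x * ip X a (v k))"
    unfolding ip_def[of X a] infsum_cmult_right' ..
  finally show ?thesis .
qed

text \<open>The coordinate of T y at \<open>s\<close> is the inner product of y with the adjoint
  image of \<open>ket s\<close>. Through \<open>decomposition_ip\<close> this moves \<open>T\<close>
  past the infinite sum without any topology on operators.\<close>

lemma decomposition_conjugate:
  assumes \<rho>: "decomposition X \<rho> K v" and T: "bounded_oper X T"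
  shows "decomposition X (T \<circ> \<rho> \<circ> adj X T) K (\<lambda>k. T (v k))"
proof -
  note v = decompositionD[OF \<rho>]
  obtain C where C: "C \<ge> 0" "\<And>x. x \<in> ell2 X \<Longrightarrow> ell2_norm X (T x) \<le> C * ell2_norm X x"
    using bounded_oper_bound[OF T] by blast
  note Tv = bounded_oper_ell2[OF T v(1)]
  have "(\<lambda>k. (ell2_norm X (T (v k)))\<^sup>2) summable_on K"
  proof (rule summable_on_comparison_test)
    show "(\<lambda>k. C\<^sup>2 * (ell2_norm X (v k))\<^sup>2) summable_on K" by (rule summable_on_cmult_right[OF v(2)])
    show "(ell2_norm X (T (v k)))\<^sup>2 \<le> C\<^sup>2 * (ell2_norm X (v k))\<^sup>2" if "k \<in> K" for k
      using power_mono[OF C(2)[OF v(1)[OF that]], of 2] by (simp add: power_mult_distrib)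
  qed simp
  moreover have "(T \<circ> \<rho> \<circ> adj X T) x s = (\<Sum>\<^sub>\<infinity>k\<in>K. ip X (T (v k)) x * T (v k) s)"
    if x: "x \<in> ell2 X" for x s
  proof -
    note w = adj_ell2[OF T x]
    note \<rho>w = decomposition_ell2[OF \<rho> w]
    show ?thesis
    proof (cases "s \<in> X")
      case True
      note a = adj_ell2[OF T ket_ell2[OF True]]
      have coord: "T y s = ip X (adj X T (ket s)) y" if "y \<in> ell2 X" for y
        using arg_cong[OF ip_adj[OF T that ket_ell2[OF True]], of cnj] True
        by (simp add: ip_cnj ip_ket_left)
      have "T (\<rho> (adj X T x)) s = (\<Sum>\<^sub>\<infinity>k\<in>K. ip X (v k) (adj X T x) * ip X (adj X T (ket s)) (v k))"
        by (simp add: coord \<rho>w decomposition_ip[OF \<rho> w a])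
      also have "\<dots> = (\<Sum>\<^sub>\<infinity>k\<in>K. ip X (T (v k)) x * T (v k) s)"
        by (rule infsum_cong) (simp add: coord v(1) ip_adj[OF T v(1) x])
      finally show ?thesis by simp
    next
      case False
      then show ?thesis
        using ell2_outside[OF bounded_oper_ell2[OF T \<rho>w] False] ell2_outside[OF Tv False]
        by (simp add: infsum_0)
    qed
  qed
  ultimately show ?thesis using Tv by (simp add: decomposition_def)
qed

text \<open>Summability for each single \<open>m\<close> would not bound the total trace, so it is
  assumed jointly over \<open>Sigma J K\<close>; the sums are then merged by absolute
  convergence.\<close>

lemma decomposition_infsum:
  assumes \<rho>: "\<And>m. m \<in> J \<Longrightarrow> decomposition X (\<rho> m) (K m) (v m)"
    and s: "(\<lambda>(m, k). (ell2_norm X (v m k))\<^sup>2) summable_on Sigma J K"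
  shows "decomposition X (\<lambda>x s. \<Sum>\<^sub>\<infinity>m\<in>J. \<rho> m x s) (Sigma J K) (\<lambda>(m, k). v m k)"
proof -
  let ?w = "\<lambda>(m, k). v m k"
  have w: "?w p \<in> ell2 X" if "p \<in> Sigma J K" for p
    using that \<rho> by (auto dest: decompositionD(1))
  have s': "(\<lambda>p. (ell2_norm X (?w p))\<^sup>2) summable_on Sigma J K"
    using s by (simp add: case_prod_unfold)
  have "(\<Sum>\<^sub>\<infinity>m\<in>J. \<rho> m x s) = (\<Sum>\<^sub>\<infinity>p\<in>Sigma J K. ip X (?w p) x * ?w p s)" if x: "x \<in> ell2 X" for x s
  proof -
    have "(\<lambda>p. norm (ip X (?w p) x * ?w p s)) summable_on Sigma J K"
      by (rule decomposition_abs_summable[where C = 1, OF w s' x]) (use ell2_coord_le[OF w] in auto)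
    then have "(\<lambda>p. ip X (?w p) x * ?w p s) summable_on Sigma J K" by (rule abs_summable_summable)
    then have "(\<Sum>\<^sub>\<infinity>p\<in>Sigma J K. ip X (?w p) x * ?w p s)
        = (\<Sum>\<^sub>\<infinity>m\<in>J. \<Sum>\<^sub>\<infinity>k\<in>K m. ip X (v m k) x * v m k s)"
      by (subst infsum_Sigma_banach[symmetric]) auto
    also have "\<dots> = (\<Sum>\<^sub>\<infinity>m\<in>J. \<rho> m x s)"
      by (rule infsum_cong) (simp add: decompositionD(3)[OF \<rho> x])
    finally show ?thesis by simp
  qed
  then show ?thesis using w s' by (simp add: decomposition_def)
qed

text \<open>Summed over the outcomes first, the terms leave the squared norm of \<open>v k\<close>.
  This supplies the joint summability that sums over outcomes require.\<close>

lemma isometric_family_summable: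
  assumes M: "isometric_family X J M" and \<rho>: "decomposition X \<rho> K v"
  shows "(\<lambda>(m, k). (ell2_norm X (M m (v k)))\<^sup>2) summable_on J \<times> K"
proof -
  have "(\<lambda>(k, m). (ell2_norm X (M m (v k)))\<^sup>2) summable_on K \<times> J"
    by (rule summable_on_SigmaI)
      (use isometric_familyD(2)[OF M decompositionD(1)[OF \<rho>]] decompositionD(2)[OF \<rho>] in auto)
  then show ?thesis by (subst (asm) summable_on_swap) simp
qed

subsection \<open>Cholesky decomposition of density operators\<close>

text \<open>Linearity, invariance of \<open>ell2 X\<close> and positivity are what an elimination
  step preserves without any tracking of norm bounds.\<close>

definition positive_oper :: "'a set \<Rightarrow> 'a oper \<Rightarrow> bool" where
  "positive_oper X R \<longleftrightarrow> (\<forall>x\<in>ell2 X. R x \<in> ell2 X \<and> ip X x (R x) \<in> \<real>\<^sub>\<ge>\<^sub>0) \<and>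
     (\<forall>x\<in>ell2 X. \<forall>y\<in>ell2 X. \<forall>c. R (\<lambda>i. x i + c * y i) = (\<lambda>i. R x i + c * R y i))"

lemma positive_operD:
  assumes "positive_oper X R"
  shows "x \<in> ell2 X \<Longrightarrow> R x \<in> ell2 X" and "x \<in> ell2 X \<Longrightarrow> ip X x (R x) \<in> \<real>\<^sub>\<ge>\<^sub>0"
    and "x \<in> ell2 X \<Longrightarrow> y \<in> ell2 X \<Longrightarrow> R (\<lambda>i. x i + c * y i) = (\<lambda>i. R x i + c * R y i)"
  using assms by (auto simp: positive_oper_def)

lemma positive_oper_form:
  assumes R: "positive_oper X R" and x: "x \<in> ell2 X" and y: "y \<in> ell2 X"
  shows "ip X y (R x) = cnj (ip X x (R y))"
    and "(cmod (ip X x (R y)))\<^sup>2 \<le> Re (ip X x (R x)) * Re (ip X y (R y))"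
proof -
  note D = positive_operD[OF R]
  note form = positive_form[where V = "ell2 X" and h = "\<lambda>x y. ip X x (R y)"]
  show "ip X y (R x) = cnj (ip X x (R y))"
    by (rule form(1)) (use x y in \<open>simp_all add: D ell2_add_scale ip_add_scale_right ip_add_scale_left\<close>)
  show "(cmod (ip X x (R y)))\<^sup>2 \<le> Re (ip X x (R x)) * Re (ip X y (R y))"
    by (rule form(2)) (use x y in \<open>simp_all add: D ell2_add_scale ip_add_scale_right ip_add_scale_left\<close>)
qed

text \<open>The form is hermitian, so row \<open>i\<close> is the conjugate of column
  \<open>i\<close>: once \<open>R (ket i)\<close> vanishes, every \<open>R x\<close> vanishes at
  \<open>i\<close>.\<close>

lemma positive_oper_coord:
  assumes "positive_oper X R" "i \<in> X" "x \<in> ell2 X"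
  shows "R x i = cnj (ip X x (R (ket i)))"
  using positive_oper_form(1)[OF assms(1,3) ket_ell2[OF assms(2)]] assms(2) by (simp add: ip_ket_left)

text \<open>By Cauchy-Schwarz an entry is at most the geometric mean of the two diagonal entries in
  its row and column.\<close>

lemma positive_oper_diag_0:
  assumes R: "positive_oper X R" and i: "i \<in> X" and 0: "Re (R (ket i) i) = 0"
  shows "R (ket i) = (\<lambda>j. 0)"
proof
  fix j show "R (ket i) j = 0"
  proof (cases "j \<in> X")
    case True
    then show ?thesis
      using positive_oper_form(2)[OF R ket_ell2[OF True] ket_ell2[OF i]] i 0 by (simp add: ip_ket_left)
  qed (simp add: ell2_outside[OF positive_operD(1)[OF R ket_ell2[OF i]]])
qed

text \<open>If the diagonal entry vanishes, \<open>1 / sqrt 0 = 0\<close> makes this the zero vector, which is right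
  because the whole column \<open>R (ket i)\<close> then vanishes.\<close>

definition cholesky_vec :: "'a oper \<Rightarrow> 'a \<Rightarrow> 'a vec" where
  "cholesky_vec R i = (\<lambda>j. complex_of_real (1 / sqrt (Re (R (ket i) i))) * R (ket i) j)"

definition schur_complement :: "'a set \<Rightarrow> 'a oper \<Rightarrow> 'a \<Rightarrow> 'a oper" where
  "schur_complement X R i =
     (\<lambda>x j. R x j - ip X (cholesky_vec R i) x * cholesky_vec R i j)"

lemma cholesky_vec_ell2: "positive_oper X R \<Longrightarrow> i \<in> X \<Longrightarrow> cholesky_vec R i \<in> ell2 X"
  unfolding cholesky_vec_def by (intro ell2_scale positive_operD(1)[of X R]) auto

text \<open>With w the removed vector and d the diagonal entry, the squared modulus of
  \<open>ip X x w\<close> is that of \<open>ip X x (R (ket i))\<close> divided by d. Cauchy-Schwarz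
  for the form of \<open>R\<close> bounds it by the value of the form at x.\<close>

lemma positive_oper_schur_complement:
  assumes R: "positive_oper X R" and i: "i \<in> X"
  shows "positive_oper X (schur_complement X R i)"
proof -
  note D = positive_operD[OF R]
  define w where "w = cholesky_vec R i"
  have w: "w \<in> ell2 X" unfolding w_def by (rule cholesky_vec_ell2[OF R i])
  define d where "d = Re (R (ket i) i)"
  have d: "d \<ge> 0"
    using D(2)[OF ket_ell2[OF i]] i by (simp add: d_def ip_ket_left complex_nonneg_Reals_iff)
  show ?thesis
    unfolding positive_oper_def
  proof (intro conjI ballI allI)
    fix x assume x: "x \<in> ell2 X"
    show "schur_complement X R i x \<in> ell2 X"
      unfolding schur_complement_def w_def[symmetric] by (intro ell2_diff ell2_scale D(1) x w)
    have "ip X x (schur_complement X R i x) = ip X x (R x) - ip X w x * ip X x w"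
      unfolding schur_complement_def w_def[symmetric]
      by (subst ip_diff_right) (auto simp: x w D(1) ell2_scale ip_scale_right)
    also have "\<dots> = ip X x (R x) - of_real ((cmod (ip X x w))\<^sup>2)"
      unfolding complex_norm_square ip_cnj by simp
    finally have eq: "ip X x (schur_complement X R i x) = ip X x (R x) - of_real ((cmod (ip X x w))\<^sup>2)" .
    have "ip X x w = of_real (1 / sqrt d) * ip X x (R (ket i))"
      unfolding w_def cholesky_vec_def d_def by (rule ip_scale_right)
    then have "(cmod (ip X x w))\<^sup>2 = (1 / d) * (cmod (ip X x (R (ket i))))\<^sup>2"
      using d by (simp add: norm_mult power_mult_distrib norm_divide power_divide)
    also have "\<dots> \<le> (1 / d) * (Re (ip X x (R x)) * d)"
      using positive_oper_form(2)[OF R x ket_ell2[OF i]] i d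
      by (intro mult_left_mono) (auto simp: ip_ket_left d_def)
    \<comment> \<open>Not an equality: for d = 0 the left side is 0, because 1 / 0 = 0.\<close>
    also have "\<dots> \<le> Re (ip X x (R x))"
      using D(2)[OF x] by (simp add: complex_nonneg_Reals_iff)
    finally show "ip X x (schur_complement X R i x) \<in> \<real>\<^sub>\<ge>\<^sub>0"
      unfolding eq using D(2)[OF x] by (simp add: complex_nonneg_Reals_iff)
  next
    fix x y c assume "x \<in> ell2 X" "y \<in> ell2 X"
    then show "schur_complement X R i (\<lambda>j. x j + c * y j)
        = (\<lambda>j. schur_complement X R i x j + c * schur_complement X R i y j)"
      unfolding schur_complement_def w_def[symmetric]
      by (simp add: D(3) ip_add_scale_right w algebra_simps)
  qed
qed

text \<open>The removed vector has inner product sqrt d with \<open>ket i\<close>, which cancels its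
  factor 1 / sqrt d, so exactly the column \<open>R (ket i)\<close> is subtracted.\<close>

lemma schur_complement_ket:
  assumes R: "positive_oper X R" and i: "i \<in> X"
  shows "schur_complement X R i (ket i) = (\<lambda>j. 0)"
proof -
  define d where "d = Re (R (ket i) i)"
  have d: "d \<ge> 0" "R (ket i) i = of_real d"
    using positive_operD(2)[OF R ket_ell2[OF i]] i
    by (simp_all add: d_def ip_ket_left complex_nonneg_Reals_iff complex_eq_iff)
  show ?thesis
  proof (cases "d = 0")
    case True
    then show ?thesis
      using positive_oper_diag_0[OF R i] by (simp add: d_def schur_complement_def cholesky_vec_def)
  next
    case False
    have "ip X (cholesky_vec R i) (ket i) = of_real (1 / sqrt d) * of_real d"
      using i d by (simp add: ip_ket_right cholesky_vec_def)
    then have "ip X (cholesky_vec R i) (ket i) = of_real (sqrt d)"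
      using d(1) by (simp add: real_div_sqrt flip: of_real_mult of_real_divide)
    then show ?thesis
      using False d by (simp add: schur_complement_def cholesky_vec_def)
  qed
qed

text \<open>Elimination never refills a cleared column, and the vectors removed later vanish at its
  index. This makes each coordinate of the decomposition a finite sum.\<close>

lemma schur_complement_null:
  assumes R: "positive_oper X R" and i: "i \<in> X" and j: "j \<in> X" and 0: "R (ket j) = (\<lambda>k. 0)"
  shows "cholesky_vec R i j = 0" and "schur_complement X R i (ket j) = (\<lambda>k. 0)"
proof -
  show w: "cholesky_vec R i j = 0"
    using positive_oper_coord[OF R j ket_ell2[OF i]] 0 by (simp add: cholesky_vec_def)
  then show "schur_complement X R i (ket j) = (\<lambda>k. 0)"
    using 0 j by (simp add: schur_complement_def ip_ket_right)
qed

primrec cholesky_seq :: "'a set \<Rightarrow> 'a oper \<Rightarrow> (nat \<Rightarrow> 'a) \<Rightarrow> nat \<Rightarrow> 'a oper" where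
  "cholesky_seq X R f 0 = R"
| "cholesky_seq X R f (Suc n) = schur_complement X (cholesky_seq X R f n) (f n)"

text \<open>No limit of the remainders \<open>R n\<close> is taken: their coordinate j is 0 once
  column j is cleared, so at j the telescoping identity is exact from some n on.\<close>

lemma partial_density_decomposition:
  assumes "partial_density X \<rho>"
  shows "\<exists>(K :: nat set) v. decomposition X \<rho> K v"
proof -
  have b: "bounded_oper X \<rho>" and pos: "\<And>x. x \<in> ell2 X \<Longrightarrow> ip X x (\<rho> x) \<in> \<real>\<^sub>\<ge>\<^sub>0"
    and "(\<lambda>i. Re (ip X (ket i) (\<rho> (ket i)))) summable_on X"
    using assms by (auto simp: partial_density_def)
  then have tr: "(\<lambda>i. Re (\<rho> (ket i) i)) summable_on X"
    by (simp add: ip_ket_left cong: summable_on_cong)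
  have R0: "positive_oper X \<rho>"
    unfolding positive_oper_def
    using pos bounded_oper_ell2[OF b] bounded_oper_add_scale[OF b] by blast
  define D where "D = {i \<in> X. Re (\<rho> (ket i) i) \<noteq> 0}"
  have "countable D" unfolding D_def by (rule summable_countable_real[OF tr])
  have null: "\<rho> (ket j) = (\<lambda>k. 0)" if "j \<in> X" "j \<notin> D" for j
    using positive_oper_diag_0[OF R0] that by (simp add: D_def)
  show ?thesis
  proof (cases "D = {}")
    case True
    have "\<rho> x s = 0" if x: "x \<in> ell2 X" for x s
    proof (cases "s \<in> X")
      case s: True
      then show ?thesis using positive_oper_coord[OF R0 s x] null True by simp
    qed (simp add: ell2_outside[OF bounded_oper_ell2[OF b x]])
    then have "decomposition X \<rho> {} (\<lambda>_::nat. (\<lambda>i. 0))" by (simp add: decomposition_def)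
    then show ?thesis by blast
  next
    case False
    \<comment> \<open>If \<open>D\<close> is finite the enumeration repeats elements; eliminating a
      cleared column only removes the zero vector.\<close>
    define f where "f = from_nat_into D"
    have f: "range f = D" unfolding f_def using False \<open>countable D\<close> by (rule range_from_nat_into)
    then have fX: "f n \<in> X" for n by (auto simp: D_def)
    define R where "R = cholesky_seq X \<rho> f"
    define w where "w n = cholesky_vec (R n) (f n)" for n
    have RS: "R (Suc n) = schur_complement X (R n) (f n)" for n by (simp add: R_def)
    have Rp: "positive_oper X (R n)" for n
      by (induction n) (simp_all add: R_def R0 positive_oper_schur_complement fX)
    have w: "w n \<in> ell2 X" for n unfolding w_def by (rule cholesky_vec_ell2[OF Rp fX])
    have step: "R (n + k) (ket j) = (\<lambda>i. 0)" if "R n (ket j) = (\<lambda>i. 0)" "j \<in> X" for n k j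
      using that
    proof (induction k)
      case (Suc k)
      then show ?case using schur_complement_null(2)[OF Rp fX] RS by simp
    qed simp
    have ex: "\<exists>n. R n (ket j) = (\<lambda>i. 0)" if "j \<in> X" for j
    proof (cases "j \<in> D")
      case True
      then obtain n where "j = f n" using f by blast
      then have "R (Suc n) (ket j) = (\<lambda>i. 0)" using schur_complement_ket[OF Rp fX] RS by simp
      then show ?thesis by blast
    next
      case False
      then show ?thesis using null that by (intro exI[of _ 0]) (simp add: R_def)
    qed
    have telescope: "\<rho> x j = R n x j + (\<Sum>k<n. ip X (w k) x * w k j)" for n x j
    proof (induction n)
      case (Suc n)
      then show ?case by (simp add: RS schur_complement_def w_def)
    qed (simp add: R_def)
    have sum: "((\<lambda>k. ip X (w k) x * w k j) has_sum \<rho> x j) UNIV" if x: "x \<in> ell2 X" for x j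
    proof (cases "j \<in> X")
      case True
      obtain n where n: "R n (ket j) = (\<lambda>i. 0)" using ex True by blast
      have "w k j = 0" if "k \<ge> n" for k
        using schur_complement_null(1)[OF Rp fX True step[OF n True, of "k - n"]] that
        by (simp add: w_def)
      then have "((\<lambda>k. ip X (w k) x * w k j) has_sum (\<Sum>k<n. ip X (w k) x * w k j)) UNIV"
        by (intro has_sum_finite_neutralI) auto
      moreover have "R n x j = 0" using positive_oper_coord[OF Rp True x] n by simp
      ultimately show ?thesis using telescope[of x j n] by simp
    next
      case False
      then show ?thesis
        using ell2_outside[OF w] ell2_outside[OF bounded_oper_ell2[OF b x]] by simp
    qed
    have col: "((\<lambda>k. (cmod (w k j))\<^sup>2) has_sum Re (\<rho> (ket j) j)) UNIV" if j: "j \<in> X" for j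
    proof -
      have "ip X (w k) (ket j) * w k j = of_real ((cmod (w k j))\<^sup>2)" for k
        using j by (simp only: ip_ket_right complex_norm_square mult.commute)
      then show ?thesis
        using has_sum_Re[OF sum[OF ket_ell2[OF j], of j]] by simp
    qed
    \<comment> \<open>Summed over k first, the terms give the diagonal entries of
      \<open>\<rho>\<close> and so its trace; summed over j first, they give the squared norms of
      the vectors.\<close>
    have "(\<lambda>(j, k). (cmod (w k j))\<^sup>2) summable_on X \<times> UNIV"
      by (rule summable_on_SigmaI) (use col tr in auto)
    then have s: "(\<lambda>(k, j). (cmod (w k j))\<^sup>2) summable_on UNIV \<times> X"
      by (subst (asm) summable_on_swap) simp
    have "(\<lambda>k. (ell2_norm X (w k))\<^sup>2) summable_on UNIV"
    proof (rule has_sum_imp_summable[OF has_sum_SigmaD[OF has_sum_infsum[OF s]]])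
      show "((\<lambda>j. case (k, j) of (k, j) \<Rightarrow> (cmod (w k j))\<^sup>2) has_sum (ell2_norm X (w k))\<^sup>2) X" for k
        using ell2_norm_has_sum[OF w] by simp
    qed
    then have "decomposition X \<rho> UNIV w"
      unfolding decomposition_def using w infsumI[OF sum, symmetric] by simp
    then show ?thesis by blast
  qed
qed

section \<open>Registers and extended operators\<close>

lemma reg_iff: "bs \<in> reg B qs \<longleftrightarrow> list_all2 (\<lambda>b q. b \<in> B q) bs qs"
proof -
  have "bs \<in> listset (map B qs) \<longleftrightarrow> list_all2 (\<lambda>b q. b \<in> B q) bs qs"
    by (induction qs arbitrary: bs) (auto simp: set_Cons_def list_all2_Cons2)
  then show ?thesis by (simp add: reg_def)
qed

lemma reg_length: "bs \<in> reg B qs \<Longrightarrow> length bs = length qs"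
  by (auto simp: reg_iff dest: list_all2_lengthD)

lemma map_in_reg: "s \<in> mems B \<Longrightarrow> map s qs \<in> reg B qs"
  by (auto simp: reg_iff mems_def list_all2_conv_all_nth)

lemma put_map: "put qs (map t qs) s = (\<lambda>q. if q \<in> set qs then t q else s q)"
  by (auto simp: put_def map_of_zip_map)

lemma put_same [simp]: "put qs (map s qs) s = s"
  by (auto simp: put_map)

lemma map_put:
  assumes "distinct qs" "length bs = length qs"
  shows "map (put qs bs s) qs = bs"
proof (rule nth_equalityI)
  fix i assume "i < length (map (put qs bs s) qs)"
  then show "map (put qs bs s) qs ! i = bs ! i"
    using assms map_of_zip_nth[of qs bs i] by (simp add: put_def)
qed (use assms in simp)

lemma reg_eq_map:
  assumes "distinct qs" "bs \<in> reg B qs"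
  obtains t where "bs = map t qs" "\<forall>q\<in>set qs. t q \<in> B q"
proof -
  have eq: "map (put qs bs undefined) qs = bs" by (rule map_put) (use assms reg_length in auto)
  moreover have "list_all2 (\<lambda>b q. b \<in> B q) (map (put qs bs undefined) qs) qs"
    unfolding eq using assms(2) by (simp add: reg_iff)
  then have "\<forall>q\<in>set qs. put qs bs undefined q \<in> B q"
    by (auto simp: list_all2_conv_all_nth in_set_conv_nth)
  ultimately show ?thesis using that by metis
qed

definition slice :: "('v \<Rightarrow> 'b set) \<Rightarrow> 'v list \<Rightarrow> ('v \<Rightarrow> 'b) vec \<Rightarrow> ('v \<Rightarrow> 'b) \<Rightarrow> 'b list vec" where
  "slice B qs x s = (\<lambda>bs. if bs \<in> reg B qs then x (put qs bs s) else 0)"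

lemma lift_slice: "lift B qs T x s = (if s \<in> mems B then T (slice B qs x s) (map s qs) else 0)"
  by (simp add: lift_def slice_def)

text \<open>A canonical representative of the memories that agree outside \<open>qs\<close>. It may
  lie outside \<open>mems B\<close>, since \<open>undefined\<close> need not be an admissible label;
  hence lemmas on slices come both for \<open>s \<in> mems B\<close> and for
  representatives.\<close>

definition forget :: "'v list \<Rightarrow> ('v \<Rightarrow> 'b) \<Rightarrow> 'v \<Rightarrow> 'b" where
  "forget qs s = (\<lambda>q. if q \<in> set qs then undefined else s q)"

lemma forget_forget [simp]: "forget qs (forget qs s) = forget qs s"
  by (auto simp: forget_def)

lemma put_forget:
  assumes "distinct qs" "bs \<in> reg B qs"
  shows "put qs bs (forget qs s) = put qs bs s"
  using assms by (elim reg_eq_map) (auto simp: put_map forget_def)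

lemma put_put_same:
  assumes "distinct qs" "bs \<in> reg B qs" "cs \<in> reg B qs"
  shows "put qs bs (put qs cs s) = put qs bs s"
proof -
  obtain t where "bs = map t qs" using reg_eq_map[OF assms(1,2)] by metis
  moreover obtain u where "cs = map u qs" using reg_eq_map[OF assms(1,3)] by metis
  ultimately show ?thesis by (auto simp: put_map)
qed

lemma forget_put:
  assumes "distinct qs" "bs \<in> reg B qs"
  shows "forget qs (put qs bs s) = forget qs s"
  using assms by (elim reg_eq_map) (auto simp: put_map forget_def)

lemma put_in_mems:
  assumes "distinct qs" "bs \<in> reg B qs" "s \<in> mems B"
  shows "put qs bs s \<in> mems B"
  using assms by (elim reg_eq_map) (auto simp: put_map mems_def)

lemma slice_forget: "distinct qs \<Longrightarrow> slice B qs x (forget qs s) = slice B qs x s"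
  by (auto simp: slice_def put_forget)

lemma slice_put: "distinct qs \<Longrightarrow> bs \<in> reg B qs \<Longrightarrow> slice B qs x (put qs bs s) = slice B qs x s"
  by (auto simp: slice_def put_put_same)

lemma slice_outside: "bs \<notin> reg B qs \<Longrightarrow> slice B qs x s bs = 0"
  by (simp add: slice_def)

text \<open>On basis labels this is the factorisation of the full space into the register and the
  rest; sums over memories are split along it.\<close>

lemma bij_betw_put:
  assumes qs: "distinct qs"
  shows "bij_betw (\<lambda>(c, bs). put qs bs c) ((forget qs ` mems B) \<times> reg B qs) (mems B)"
proof (rule bij_betwI[where g = "\<lambda>s. (forget qs s, map s qs)"])
  show "(\<lambda>(c, bs). put qs bs c) \<in> (forget qs ` mems B) \<times> reg B qs \<rightarrow> mems B"
    by (auto simp: put_forget[OF qs] put_in_mems[OF qs])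
  show "(\<lambda>s. (forget qs s, map s qs)) \<in> mems B \<rightarrow> (forget qs ` mems B) \<times> reg B qs"
    by (auto simp: map_in_reg)
  fix p assume "p \<in> (forget qs ` mems B) \<times> reg B qs"
  then obtain s bs where p: "p = (forget qs s, bs)" "bs \<in> reg B qs" by auto
  show "(forget qs (case p of (c, bs) \<Rightarrow> put qs bs c), map (case p of (c, bs) \<Rightarrow> put qs bs c) qs) = p"
    using p by (simp add: put_forget[OF qs] forget_put[OF qs] map_put[OF qs] reg_length)
next
  fix s assume "s \<in> mems B"
  then show "(case (forget qs s, map s qs) of (c, bs) \<Rightarrow> put qs bs c) = s"
    using put_forget[OF qs map_in_reg, of s B s] by simp
qed

lemma has_sum_mems_iff:
  assumes "distinct qs"
  shows "(f has_sum a) (mems B) \<longleftrightarrow>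
    ((\<lambda>(c, bs). f (put qs bs c)) has_sum a) ((forget qs ` mems B) \<times> reg B qs)"
  using has_sum_reindex_bij_betw[OF bij_betw_put[OF assms, of B], of f a]
  by (simp add: case_prod_unfold)

lemma slice_ell2_forget:
  assumes qs: "distinct qs" and x: "x \<in> ell2 (mems B)" and c: "c \<in> forget qs ` mems B"
  shows "slice B qs x c \<in> ell2 (reg B qs)"
proof -
  have "((\<lambda>(c, bs). (cmod (x (put qs bs c)))\<^sup>2) has_sum (ell2_norm (mems B) x)\<^sup>2)
      ((forget qs ` mems B) \<times> reg B qs)"
    using ell2_norm_has_sum[OF x] unfolding has_sum_mems_iff[OF qs] .
  then have "(\<lambda>bs. (cmod (x (put qs bs c)))\<^sup>2) summable_on reg B qs"
    using summable_on_SigmaD1[of "\<lambda>c bs. (cmod (x (put qs bs c)))\<^sup>2", OF has_sum_imp_summable c] by auto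
  then show ?thesis by (simp add: ell2_def slice_def cong: summable_on_cong)
qed

lemma slice_ell2:
  assumes "distinct qs" "x \<in> ell2 (mems B)" "s \<in> mems B"
  shows "slice B qs x s \<in> ell2 (reg B qs)"
  using slice_ell2_forget[OF assms(1,2), of "forget qs s"] assms by (simp add: slice_forget)

lemma slice_norm_has_sum:
  assumes qs: "distinct qs" and x: "x \<in> ell2 (mems B)"
  shows "((\<lambda>c. (ell2_norm (reg B qs) (slice B qs x c))\<^sup>2) has_sum (ell2_norm (mems B) x)\<^sup>2)
    (forget qs ` mems B)"
proof (rule has_sum_SigmaD)
  show "((\<lambda>(c, bs). (cmod (x (put qs bs c)))\<^sup>2) has_sum (ell2_norm (mems B) x)\<^sup>2)
      ((forget qs ` mems B) \<times> reg B qs)"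
    using ell2_norm_has_sum[OF x] unfolding has_sum_mems_iff[OF qs] .
  show "((\<lambda>bs. case (c, bs) of (c, bs) \<Rightarrow> (cmod (x (put qs bs c)))\<^sup>2) has_sum
      (ell2_norm (reg B qs) (slice B qs x c))\<^sup>2) (reg B qs)" if "c \<in> forget qs ` mems B" for c
    using ell2_norm_has_sum[OF slice_ell2_forget[OF qs x that]]
    by (simp add: slice_def cong: has_sum_cong)
qed

lemma slice_ip_has_sum:
  assumes qs: "distinct qs" and x: "x \<in> ell2 (mems B)" and y: "y \<in> ell2 (mems B)"
  shows "((\<lambda>c. ip (reg B qs) (slice B qs x c) (slice B qs y c)) has_sum ip (mems B) x y)
    (forget qs ` mems B)"
proof (rule has_sum_SigmaD)
  show "((\<lambda>(c, bs). cnj (x (put qs bs c)) * y (put qs bs c)) has_sum ip (mems B) x y)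
      ((forget qs ` mems B) \<times> reg B qs)"
    using ip_has_sum[OF x y] unfolding has_sum_mems_iff[OF qs] .
  show "((\<lambda>bs. case (c, bs) of (c, bs) \<Rightarrow> cnj (x (put qs bs c)) * y (put qs bs c)) has_sum
      ip (reg B qs) (slice B qs x c) (slice B qs y c)) (reg B qs)" if "c \<in> forget qs ` mems B" for c
    using ip_has_sum[OF slice_ell2_forget[OF qs x that] slice_ell2_forget[OF qs y that]]
    by (simp add: slice_def cong: has_sum_cong)
qed

lemma ell2_slicesI:
  assumes qs: "distinct qs" and 0: "\<And>s. s \<notin> mems B \<Longrightarrow> x s = 0"
    and sl: "\<And>c. c \<in> forget qs ` mems B \<Longrightarrow> slice B qs x c \<in> ell2 (reg B qs)"
    and sum: "((\<lambda>c. (ell2_norm (reg B qs) (slice B qs x c))\<^sup>2) has_sum a) (forget qs ` mems B)"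
  shows "x \<in> ell2 (mems B)" and "(ell2_norm (mems B) x)\<^sup>2 = a"
proof -
  have 1: "((\<lambda>bs. case (c, bs) of (c, bs) \<Rightarrow> (cmod (x (put qs bs c)))\<^sup>2) has_sum
      (ell2_norm (reg B qs) (slice B qs x c))\<^sup>2) (reg B qs)" if "c \<in> forget qs ` mems B" for c
    using ell2_norm_has_sum[OF sl[OF that]] by (simp add: slice_def cong: has_sum_cong)
  have "((\<lambda>(c, bs). (cmod (x (put qs bs c)))\<^sup>2) has_sum a) ((forget qs ` mems B) \<times> reg B qs)"
    by (rule has_sum_SigmaI[OF 1 sum summable_on_SigmaI[OF 1 has_sum_imp_summable[OF sum]]]) auto
  then have "((\<lambda>s. (cmod (x s))\<^sup>2) has_sum a) (mems B)"
    unfolding has_sum_mems_iff[OF qs, of "\<lambda>s. (cmod (x s))\<^sup>2"] .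
  then show "x \<in> ell2 (mems B)" "(ell2_norm (mems B) x)\<^sup>2 = a"
    using ell2I_has_sum 0 by blast+
qed

lemma slice_norm_le:
  assumes qs: "distinct qs" and x: "x \<in> ell2 (mems B)" and s: "s \<in> mems B"
  shows "ell2_norm (reg B qs) (slice B qs x s) \<le> ell2_norm (mems B) x"
proof (rule power2_le_imp_le)
  have "(\<Sum>c\<in>{forget qs s}. (ell2_norm (reg B qs) (slice B qs x c))\<^sup>2) \<le> (ell2_norm (mems B) x)\<^sup>2"
    by (rule finite_sum_le_has_sum[OF slice_norm_has_sum[OF qs x]]) (use s in auto)
  then show "(ell2_norm (reg B qs) (slice B qs x s))\<^sup>2 \<le> (ell2_norm (mems B) x)\<^sup>2"
    by (simp add: slice_forget[OF qs])
qed simp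

section \<open>Extended operators act slice by slice\<close>

lemma slice_lift_mems:
  assumes qs: "distinct qs" and T: "bounded_oper (reg B qs) T" and x: "x \<in> ell2 (mems B)"
    and s: "s \<in> mems B"
  shows "slice B qs (lift B qs T x) s = T (slice B qs x s)"
proof
  fix bs show "slice B qs (lift B qs T x) s bs = T (slice B qs x s) bs"
  proof (cases "bs \<in> reg B qs")
    case True
    then show ?thesis
      using s by (simp add: slice_def[of B qs "lift B qs T x"] lift_slice put_in_mems[OF qs]
          slice_put[OF qs] map_put[OF qs reg_length])
  next
    case False
    then show ?thesis
      using ell2_outside[OF bounded_oper_ell2[OF T slice_ell2[OF qs x s]]] by (simp add: slice_outside)
  qed
qed

lemma slice_lift:
  assumes "distinct qs" "bounded_oper (reg B qs) T" "x \<in> ell2 (mems B)" "c \<in> forget qs ` mems B"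
  shows "slice B qs (lift B qs T x) c = T (slice B qs x c)"
  using assms slice_lift_mems[OF assms(1-3)] by (auto simp: slice_forget)

text \<open>Slices do not interact and each is mapped by the same \<open>T\<close>, so the bound for
  \<open>T\<close> carries over to the sum of the squared norms of the slices.\<close>

lemma lift_ell2:
  assumes qs: "distinct qs" and T: "bounded_oper (reg B qs) T" and x: "x \<in> ell2 (mems B)"
  shows "lift B qs T x \<in> ell2 (mems B)"
    and "((\<lambda>c. (ell2_norm (reg B qs) (T (slice B qs x c)))\<^sup>2) has_sum
      (ell2_norm (mems B) (lift B qs T x))\<^sup>2) (forget qs ` mems B)"
proof -
  obtain K where K: "K \<ge> 0" "\<And>y. y \<in> ell2 (reg B qs) \<Longrightarrow>
      ell2_norm (reg B qs) (T y) \<le> K * ell2_norm (reg B qs) y"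
    using bounded_oper_bound[OF T] by blast
  note sl = slice_ell2_forget[OF qs x]
  have "(\<lambda>c. (ell2_norm (reg B qs) (T (slice B qs x c)))\<^sup>2) summable_on forget qs ` mems B"
  proof (rule summable_on_comparison_test)
    show "(\<lambda>c. K\<^sup>2 * (ell2_norm (reg B qs) (slice B qs x c))\<^sup>2) summable_on forget qs ` mems B"
      by (rule summable_on_cmult_right[OF has_sum_imp_summable[OF slice_norm_has_sum[OF qs x]]])
    show "(ell2_norm (reg B qs) (T (slice B qs x c)))\<^sup>2 \<le> K\<^sup>2 * (ell2_norm (reg B qs) (slice B qs x c))\<^sup>2"
      if "c \<in> forget qs ` mems B" for c
      using power_mono[OF K(2)[OF sl[OF that]], of 2] by (simp add: power_mult_distrib)
  qed simp
  then obtain a where a: "((\<lambda>c. (ell2_norm (reg B qs) (T (slice B qs x c)))\<^sup>2) has_sum a) (forget qs ` mems B)"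
    by (auto simp: summable_on_def)
  have "((\<lambda>c. (ell2_norm (reg B qs) (slice B qs (lift B qs T x) c))\<^sup>2) has_sum a) (forget qs ` mems B)"
    using a by (simp add: slice_lift[OF qs T x] cong: has_sum_cong)
  from ell2_slicesI[OF qs _ _ this]
  have "lift B qs T x \<in> ell2 (mems B) \<and> (ell2_norm (mems B) (lift B qs T x))\<^sup>2 = a"
    using bounded_oper_ell2[OF T sl] by (simp add: slice_lift[OF qs T x] lift_slice)
  then show "lift B qs T x \<in> ell2 (mems B)"
    "((\<lambda>c. (ell2_norm (reg B qs) (T (slice B qs x c)))\<^sup>2) has_sum
      (ell2_norm (mems B) (lift B qs T x))\<^sup>2) (forget qs ` mems B)"
    using a by auto
qed

lemma slice_add_scale: "slice B qs (\<lambda>s. x s + c * y s) s = (\<lambda>bs. slice B qs x s bs + c * slice B qs y s bs)"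
  by (auto simp: slice_def)

lemma bounded_oper_lift:
  assumes qs: "distinct qs" and T: "bounded_oper (reg B qs) T"
  shows "bounded_oper (mems B) (lift B qs T)"
proof -
  obtain K where K: "K \<ge> 0" "\<And>y. y \<in> ell2 (reg B qs) \<Longrightarrow>
      ell2_norm (reg B qs) (T y) \<le> K * ell2_norm (reg B qs) y"
    using bounded_oper_bound[OF T] by blast
  show ?thesis
  proof (rule bounded_operI[where K = K])
    fix x assume x: "x \<in> ell2 (mems B)"
    show "lift B qs T x \<in> ell2 (mems B)" by (rule lift_ell2(1)[OF qs T x])
    have "(ell2_norm (mems B) (lift B qs T x))\<^sup>2 \<le> K\<^sup>2 * (ell2_norm (mems B) x)\<^sup>2"
    proof (rule has_sum_mono[OF lift_ell2(2)[OF qs T x]])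
      show "((\<lambda>c. K\<^sup>2 * (ell2_norm (reg B qs) (slice B qs x c))\<^sup>2) has_sum
          K\<^sup>2 * (ell2_norm (mems B) x)\<^sup>2) (forget qs ` mems B)"
        by (rule has_sum_cmult_right[OF slice_norm_has_sum[OF qs x]])
      show "(ell2_norm (reg B qs) (T (slice B qs x c)))\<^sup>2 \<le> K\<^sup>2 * (ell2_norm (reg B qs) (slice B qs x c))\<^sup>2"
        if "c \<in> forget qs ` mems B" for c
        using power_mono[OF K(2)[OF slice_ell2_forget[OF qs x that]], of 2] by (simp add: power_mult_distrib)
    qed
    then have "(ell2_norm (mems B) (lift B qs T x))\<^sup>2 \<le> (K * ell2_norm (mems B) x)\<^sup>2"
      by (simp add: power_mult_distrib)
    then show "ell2_norm (mems B) (lift B qs T x) \<le> K * ell2_norm (mems B) x"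
      by (rule power2_le_imp_le) (simp add: K(1))
  next
    fix x y c assume x: "x \<in> ell2 (mems B)" and y: "y \<in> ell2 (mems B)"
    show "lift B qs T (\<lambda>s. x s + c * y s) = (\<lambda>s. lift B qs T x s + c * lift B qs T y s)"
    proof
      fix s show "lift B qs T (\<lambda>s. x s + c * y s) s = lift B qs T x s + c * lift B qs T y s"
        using bounded_oper_add_scale[OF T slice_ell2[OF qs x] slice_ell2[OF qs y], of s s c]
        by (simp add: lift_slice slice_add_scale)
    qed
  qed
qed

lemma lift_comp:
  assumes "distinct qs" "bounded_oper (reg B qs) T" "x \<in> ell2 (mems B)"
  shows "lift B qs S (lift B qs T x) = lift B qs (S \<circ> T) x"
  using assms by (auto simp: lift_slice[of B qs S] lift_slice[of B qs "S \<circ> T"] slice_lift_mems)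

lemma lift_id:
  assumes "x \<in> ell2 (mems B)"
  shows "lift B qs id x = x"
  using assms ell2_outside[OF assms] by (auto simp: lift_slice slice_def map_in_reg)

lemma lift_isometric_family:
  assumes qs: "distinct qs" and M: "isometric_family (reg B qs) J M"
  shows "isometric_family (mems B) J (\<lambda>m. lift B qs (M m))"
proof -
  note D = isometric_familyD[OF M]
  have "((\<lambda>m. (ell2_norm (mems B) (lift B qs (M m) x))\<^sup>2) has_sum (ell2_norm (mems B) x)\<^sup>2) J"
    if x: "x \<in> ell2 (mems B)" for x
  proof -
    let ?f = "\<lambda>(c, m). (ell2_norm (reg B qs) (M m (slice B qs x c)))\<^sup>2"
    have 1: "((\<lambda>m. ?f (c, m)) has_sum (ell2_norm (reg B qs) (slice B qs x c))\<^sup>2) J"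
      if "c \<in> forget qs ` mems B" for c
      using D(2)[OF slice_ell2_forget[OF qs x that]] by simp
    note 2 = slice_norm_has_sum[OF qs x]
    have "(?f has_sum (ell2_norm (mems B) x)\<^sup>2) ((forget qs ` mems B) \<times> J)"
      by (rule has_sum_SigmaI[OF 1 2 summable_on_SigmaI[OF 1 has_sum_imp_summable[OF 2]]]) auto
    then have "((\<lambda>(m, c). ?f (c, m)) has_sum (ell2_norm (mems B) x)\<^sup>2) (J \<times> (forget qs ` mems B))"
      by (subst (asm) has_sum_swap) simp
    then show ?thesis
      by (rule has_sum_SigmaD) (use lift_ell2(2)[OF qs D(1) x] in simp)
  qed
  then show ?thesis
    using D(1) qs by (simp add: isometric_family_def bounded_oper_lift)
qed

lemma slice_ket:
  assumes qs: "distinct qs" and s: "s \<in> mems B" and c: "c \<in> forget qs ` mems B"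
  shows "slice B qs (ket s) c = (if c = forget qs s then ket (map s qs) else (\<lambda>bs. 0))"
proof -
  obtain t where t: "t \<in> mems B" "c = forget qs t" using c by auto
  have "put qs bs c = s \<longleftrightarrow> c = forget qs s \<and> bs = map s qs" if bs: "bs \<in> reg B qs" for bs
  proof
    assume *: "put qs bs c = s"
    then have "forget qs s = c"
      using forget_put[OF qs bs, of c] t by simp
    moreover have "map s qs = bs" using * map_put[OF qs reg_length[OF bs]] by blast
    ultimately show "c = forget qs s \<and> bs = map s qs" by simp
  next
    assume "c = forget qs s \<and> bs = map s qs"
    then show "put qs bs c = s" using put_forget[OF qs map_in_reg[OF s]] by simp
  qed
  then show ?thesis
    using map_in_reg[OF s, of qs] by (auto simp: slice_def ket_def fun_eq_iff)
qed

text \<open>The only nonzero slice of \<open>ket s\<close> is the one at \<open>forget qs s\<close>,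
  so the sum over slices collapses to one term.\<close>

lemma adj_lift:
  assumes qs: "distinct qs" and T: "bounded_oper (reg B qs) T" and y: "y \<in> ell2 (mems B)"
  shows "adj (mems B) (lift B qs T) y = lift B qs (adj (reg B qs) T) y"
proof
  fix s show "adj (mems B) (lift B qs T) y s = lift B qs (adj (reg B qs) T) y s"
  proof (cases "s \<in> mems B")
    case s: True
    note k = ket_ell2[OF s]
    have fs: "forget qs s \<in> forget qs ` mems B" using s by simp
    have "((\<lambda>c. ip (reg B qs) (slice B qs (lift B qs T (ket s)) c) (slice B qs y c)) has_sum
        ip (reg B qs) (T (ket (map s qs))) (slice B qs y s)) (forget qs ` mems B)"
    proof (rule has_sum_finite_neutralI[of "{forget qs s}"])
      show "ip (reg B qs) (slice B qs (lift B qs T (ket s)) c) (slice B qs y c) = 0"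
        if "c \<in> forget qs ` mems B - {forget qs s}" for c
        using that by (simp add: slice_lift[OF qs T k] slice_ket[OF qs s] bounded_oper_zero[OF T])
      show "ip (reg B qs) (T (ket (map s qs))) (slice B qs y s) = (\<Sum>c\<in>{forget qs s}.
          ip (reg B qs) (slice B qs (lift B qs T (ket s)) c) (slice B qs y c))"
        by (simp add: slice_lift[OF qs T k fs] slice_ket[OF qs s fs]) (simp add: slice_forget[OF qs])
    qed (use s in auto)
    then have "ip (mems B) (lift B qs T (ket s)) y = ip (reg B qs) (T (ket (map s qs))) (slice B qs y s)"
      using slice_ip_has_sum[OF qs lift_ell2(1)[OF qs T k] y] has_sum_unique by blast
    then show ?thesis
      using s by (simp add: adj_apply_eq_ip lift_slice map_in_reg)
  qed (simp add: adj_outside lift_slice)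
qed

lemma adj_ketbra:
  assumes "\<phi> \<in> ell2 X" "\<psi> \<in> ell2 X"
  shows "adj X (ketbra X \<phi> \<psi>) y = ketbra X \<psi> \<phi> y"
proof
  fix i show "adj X (ketbra X \<phi> \<psi>) y i = ketbra X \<psi> \<phi> y i"
    using ell2_outside[OF assms(2)]
    by (cases "i \<in> X") (simp_all add: adj_def ketbra_def ip_scale_left ip_ket_right mult.commute[of _ "\<psi> i"])
qed

text \<open>The tensor product of \<open>y\<close> with the basis vector given by the labels of
  \<open>t\<close> outside \<open>qs\<close>.\<close>

definition embed :: "('v \<Rightarrow> 'b set) \<Rightarrow> 'v list \<Rightarrow> ('v \<Rightarrow> 'b) \<Rightarrow> 'b list vec \<Rightarrow> ('v \<Rightarrow> 'b) vec" where
  "embed B qs t y = (\<lambda>s. if s \<in> mems B \<and> forget qs s = forget qs t then y (map s qs) else 0)"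

lemma slice_embed:
  assumes qs: "distinct qs" and t: "t \<in> mems B" and y: "y \<in> ell2 (reg B qs)" and c: "c \<in> forget qs ` mems B"
  shows "slice B qs (embed B qs t y) c = (if c = forget qs t then y else (\<lambda>bs. 0))"
proof
  fix bs
  obtain u where u: "u \<in> mems B" "c = forget qs u" using c by auto
  have "forget qs c = c" by (simp add: u)
  then show "slice B qs (embed B qs t y) c bs = (if c = forget qs t then y else (\<lambda>bs. 0)) bs"
    using ell2_outside[OF y] u
    by (auto simp: slice_def embed_def put_forget[OF qs] put_in_mems[OF qs _ t] forget_put[OF qs]
        map_put[OF qs] reg_length)
qed

lemma has_sum_embed:
  assumes "t \<in> mems B" "\<And>c. c \<in> forget qs ` mems B \<Longrightarrow> f c = (if c = forget qs t then a else (0::real))"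
  shows "(f has_sum a) (forget qs ` mems B)"
  by (rule has_sum_finite_neutralI[of "{forget qs t}"]) (use assms in auto)

lemma embed_ell2:
  assumes qs: "distinct qs" and t: "t \<in> mems B" and y: "y \<in> ell2 (reg B qs)"
  shows "embed B qs t y \<in> ell2 (mems B)" and "ell2_norm (mems B) (embed B qs t y) = ell2_norm (reg B qs) y"
proof -
  have "((\<lambda>c. (ell2_norm (reg B qs) (slice B qs (embed B qs t y) c))\<^sup>2) has_sum
      (ell2_norm (reg B qs) y)\<^sup>2) (forget qs ` mems B)"
    by (rule has_sum_embed[OF t]) (simp add: slice_embed[OF qs t y])
  from ell2_slicesI[OF qs _ _ this]
  have "embed B qs t y \<in> ell2 (mems B) \<and>
      (ell2_norm (mems B) (embed B qs t y))\<^sup>2 = (ell2_norm (reg B qs) y)\<^sup>2"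
    using y slice_embed[OF qs t y] by (simp add: embed_def)
  then show "embed B qs t y \<in> ell2 (mems B)" "ell2_norm (mems B) (embed B qs t y) = ell2_norm (reg B qs) y"
    by (simp_all add: power2_eq_iff_nonneg)
qed

lemma ell2_norm_lift_embed:
  assumes qs: "distinct qs" and t: "t \<in> mems B" and y: "y \<in> ell2 (reg B qs)"
    and T: "bounded_oper (reg B qs) T"
  shows "(ell2_norm (mems B) (lift B qs T (embed B qs t y)))\<^sup>2 = (ell2_norm (reg B qs) (T y))\<^sup>2"
  using lift_ell2(2)[OF qs T embed_ell2(1)[OF qs t y]]
  by (rule has_sum_unique)
    (rule has_sum_embed[OF t], simp add: slice_embed[OF qs t y] bounded_oper_zero[OF T])

text \<open>Tested on the vectors \<open>embed B qs t y\<close>, the identity on the full space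
  becomes the one on the register. Some memory \<open>t\<close> must exist to form such
  vectors.\<close>

lemma isometric_family_of_lift:
  assumes qs: "distinct qs" and t: "t \<in> mems B"
    and L: "isometric_family (mems B) J L"
    and T: "\<And>m. m \<in> J \<Longrightarrow> bounded_oper (reg B qs) (T m)"
    and eq: "\<And>m x. m \<in> J \<Longrightarrow> x \<in> ell2 (mems B) \<Longrightarrow> L m x = lift B qs (T m) x"
  shows "isometric_family (reg B qs) J T"
proof -
  have "((\<lambda>m. (ell2_norm (reg B qs) (T m y))\<^sup>2) has_sum (ell2_norm (reg B qs) y)\<^sup>2) J"
    if y: "y \<in> ell2 (reg B qs)" for y
  proof -
    have 1: "((\<lambda>m. (ell2_norm (mems B) (L m (embed B qs t y)))\<^sup>2) has_sum (ell2_norm (reg B qs) y)\<^sup>2) J"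
      using isometric_familyD(2)[OF L embed_ell2(1)[OF qs t y]] embed_ell2(2)[OF qs t y] by simp
    have 2: "(ell2_norm (mems B) (L m (embed B qs t y)))\<^sup>2 = (ell2_norm (reg B qs) (T m y))\<^sup>2"
      if m: "m \<in> J" for m
      using eq[OF m embed_ell2(1)[OF qs t y]] ell2_norm_lift_embed[OF qs t y T[OF m]] by simp
    from has_sum_cong[THEN iffD1, OF 2 1] show ?thesis .
  qed
  then show ?thesis using T by (simp add: isometric_family_def)
qed

subsection \<open>Operators local to a register\<close>

text \<open>Equality is asked on \<open>ell2 (mems B)\<close> only, where \<open>lift_id\<close> and
  \<open>lift_comp\<close> are available.\<close>

definition local_oper :: "('v \<Rightarrow> 'b set) \<Rightarrow> 'v list \<Rightarrow> ('v \<Rightarrow> 'b) oper \<Rightarrow> bool" where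
  "local_oper B qs L \<longleftrightarrow>
     (\<exists>T. bounded_oper (reg B qs) T \<and> (\<forall>x\<in>ell2 (mems B). L x = lift B qs T x))"

lemma bounded_oper_cong:
  assumes T: "bounded_oper X T" and eq: "\<And>x. x \<in> ell2 X \<Longrightarrow> S x = T x"
  shows "bounded_oper X S"
proof -
  obtain K where K: "K \<ge> 0" "\<And>x. x \<in> ell2 X \<Longrightarrow> ell2_norm X (T x) \<le> K * ell2_norm X x"
    using bounded_oper_bound[OF T] by blast
  show ?thesis
    by (rule bounded_operI[where K = K])
      (simp_all add: eq K ell2_add_scale bounded_oper_ell2[OF T] bounded_oper_add_scale[OF T])
qed

lemma bounded_oper_local: "distinct qs \<Longrightarrow> local_oper B qs L \<Longrightarrow> bounded_oper (mems B) L"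
  unfolding local_oper_def using bounded_oper_lift bounded_oper_cong by metis

lemma local_oper_lift: "bounded_oper (reg B qs) T \<Longrightarrow> local_oper B qs (lift B qs T)"
  by (auto simp: local_oper_def)

lemma local_oper_id: "local_oper B qs id"
  unfolding local_oper_def
  by (intro exI[of _ id] conjI bounded_oper_id ballI) (simp add: lift_id)

lemma local_oper_comp:
  assumes qs: "distinct qs" and L: "local_oper B qs L" and M: "local_oper B qs M"
  shows "local_oper B qs (L \<circ> M)"
proof -
  obtain S where S: "bounded_oper (reg B qs) S" "\<And>x. x \<in> ell2 (mems B) \<Longrightarrow> L x = lift B qs S x"
    using L by (auto simp: local_oper_def)
  obtain T where T: "bounded_oper (reg B qs) T" "\<And>x. x \<in> ell2 (mems B) \<Longrightarrow> M x = lift B qs T x"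
    using M by (auto simp: local_oper_def)
  have "(L \<circ> M) x = lift B qs (S \<circ> T) x" if "x \<in> ell2 (mems B)" for x
    using that by (simp add: S(2) T(2) lift_ell2[OF qs T(1)] lift_comp[OF qs T(1)])
  then show ?thesis
    unfolding local_oper_def using bounded_oper_comp[OF S(1) T(1)] by blast
qed

lemma local_oper_sum:
  assumes "\<And>j. j \<in> A \<Longrightarrow> local_oper B qs (L j)"
  shows "local_oper B qs (\<lambda>x s. \<Sum>j\<in>A. L j x s)"
proof -
  obtain T where T: "\<And>j. j \<in> A \<Longrightarrow> bounded_oper (reg B qs) (T j)"
    "\<And>j x. j \<in> A \<Longrightarrow> x \<in> ell2 (mems B) \<Longrightarrow> L j x = lift B qs (T j) x"
    using assms unfolding local_oper_def by metis
  have "(\<lambda>s. \<Sum>j\<in>A. L j x s) = lift B qs (\<lambda>x i. \<Sum>j\<in>A. T j x i) x" if "x \<in> ell2 (mems B)" for x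
  proof
    fix s
    have "(\<Sum>j\<in>A. L j x s) = (\<Sum>j\<in>A. lift B qs (T j) x s)"
      by (rule sum.cong[OF refl]) (simp only: T(2)[OF _ that])
    then show "(\<Sum>j\<in>A. L j x s) = lift B qs (\<lambda>x i. \<Sum>j\<in>A. T j x i) x s"
      by (simp add: lift_slice)
  qed
  then show ?thesis
    unfolding local_oper_def
    by (intro exI[of _ "\<lambda>x i. \<Sum>j\<in>A. T j x i"] conjI ballI bounded_oper_sum_oper T(1))
qed

text \<open>Restricting an operator to the memories that agree with \<open>t\<close> outside the larger register
  gives its operator on that register.\<close>

lemma local_oper_mono:
  assumes qs: "distinct qs" and rs: "distinct rs" and sub: "set qs \<subseteq> set rs" and L: "local_oper B qs L"
  shows "local_oper B rs L"
proof (cases "mems B = {}")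
  case True
  \<comment> \<open>Without memories every extended operator is zero, whatever the register.\<close>
  then have lift_0: "lift B ps T x = (\<lambda>s. 0)" for ps T x by (simp add: lift_slice fun_eq_iff)
  show ?thesis
    using L bounded_oper_zero_oper[of "reg B rs"] unfolding local_oper_def lift_0 by blast
next
  case False
  then obtain t where t: "t \<in> mems B" by auto
  obtain T where T: "bounded_oper (reg B qs) T" "\<And>x. x \<in> ell2 (mems B) \<Longrightarrow> L x = lift B qs T x"
    using L by (auto simp: local_oper_def)
  have bL: "bounded_oper (mems B) L" by (rule bounded_oper_local[OF qs L])
  obtain K where K: "K \<ge> 0" "\<And>x. x \<in> ell2 (mems B) \<Longrightarrow> ell2_norm (mems B) (L x) \<le> K * ell2_norm (mems B) x"
    using bounded_oper_bound[OF bL] by blast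
  define S where "S y = slice B rs (L (embed B rs t y)) t" for y
  have LE: "L (embed B rs t y) \<in> ell2 (mems B)" if "y \<in> ell2 (reg B rs)" for y
    by (rule bounded_oper_ell2[OF bL embed_ell2(1)[OF rs t that]])
  have "bounded_oper (reg B rs) S"
  proof (rule bounded_operI[where K = K])
    fix y assume y: "y \<in> ell2 (reg B rs)"
    show "S y \<in> ell2 (reg B rs)" unfolding S_def by (rule slice_ell2[OF rs LE[OF y] t])
    have "ell2_norm (reg B rs) (S y) \<le> ell2_norm (mems B) (L (embed B rs t y))"
      unfolding S_def by (rule slice_norm_le[OF rs LE[OF y] t])
    also have "\<dots> \<le> K * ell2_norm (reg B rs) y"
      using K(2)[OF embed_ell2(1)[OF rs t y]] by (simp add: embed_ell2(2)[OF rs t y])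
    finally show "ell2_norm (reg B rs) (S y) \<le> K * ell2_norm (reg B rs) y" .
  next
    fix x y c assume x: "x \<in> ell2 (reg B rs)" and y: "y \<in> ell2 (reg B rs)"
    have "embed B rs t (\<lambda>i. x i + c * y i) = (\<lambda>s. embed B rs t x s + c * embed B rs t y s)"
      by (auto simp: embed_def)
    then show "S (\<lambda>i. x i + c * y i) = (\<lambda>i. S x i + c * S y i)"
      by (simp add: S_def slice_add_scale
          bounded_oper_add_scale[OF bL embed_ell2(1)[OF rs t x] embed_ell2(1)[OF rs t y]])
  qed
  moreover have "L x = lift B rs S x" if x: "x \<in> ell2 (mems B)" for x
  proof
    fix s show "L x s = lift B rs S x s"
    proof (cases "s \<in> mems B")
      case s: True
      \<comment> \<open>\<open>u\<close> has the labels of \<open>s\<close> on \<open>rs\<close> and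
        those of \<open>t\<close> elsewhere. There the \<open>qs\<close>-slice of the embedded
        vector equals the \<open>qs\<close>-slice of \<open>x\<close> at \<open>s\<close>, and
        \<open>L\<close> depends on nothing else.\<close>
      define u where "u = put rs (map s rs) t"
      have u: "u \<in> mems B" unfolding u_def by (rule put_in_mems[OF rs map_in_reg[OF s] t])
      have u': "u = (\<lambda>q. if q \<in> set rs then s q else t q)" by (simp add: u_def put_map)
      have "map u qs = map s qs" using sub by (auto simp: u')
      moreover
      define y where "y = slice B rs x s"
      have y: "y \<in> ell2 (reg B rs)" unfolding y_def by (rule slice_ell2[OF rs x s])
      have "slice B qs (embed B rs t y) u = slice B qs x s"
      proof
        fix bs show "slice B qs (embed B rs t y) u bs = slice B qs x s bs"
        proof (cases "bs \<in> reg B qs")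
          case bs: True
          obtain v where v: "bs = map v qs" using reg_eq_map[OF qs bs] by metis
          have "forget rs (put qs bs u) = forget rs t" "put rs (map (put qs bs u) rs) s = put qs bs s"
            using sub by (auto simp: v put_map forget_def u' fun_eq_iff)
          moreover note put_in_mems[OF qs bs u]
          ultimately show ?thesis
            using bs by (simp add: slice_def embed_def map_in_reg y_def)
        qed (simp add: slice_outside)
      qed
      ultimately have "L x s = lift B qs T (embed B rs t y) u"
        unfolding T(2)[OF x] lift_slice using s u by (simp only: if_True)
      also have "\<dots> = S y (map s rs)"
        using map_in_reg[OF s, of rs]
        by (simp add: S_def slice_def u_def T(2)[OF embed_ell2(1)[OF rs t y]])
      also have "\<dots> = lift B rs S x s" using s by (simp add: lift_slice y_def)
      finally show ?thesis .
    next
      case False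
      then show ?thesis by (simp add: T(2)[OF x] lift_slice)
    qed
  qed
  ultimately show ?thesis unfolding local_oper_def by blast
qed

text \<open>The register of a quantum case statement has a finite orthonormal basis, hence finitely many
  labels, so the local operator is only exchanged with finite sums.\<close>

lemma lift_ketbra_commute:
  assumes qs: "distinct qs" and rs: "distinct rs" and disj: "set qs \<inter> set rs = {}"
    and fin: "finite (reg B qs)" and \<phi>: "\<phi> \<in> ell2 (reg B qs)" and \<psi>: "\<psi> \<in> ell2 (reg B qs)"
    and L: "local_oper B rs L" and x: "x \<in> ell2 (mems B)"
  shows "lift B qs (ketbra (reg B qs) \<phi> \<psi>) (L x) = L (lift B qs (ketbra (reg B qs) \<phi> \<psi>) x)"
proof
  obtain T where T: "bounded_oper (reg B rs) T" "\<And>x. x \<in> ell2 (mems B) \<Longrightarrow> L x = lift B rs T x"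
    using L by (auto simp: local_oper_def)
  let ?P = "lift B qs (ketbra (reg B qs) \<phi> \<psi>)"
  have P: "?P z s = (\<Sum>bs\<in>reg B qs. \<phi> (map s qs) * cnj (\<psi> bs) * z (put qs bs s))"
    if "s \<in> mems B" for z s
    using that fin
    by (simp add: lift_slice ketbra_def ip_def slice_def sum_distrib_left mult_ac cong: sum.cong)
  have Px: "?P x \<in> ell2 (mems B)" by (rule lift_ell2(1)[OF qs bounded_oper_ketbra[OF \<phi> \<psi>] x])
  fix s show "?P (L x) s = L (?P x) s"
  proof (cases "s \<in> mems B")
    case s: True
    have 1: "put qs bs (put rs cs s) = put rs cs (put qs bs s)"
      if b: "bs \<in> reg B qs" and c: "cs \<in> reg B rs" for bs cs
    proof -
      obtain v where v: "bs = map v qs" using reg_eq_map[OF qs b] by metis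
      obtain w where w: "cs = map w rs" using reg_eq_map[OF rs c] by metis
      show ?thesis using disj by (auto simp: v w put_map fun_eq_iff)
    qed
    have 2: "map (put qs bs s) rs = map s rs" if b: "bs \<in> reg B qs" for bs
    proof -
      obtain v where v: "bs = map v qs" using reg_eq_map[OF qs b] by metis
      show ?thesis using disj by (auto simp: v put_map)
    qed
    have 3: "map (put rs cs s) qs = map s qs" if c: "cs \<in> reg B rs" for cs
    proof -
      obtain v where v: "cs = map v rs" using reg_eq_map[OF rs c] by metis
      show ?thesis using disj by (auto simp: v put_map)
    qed
    note sl = slice_ell2[OF rs x put_in_mems[OF qs _ s]]
    have "T (slice B rs (?P x) s)
        = T (\<lambda>cs. \<Sum>bs\<in>reg B qs. (\<phi> (map s qs) * cnj (\<psi> bs)) * slice B rs x (put qs bs s) cs)"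
      using s by (auto simp: slice_def P put_in_mems[OF rs] 1 3 intro!: arg_cong[of _ _ T] cong: sum.cong)
    also have "\<dots> = (\<lambda>cs. \<Sum>bs\<in>reg B qs. T (\<lambda>cs. (\<phi> (map s qs) * cnj (\<psi> bs)) * slice B rs x (put qs bs s) cs) cs)"
      by (rule bounded_oper_sum[OF T(1)]) (use sl ell2_scale in blast)
    also have "\<dots> = (\<lambda>cs. \<Sum>bs\<in>reg B qs. (\<phi> (map s qs) * cnj (\<psi> bs)) * T (slice B rs x (put qs bs s)) cs)"
      by (intro ext sum.cong refl) (simp add: bounded_oper_scale[OF T(1) sl])
    finally show ?thesis
      unfolding P[OF s] T(2)[OF x] T(2)[OF Px] lift_slice[of B rs T]
      using s by (simp add: put_in_mems[OF qs] 2 cong: sum.cong)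
  next
    case False
    then show ?thesis by (simp add: lift_slice T(2)[OF Px])
  qed
qed

section \<open>Finite orthonormal bases\<close>

lemma orthonormal_basisD:
  assumes "orthonormal_basis X d \<psi>"
  shows "i < d \<Longrightarrow> \<psi> i \<in> ell2 X"
    and "i < d \<Longrightarrow> j < d \<Longrightarrow> ip X (\<psi> i) (\<psi> j) = (if i = j then 1 else 0)"
    and "x \<in> ell2 X \<Longrightarrow> x k = (\<Sum>i<d. ip X (\<psi> i) x * \<psi> i k)"
proof -
  show "x k = (\<Sum>i<d. ip X (\<psi> i) x * \<psi> i k)" if "x \<in> ell2 X"
    using assms that unfolding orthonormal_basis_def by meson
qed (use assms in \<open>auto simp: orthonormal_basis_def\<close>)

text \<open>Double counting: over the basis vectors the squared entries at a label add up to 1, over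
  labels those of one vector to at most 1. So d + 1 labels would give d + 1 \<le> d.\<close>

lemma orthonormal_basis_finite:
  assumes "orthonormal_basis X d \<psi>"
  shows "finite X"
proof (rule ccontr)
  assume "infinite X"
  then obtain F where F: "finite F" "F \<subseteq> X" "card F = Suc d"
    using infinite_arbitrarily_large by blast
  note D = orthonormal_basisD[OF assms]
  have one: "(\<Sum>i<d. (cmod (\<psi> i k))\<^sup>2) = 1" if k: "k \<in> X" for k
  proof -
    have "of_real (\<Sum>i<d. (cmod (\<psi> i k))\<^sup>2) = (\<Sum>i<d. ip X (\<psi> i) (ket k) * \<psi> i k)"
      unfolding of_real_sum complex_norm_square by (simp add: ip_ket_right[OF k] mult.commute)
    also have "\<dots> = of_real 1" using D(3)[OF ket_ell2[OF k], of k] by (simp add: ket_def)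
    finally show ?thesis by (simp only: of_real_eq_iff)
  qed
  have "real (Suc d) = (\<Sum>k\<in>F. \<Sum>i<d. (cmod (\<psi> i k))\<^sup>2)"
    using F one by (simp add: subset_eq)
  also have "\<dots> = (\<Sum>i<d. \<Sum>k\<in>F. (cmod (\<psi> i k))\<^sup>2)" by (rule sum.swap)
  also have "\<dots> \<le> (\<Sum>i<d. 1)"
  proof (rule sum_mono)
    fix i assume i: "i \<in> {..<d}"
    have "(\<Sum>k\<in>F. (cmod (\<psi> i k))\<^sup>2) \<le> (ell2_norm X (\<psi> i))\<^sup>2"
      by (rule finite_sum_le_has_sum[OF ell2_norm_has_sum F(1,2)]) (use D(1) i in auto)
    also have "\<dots> = 1" using ip_self_Re[OF D(1), of i] D(2)[of i i] i by simp
    finally show "(\<Sum>k\<in>F. (cmod (\<psi> i k))\<^sup>2) \<le> 1" .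
  qed
  finally show False by simp
qed

lemma ell2_norm_ketbra:
  "\<phi> \<in> ell2 X \<Longrightarrow> ell2_norm X (ketbra X \<phi> \<psi> x) = cmod (ip X \<psi> x) * ell2_norm X \<phi>"
  unfolding ketbra_def by (rule ell2_scale(2))

lemma orthonormal_basis_isometric_family:
  assumes "orthonormal_basis X d \<psi>"
  shows "isometric_family X {..<d} (\<lambda>i. ketbra X (\<psi> i) (\<psi> i))"
proof -
  note D = orthonormal_basisD[OF assms]
  have n: "ell2_norm X (\<psi> i) = 1" if "i < d" for i
    using ip_self_Re[OF D(1)[OF that]] D(2)[OF that that]
    by (metis one_complex.simps(1) power2_eq_1_iff ell2_norm_nonneg neg_0_le_iff_le not_one_le_zero)
  have "(\<Sum>i<d. (ell2_norm X (ketbra X (\<psi> i) (\<psi> i) x))\<^sup>2) = (ell2_norm X x)\<^sup>2" if x: "x \<in> ell2 X" for x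
  proof -
    have "x = (\<lambda>k. \<Sum>i<d. ip X (\<psi> i) x * \<psi> i k)" using D(3)[OF x] by blast
    then have "ip X x x = ip X x (\<lambda>k. \<Sum>i<d. ip X (\<psi> i) x * \<psi> i k)" by simp
    also have "\<dots> = (\<Sum>i<d. ip X x (\<lambda>k. ip X (\<psi> i) x * \<psi> i k))"
      by (rule ip_sum_right[OF x]) (simp add: ell2_scale D(1))
    also have "\<dots> = (\<Sum>i<d. of_real ((cmod (ip X (\<psi> i) x))\<^sup>2))"
      by (rule sum.cong[OF refl]) (simp only: ip_scale_right complex_norm_square ip_cnj)
    finally have "(ell2_norm X x)\<^sup>2 = (\<Sum>i<d. (cmod (ip X (\<psi> i) x))\<^sup>2)"
      unfolding ip_self[OF x] of_real_sum[symmetric] of_real_eq_iff .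
    then show ?thesis by (simp add: ell2_norm_ketbra D(1) n)
  qed
  then show ?thesis
    using D(1) by (auto simp: isometric_family_def intro: bounded_oper_ketbra has_sum_finiteI)
qed

section \<open>Circuits\<close>

lemma isometric_family_singletonD:
  assumes "isometric_family X {m} M" "x \<in> ell2 X"
  shows "ell2_norm X (M m x) = ell2_norm X x"
proof -
  have "(ell2_norm X (M m x))\<^sup>2 = (ell2_norm X x)\<^sup>2"
    using has_sum_unique[OF isometric_familyD(2)[OF assms] has_sum_finiteI[OF _ refl]] by simp
  then show ?thesis by (simp add: power2_eq_iff_nonneg)
qed

lemma unitary_oper_norm:
  assumes "unitary_oper X U" and x: "x \<in> ell2 X"
  shows "ell2_norm X (U x) = ell2_norm X x"
proof -
  have U: "bounded_oper X U" "adj X U (U x) = x" using assms by (auto simp: unitary_oper_def)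
  have "ip X (U x) (U x) = ip X x x"
    using ip_adj[OF U(1) x bounded_oper_ell2[OF U(1) x]] U(2) by simp
  then have "(ell2_norm X (U x))\<^sup>2 = (ell2_norm X x)\<^sup>2"
    using ip_self_Re[OF x] ip_self_Re[OF bounded_oper_ell2[OF U(1) x]] by simp
  then show ?thesis by (simp add: power2_eq_iff_nonneg)
qed

text \<open>In the superposition \<open>z = \<Sum>\<^sub>i P\<^sub>i L\<^sub>i x\<close> the projections satisfy \<open>P\<^sub>i z = P\<^sub>i L\<^sub>i x = L\<^sub>i P\<^sub>i x\<close>, and both
  \<open>z\<close> and \<open>x\<close> are measured isometrically by \<open>P\<close>.\<close>

lemma quantum_case_norm:
  assumes qs: "distinct qs" and \<psi>: "orthonormal_basis (reg B qs) d \<psi>"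
    and rs: "\<And>i. i < d \<Longrightarrow> distinct (rs i)" "\<And>i. i < d \<Longrightarrow> set qs \<inter> set (rs i) = {}"
    and L: "\<And>i. i < d \<Longrightarrow> local_oper B (rs i) (L i)"
    and iso: "\<And>i y. i < d \<Longrightarrow> y \<in> ell2 (mems B) \<Longrightarrow> ell2_norm (mems B) (L i y) = ell2_norm (mems B) y"
    and x: "x \<in> ell2 (mems B)"
  shows "ell2_norm (mems B) (\<lambda>s. \<Sum>i<d. lift B qs (ketbra (reg B qs) (\<psi> i) (\<psi> i)) (L i x) s)
    = ell2_norm (mems B) x"
proof -
  note D = orthonormal_basisD[OF \<psi>]
  define P where "P i = lift B qs (ketbra (reg B qs) (\<psi> i) (\<psi> i))" for i
  have bk: "bounded_oper (reg B qs) (ketbra (reg B qs) (\<psi> i) (\<psi> i))" if "i < d" for i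
    by (rule bounded_oper_ketbra[OF D(1)[OF that] D(1)[OF that]])
  have bP: "bounded_oper (mems B) (P i)" if "i < d" for i
    unfolding P_def by (rule bounded_oper_lift[OF qs bk[OF that]])
  have Px: "P i y \<in> ell2 (mems B)" if "i < d" "y \<in> ell2 (mems B)" for i y
    by (rule bounded_oper_ell2[OF bP[OF that(1)] that(2)])
  have Lx: "L i x \<in> ell2 (mems B)" if "i < d" for i
    by (rule bounded_oper_ell2[OF bounded_oper_local[OF rs(1) L] x]) (rule that)+
  have P: "isometric_family (mems B) {..<d} P"
    unfolding P_def by (rule lift_isometric_family[OF qs orthonormal_basis_isometric_family[OF \<psi>]])
  have Pn: "(\<Sum>i<d. (ell2_norm (mems B) (P i y))\<^sup>2) = (ell2_norm (mems B) y)\<^sup>2"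
    if "y \<in> ell2 (mems B)" for y
    using has_sum_unique[OF isometric_familyD(2)[OF P that] has_sum_finiteI[OF _ refl]] by simp
  have PP: "P j (P i y) = (if i = j then P j y else (\<lambda>s. 0))"
    if "i < d" "j < d" "y \<in> ell2 (mems B)" for i j y
    unfolding P_def lift_comp[OF qs bk[OF that(1)] that(3)]
    by (rule ext) (simp add: lift_slice ketbra_def ip_scale_right D(2)[OF that(2,1)] D(2)[OF that(2,2)])
  define z where "z = (\<lambda>s. \<Sum>i<d. P i (L i x) s)"
  have z: "z \<in> ell2 (mems B)" unfolding z_def by (rule ell2_sum) (simp add: Px Lx)
  have Pz: "P j z = P j (L j x)" if j: "j < d" for j
  proof -
    have "P j z = (\<lambda>s. \<Sum>i<d. P j (P i (L i x)) s)"
      unfolding z_def by (rule bounded_oper_sum[OF bP[OF j]]) (simp add: Px Lx)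
    also have "\<dots> = (\<lambda>s. \<Sum>i<d. if i = j then P j (L j x) s else 0)"
      by (intro ext sum.cong refl) (simp add: PP j Lx)
    also have "\<dots> = P j (L j x)" using j by simp
    finally show ?thesis .
  qed
  have comm: "P j (L j x) = L j (P j x)" if j: "j < d" for j
    unfolding P_def
    by (rule lift_ketbra_commute[OF qs rs(1)[OF j] rs(2)[OF j] orthonormal_basis_finite[OF \<psi>]
          D(1)[OF j] D(1)[OF j] L[OF j] x])
  have "(ell2_norm (mems B) z)\<^sup>2 = (\<Sum>j<d. (ell2_norm (mems B) (P j x))\<^sup>2)"
    unfolding Pn[OF z, symmetric] by (rule sum.cong) (simp_all add: Pz comm iso Px x)
  then have "(ell2_norm (mems B) z)\<^sup>2 = (ell2_norm (mems B) x)\<^sup>2" by (simp add: Pn[OF x])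
  then show ?thesis by (simp add: power2_eq_iff_nonneg z_def P_def)
qed

text \<open>Locality is proved along with isometry because the projections of a quantum case must
  commute with its branches. The register varies in the induction, since branches have to be placed
  on one that avoids the control variables.\<close>

lemma circuit_local_isometric:
  assumes U: "\<And>Ts U. (Ts, U) \<in> \<U> \<Longrightarrow> unitary_oper (listset Ts) U"
    and "is_circuit B \<U> C" "distinct rs" "cvars C \<subseteq> set rs"
  shows "local_oper B rs (csem B C) \<and>
    (\<forall>x\<in>ell2 (mems B). ell2_norm (mems B) (csem B C x) = ell2_norm (mems B) x)"
  using assms(2-)
proof (induction C arbitrary: rs)
  case CSkip
  show ?case using local_oper_id[of B rs] by (simp add: id_def)
next
  case (CUnitary W qs)
  then have qs: "distinct qs" and W: "unitary_oper (reg B qs) W"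
    using U[of "map B qs" W] by (auto simp: reg_def)
  have bW: "bounded_oper (reg B qs) W" using W by (simp add: unitary_oper_def)
  \<comment> \<open>A single isometry is treated as a measurement with one outcome, so that the
    result on extended families applies.\<close>
  have "isometric_family (mems B) {()} (\<lambda>_. lift B qs W)"
    by (intro lift_isometric_family qs isometric_family_singleton bW unitary_oper_norm W)
  then have "\<forall>x\<in>ell2 (mems B). ell2_norm (mems B) (lift B qs W x) = ell2_norm (mems B) x"
    using isometric_family_singletonD[of "mems B" "()" "\<lambda>_. lift B qs W"] by blast
  then show ?case
    using local_oper_mono[OF qs CUnitary.prems(2) _ local_oper_lift[OF bW]] CUnitary.prems by simp
next
  case (CSeq C1 C2)
  have 1: "local_oper B rs (csem B C1)"
    "\<And>x. x \<in> ell2 (mems B) \<Longrightarrow> ell2_norm (mems B) (csem B C1 x) = ell2_norm (mems B) x"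
    using CSeq.IH(1)[of rs] CSeq.prems by auto
  have 2: "local_oper B rs (csem B C2)"
    "\<And>x. x \<in> ell2 (mems B) \<Longrightarrow> ell2_norm (mems B) (csem B C2 x) = ell2_norm (mems B) x"
    using CSeq.IH(2)[of rs] CSeq.prems by auto
  note b = bounded_oper_ell2[OF bounded_oper_local[OF CSeq.prems(2) 1(1)]]
  show ?case
    using local_oper_comp[OF CSeq.prems(2) 2(1) 1(1)] by (simp add: 1(2) 2(2) b comp_def)
next
  case (CQif qs d \<psi> C)
  have qs: "distinct qs" and \<psi>: "orthonormal_basis (reg B qs) d \<psi>" and rs: "distinct rs"
    and sub: "set qs \<subseteq> set rs"
    using CQif.prems by auto
  \<comment> \<open>Removing the control variables keeps all variables of the branches, by the
    disjointness condition on circuits.\<close>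
  define ps where "ps = filter (\<lambda>q. q \<notin> set qs) rs"
  have ps: "distinct ps" "set qs \<inter> set ps = {}" "set ps \<subseteq> set rs" using rs by (auto simp: ps_def)
  have IH: "local_oper B ps (csem B (C i))"
    "\<And>x. x \<in> ell2 (mems B) \<Longrightarrow> ell2_norm (mems B) (csem B (C i) x) = ell2_norm (mems B) x"
    if i: "i < d" for i
  proof -
    have "is_circuit B \<U> (C i)" "cvars (C i) \<subseteq> set ps"
      using CQif.prems i by (auto simp: ps_def)
    with CQif.IH[of "C i" ps] ps(1)
    show "local_oper B ps (csem B (C i))"
      "\<And>x. x \<in> ell2 (mems B) \<Longrightarrow> ell2_norm (mems B) (csem B (C i) x) = ell2_norm (mems B) x"
      by auto
  qed
  have "local_oper B rs (\<lambda>x s. \<Sum>i\<in>{..<d}. (lift B qs (ketbra (reg B qs) (\<psi> i) (\<psi> i)) \<circ> csem B (C i)) x s)"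
  proof (intro local_oper_sum local_oper_comp[OF rs])
    fix i assume i: "i \<in> {..<d}"
    show "local_oper B rs (lift B qs (ketbra (reg B qs) (\<psi> i) (\<psi> i)))"
      using i orthonormal_basisD(1)[OF \<psi>]
      by (intro local_oper_mono[OF qs rs sub] local_oper_lift bounded_oper_ketbra) auto
    show "local_oper B rs (csem B (C i))"
      using i by (intro local_oper_mono[OF ps(1) rs ps(3)] IH(1)) auto
  qed
  then show ?case
    using quantum_case_norm[OF qs \<psi>, of "\<lambda>_. ps" "\<lambda>i. csem B (C i)"] ps IH by simp
qed

section \<open>Kraus families of programs\<close>

text \<open>The outcomes in \<open>A\<close> are the aborted ones. Keeping their operators makes the whole family a
  measurement without taking the square root of \<open>I - \<Sum>\<^sub>m L\<^sub>m\<^sup>\<dagger>L\<^sub>m\<close>.\<close>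

definition kraus_family ::
  "('v \<Rightarrow> 'b set) \<Rightarrow> 'v list \<Rightarrow> (('v \<Rightarrow> 'b) oper \<Rightarrow> ('v \<Rightarrow> 'b) oper) \<Rightarrow> 'm set \<Rightarrow> 'm set \<Rightarrow>
    ('m \<Rightarrow> ('v \<Rightarrow> 'b) oper) \<Rightarrow> bool" where
  "kraus_family B qs F I A L \<longleftrightarrow> A \<subseteq> I \<and> (\<forall>m\<in>I. local_oper B qs (L m)) \<and>
     isometric_family (mems B) I L \<and>
     (\<forall>\<rho> (K :: 'b set) v. decomposition (mems B) \<rho> K v \<longrightarrow>
        decomposition (mems B) (F \<rho>) ((I - A) \<times> K) (\<lambda>(m, k). L m (v k)))"

lemma kraus_familyD:
  fixes K :: "'b set"
  assumes "kraus_family (B :: 'v \<Rightarrow> 'b set) qs F I A L"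
  shows "A \<subseteq> I" and "m \<in> I \<Longrightarrow> local_oper B qs (L m)" and "isometric_family (mems B) I L"
    and "decomposition (mems B) \<rho> K v \<Longrightarrow>
      decomposition (mems B) (F \<rho>) ((I - A) \<times> K) (\<lambda>(m, k). L m (v k))"
  using assms by (auto simp: kraus_family_def)

lemma isometric_family_reindex:
  assumes M: "isometric_family X I M" and g: "bij_betw g J I"
  shows "isometric_family X J (M \<circ> g)"
proof -
  have "((\<lambda>m. (ell2_norm X (M (g m) x))\<^sup>2) has_sum (ell2_norm X x)\<^sup>2) J" if "x \<in> ell2 X" for x
    using isometric_familyD(2)[OF M that]
    unfolding has_sum_reindex_bij_betw[OF g, of "\<lambda>m. (ell2_norm X (M m x))\<^sup>2"] .
  then show ?thesis
    using isometric_familyD(1)[OF M] bij_betwE[OF g] by (simp add: isometric_family_def)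
qed

text \<open>Initialisation, sequencing and branching produce outcomes that are lists or pairs; an
  injection renames them to the type \<open>'b\<close> that \<open>If\<close> demands.\<close>

lemma kraus_family_reindex:
  assumes L: "kraus_family B qs F I A L" and f: "inj_on f I"
  shows "kraus_family B qs F (f ` I) (f ` A) (L \<circ> inv_into I f)"
proof -
  note D = kraus_familyD[OF L]
  have g: "bij_betw (inv_into I f) (f ` I) I" using f by (intro bij_betw_inv_into inj_on_imp_bij_betw)
  have "bij_betw (\<lambda>(m, k). (inv_into I f m, k)) ((f ` I - f ` A) \<times> K) ((I - A) \<times> K)" for K :: "'b set"
    using f D(1) by (intro bij_betwI[where g = "\<lambda>(m, k). (f m, k)"]) (auto simp: inj_on_def)
  from decomposition_reindex[OF D(4) this]
  have "decomposition (mems B) (F \<rho>) ((f ` I - f ` A) \<times> K) (\<lambda>(m, k). (L \<circ> inv_into I f) m (v k))"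
    if "decomposition (mems B) \<rho> K v" for \<rho> and K :: "'b set" and v
    using that by (simp add: comp_def case_prod_unfold)
  then show ?thesis
    unfolding kraus_family_def using D(1,2) isometric_family_reindex[OF D(3) g] f by auto
qed

lemma kraus_family_singleton:
  fixes B :: "'v \<Rightarrow> 'b set"
  assumes L: "local_oper B qs L" and iso: "isometric_family (mems B) {m} (\<lambda>_. L)"
    and F: "\<And>\<rho> (K :: 'b set) v. decomposition (mems B) \<rho> K v \<Longrightarrow> decomposition (mems B) (F \<rho>) K (\<lambda>k. L (v k))"
  shows "kraus_family B qs F {m} {} (\<lambda>_. L)"
proof -
  have "bij_betw snd ({m} \<times> K) K" for K :: "'b set"
    by (rule bij_betwI[where g = "Pair m"]) auto
  from decomposition_reindex[OF F this] show ?thesis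
    using L iso by (simp add: kraus_family_def case_prod_unfold comp_def)
qed

text \<open>An infinite cardinal equals its square.\<close>

lemma inj_pair_infinite: "\<exists>g :: 'b::infinite \<times> 'b \<Rightarrow> 'b. inj g"
proof -
  obtain g :: "'b \<times> 'b \<Rightarrow> 'b" where "bij_betw g (UNIV \<times> UNIV) UNIV"
    using iffD2[OF card_of_ordIso card_of_Times_same_infinite[OF infinite_UNIV]] by blast
  then show ?thesis by (auto simp: bij_betw_def)
qed

text \<open>The outcomes of an initialisation are label lists of one length, the length of the
  register; the pairing is iterated that many times.\<close>

lemma inj_on_lists_infinite: "\<exists>f :: 'b::infinite list \<Rightarrow> 'b. inj_on f {xs. length xs = n}"
proof (induction n)
  case (Suc n)
  then obtain f :: "'b list \<Rightarrow> 'b" where f: "inj_on f {xs. length xs = n}" by blast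
  obtain g :: "'b \<times> 'b \<Rightarrow> 'b" where g: "inj g" using inj_pair_infinite by blast
  have "inj_on (\<lambda>xs. g (hd xs, f (tl xs))) {xs. length xs = Suc n}"
  proof (rule inj_onI)
    fix xs ys :: "'b list"
    assume len: "xs \<in> {xs. length xs = Suc n}" "ys \<in> {xs. length xs = Suc n}"
      and "g (hd xs, f (tl xs)) = g (hd ys, f (tl ys))"
    then have eq: "hd xs = hd ys" "f (tl xs) = f (tl ys)" by (simp_all add: inj_eq[OF g])
    have "tl xs = tl ys" by (rule inj_onD[OF f eq(2)]) (use len in simp_all)
    moreover have "xs \<noteq> []" "ys \<noteq> []" using len by auto
    ultimately show "xs = ys" using eq(1) by (simp add: list.expand)
  qed
  then show ?case by blast
qed auto

section \<open>Kraus families of the program constructs\<close>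

lemma init_isometric_family:
  assumes \<psi>: "\<psi> \<in> ell2 X" "ell2_norm X \<psi> = 1"
  shows "isometric_family X X (\<lambda>n. ketbra X \<psi> (ket n))"
  unfolding isometric_family_def
proof (intro conjI ballI)
  fix x assume "x \<in> ell2 X"
  then have "((\<lambda>n. (cmod (x n))\<^sup>2) has_sum (ell2_norm X x)\<^sup>2) X" by (rule ell2_norm_has_sum)
  then show "((\<lambda>n. (ell2_norm X (ketbra X \<psi> (ket n) x))\<^sup>2) has_sum (ell2_norm X x)\<^sup>2) X"
    by (simp add: ell2_norm_ketbra \<psi> ip_ket_left cong: has_sum_cong)
qed (simp add: bounded_oper_ketbra \<psi>)

lemma kraus_family_init:
  fixes B :: "'v \<Rightarrow> 'b set"
  assumes qs: "distinct qs" and rs: "distinct rs" "set rs \<subseteq> set qs"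
    and \<psi>: "\<psi> \<in> ell2 (reg B rs)" "ell2_norm (reg B rs) \<psi> = 1"
  shows "kraus_family B qs (psem B (Init rs \<psi>)) (reg B rs) {}
    (\<lambda>n. lift B rs (ketbra (reg B rs) \<psi> (ket n)))"
proof -
  let ?L = "\<lambda>n. lift B rs (ketbra (reg B rs) \<psi> (ket n))"
  have bk: "bounded_oper (reg B rs) (ketbra (reg B rs) \<psi> (ket n))" if "n \<in> reg B rs" for n
    using that \<psi> by (intro bounded_oper_ketbra) auto
  have iso: "isometric_family (mems B) (reg B rs) ?L"
    by (rule lift_isometric_family[OF rs(1) init_isometric_family[OF \<psi>]])
  have "decomposition (mems B) (psem B (Init rs \<psi>) \<rho>) (reg B rs \<times> K) (\<lambda>(n, k). ?L n (v k))"
    if \<rho>: "decomposition (mems B) \<rho> K v" for \<rho> and K :: "'b set" and v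
    unfolding psem.simps
  proof (rule decomposition_infsum[OF _ isometric_family_summable[OF iso \<rho>]])
    fix n assume n: "n \<in> reg B rs"
    \<comment> \<open>The semantics writes the right factor as an explicit ket-bra; identifying it
      with the adjoint of the left one makes each summand a conjugation.\<close>
    have "adj (mems B) (?L n) x = lift B rs (ketbra (reg B rs) (ket n) \<psi>) x" if "x \<in> ell2 (mems B)" for x
      unfolding adj_lift[OF rs(1) bk[OF n] that] by (rule ext) (simp add: lift_slice adj_ketbra \<psi> n)
    then show "decomposition (mems B) (?L n \<circ> \<rho> \<circ> lift B rs (ketbra (reg B rs) (ket n) \<psi>)) K (\<lambda>k. ?L n (v k))"
      using decomposition_cong[OF decomposition_conjugate[OF \<rho> bounded_oper_lift[OF rs(1) bk[OF n]]]]
      by simp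
  qed
  then show ?thesis
    using iso bk by (simp add: kraus_family_def local_oper_mono[OF rs(1) qs rs(2)] local_oper_lift)
qed

text \<open>The vectors obtained after \<open>F\<close> are indexed by pairs, whereas the assumption
  on \<open>G\<close> covers index sets in \<open>'b\<close> only. They are therefore recoded by an
  injection \<open>g\<close> before \<open>G\<close> is applied, and decoded afterwards.\<close>

lemma kraus_family_seq:
  fixes B :: "'v \<Rightarrow> 'b::infinite set" and I J :: "'b set"
  assumes qs: "distinct qs" and F: "kraus_family B qs F I A L" and G: "kraus_family B qs G J C M"
  shows "kraus_family B qs (\<lambda>\<rho>. G (F \<rho>)) (I \<times> J) {(m, n) \<in> I \<times> J. m \<in> A \<or> n \<in> C}
    (\<lambda>(m, n). M n \<circ> L m)"
proof -
  note DF = kraus_familyD[OF F] and DG = kraus_familyD[OF G]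
  obtain g :: "'b \<times> 'b \<Rightarrow> 'b" where g: "inj g" using inj_pair_infinite by blast
  let ?A = "{(m, n) \<in> I \<times> J. m \<in> A \<or> n \<in> C}"
  have "decomposition (mems B) (G (F \<rho>)) ((I \<times> J - ?A) \<times> K) (\<lambda>(p, k). (case p of (m, n) \<Rightarrow> M n \<circ> L m) (v k))"
    if \<rho>: "decomposition (mems B) \<rho> K v" for \<rho> and K :: "'b set" and v
  proof -
    define S where "S = (I - A) \<times> K"
    define w where "w = (\<lambda>(m, k). L m (v k))"
    have "decomposition (mems B) (F \<rho>) S w" unfolding S_def w_def by (rule DF(4)[OF \<rho>])
    moreover have "bij_betw (inv g) (g ` S) S"
      using g by (intro bij_betwI[where g = g]) auto
    ultimately have "decomposition (mems B) (F \<rho>) (g ` S) (w \<circ> inv g)"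
      by (rule decomposition_reindex)
    note 1 = DG(4)[OF this]
    have 2: "bij_betw (\<lambda>((m, n), k). (n, g (m, k))) ((I \<times> J - ?A) \<times> K) ((J - C) \<times> g ` S)"
      using g by (intro bij_betwI[where g = "\<lambda>(n, j). ((fst (inv g j), n), snd (inv g j))"])
        (auto simp: S_def)
    show ?thesis
      by (rule decomposition_cong[OF decomposition_reindex[OF 1 2]]) (use g in \<open>auto simp: w_def\<close>)
  qed
  then show ?thesis
    unfolding kraus_family_def
    using local_oper_comp[OF qs DG(2) DF(2)] isometric_family_comp[OF DF(3) DG(3)] by auto
qed

lemma kraus_family_if:
  fixes B :: "'v \<Rightarrow> 'b set"
  assumes qs: "distinct qs" and rs: "distinct rs" "set rs \<subseteq> set qs"
    and M: "isometric_family (reg B rs) J M"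
    and P: "\<And>m. m \<in> J \<Longrightarrow> kraus_family B qs (psem B (P m)) (I m) (A m) (L m)"
  shows "kraus_family B qs (psem B (If rs J M P)) (Sigma J I) (Sigma J A)
    (\<lambda>(m, n). L m n \<circ> lift B rs (M m))"
proof -
  note D = kraus_familyD[OF P] and DM = isometric_familyD[OF M]
  note iM = lift_isometric_family[OF rs(1) M]
  note iso = isometric_family_comp[OF iM D(3)]
  have "decomposition (mems B) (psem B (If rs J M P) \<rho>) ((Sigma J I - Sigma J A) \<times> K)
      (\<lambda>(p, k). (case p of (m, n) \<Rightarrow> L m n \<circ> lift B rs (M m)) (v k))"
    if \<rho>: "decomposition (mems B) \<rho> K v" for \<rho> and K :: "'b set" and v
  proof -
    define w where "w m = (\<lambda>(n, k). L m n (lift B rs (M m) (v k)))" for m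
    have 1: "decomposition (mems B) (psem B (P m) (conjugate B (lift B rs (M m)) \<rho>)) ((I m - A m) \<times> K) (w m)"
      if m: "m \<in> J" for m
      unfolding conjugate_def w_def
      by (rule D(4)[OF m decomposition_conjugate[OF \<rho> isometric_familyD(1)[OF iM m]]])
    have bij: "bij_betw (\<lambda>((m, n), k). (m, n, k)) ((Sigma J I - Sigma J A) \<times> K) (Sigma J (\<lambda>m. (I m - A m) \<times> K))"
      by (rule bij_betwI[where g = "\<lambda>(m, n, k). ((m, n), k)"]) auto
    \<comment> \<open>Joint summability comes from the complete family, aborted outcomes included,
      and is then restricted.\<close>
    have "(\<lambda>(p, k). (ell2_norm (mems B) ((case p of (m, n) \<Rightarrow> L m n \<circ> lift B rs (M m)) (v k)))\<^sup>2)
        summable_on (Sigma J I - Sigma J A) \<times> K"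
      by (rule summable_on_subset[OF isometric_family_summable[OF iso \<rho>]]) auto
    then have 2: "(\<lambda>(m, j). (ell2_norm (mems B) (w m j))\<^sup>2) summable_on (Sigma J (\<lambda>m. (I m - A m) \<times> K))"
      by (subst summable_on_reindex_bij_betw[OF bij, symmetric]) (simp add: w_def case_prod_unfold)
    show ?thesis
      unfolding psem.simps
      by (rule decomposition_cong[OF decomposition_reindex[OF decomposition_infsum[OF 1 2] bij]])
        (auto simp: w_def)
  qed
  moreover have "local_oper B qs (L m n \<circ> lift B rs (M m))" if "m \<in> J" "n \<in> I m" for m n
    by (rule local_oper_comp[OF qs D(2)[OF that] local_oper_mono[OF rs(1) qs rs(2) local_oper_lift[OF DM(1)[OF that(1)]]]])
  moreover have "Sigma J A \<subseteq> Sigma J I" using D(1) by blast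
  ultimately show ?thesis
    unfolding kraus_family_def using iso by auto
qed

lemma program_kraus_family:
  fixes B :: "'v \<Rightarrow> 'b::infinite set"
  assumes U: "\<And>Ts U. (Ts, U) \<in> \<U> \<Longrightarrow> unitary_oper (listset Ts) U"
    and qs: "distinct qs" and "well_formed B \<U> P" "pvars P \<subseteq> set qs"
  shows "\<exists>(I :: 'b set) A L. kraus_family B qs (psem B P) I A L"
  using assms(3-)
proof (induction P)
  case Skip
  have "kraus_family B qs (psem B Skip) {undefined :: 'b} {} (\<lambda>_. id)"
    by (rule kraus_family_singleton)
      (simp_all add: local_oper_id isometric_family_singleton bounded_oper_id)
  then show ?case by blast
next
  case Abort
  \<comment> \<open>The identity is kept for the sake of isometry, but its outcome is aborted, so
    the zero operator is decomposed over the empty set.\<close>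
  have "kraus_family B qs (psem B Abort) {undefined :: 'b} {undefined} (\<lambda>_. id)"
    by (simp add: kraus_family_def local_oper_id isometric_family_singleton bounded_oper_id decomposition_def)
  then show ?case by blast
next
  case (Init rs \<psi>)
  then have rs: "distinct rs" "set rs \<subseteq> set qs"
    and \<psi>: "\<psi> \<in> ell2 (reg B rs)" "ell2_norm (reg B rs) \<psi> = 1" by auto
  obtain f :: "'b list \<Rightarrow> 'b" where f: "inj_on f {xs. length xs = length rs}"
    using inj_on_lists_infinite by blast
  have "inj_on f (reg B rs)" by (rule inj_on_subset[OF f]) (auto simp: reg_length)
  from kraus_family_reindex[OF kraus_family_init[OF qs rs \<psi>] this] show ?case by blast
next
  case (Circ C)
  have C: "local_oper B qs (csem B C)"
    "\<And>x. x \<in> ell2 (mems B) \<Longrightarrow> ell2_norm (mems B) (csem B C x) = ell2_norm (mems B) x"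
    using circuit_local_isometric[OF U _ qs, of \<U> B C] Circ by auto
  note b = bounded_oper_local[OF qs C(1)]
  have "kraus_family B qs (psem B (Circ C)) {undefined :: 'b} {} (\<lambda>_. csem B C)"
    by (rule kraus_family_singleton[OF C(1) isometric_family_singleton[OF b C(2)]])
      (simp_all add: conjugate_def decomposition_conjugate b)
  then show ?case by blast
next
  case (Seq P1 P2)
  then obtain I1 A1 L1 I2 A2 L2 where
    "kraus_family B qs (psem B P1) (I1 :: 'b set) A1 L1" "kraus_family B qs (psem B P2) (I2 :: 'b set) A2 L2"
    by auto
  from kraus_family_seq[OF qs this]
  have *: "kraus_family B qs (psem B (Seq P1 P2)) (I1 \<times> I2) {(m, n) \<in> I1 \<times> I2. m \<in> A1 \<or> n \<in> A2}
    (\<lambda>(m, n). L2 n \<circ> L1 m)" by simp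
  obtain g :: "'b \<times> 'b \<Rightarrow> 'b" where "inj g" using inj_pair_infinite by blast
  then have "inj_on g (I1 \<times> I2)" by (rule inj_on_subset) simp
  from kraus_family_reindex[OF * this] show ?case by blast
next
  case (If rs J M P)
  have rs: "distinct rs" "set rs \<subseteq> set qs" and M: "isometric_family (reg B rs) J M"
    using If.prems measurement_imp_isometric_family by auto
  have "\<exists>(I :: 'b set) A L. kraus_family B qs (psem B (P m)) I A L" if "m \<in> J" for m
  proof (rule If.IH)
    show "well_formed B \<U> (P m)" "pvars (P m) \<subseteq> set qs" using If.prems that by auto
  qed simp
  then obtain I A L where
    P: "\<And>m. m \<in> J \<Longrightarrow> kraus_family B qs (psem B (P m)) (I m :: 'b set) (A m) (L m)"
    by metis
  obtain g :: "'b \<times> 'b \<Rightarrow> 'b" where "inj g" using inj_pair_infinite by blast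
  then have "inj_on g (Sigma J I)" by (rule inj_on_subset) simp
  from kraus_family_reindex[OF kraus_family_if[OF qs rs M P] this] show ?case by blast
qed

text \<open>Moves the index set from \<open>nat\<close> to \<open>'b\<close>, the type over which
  \<open>kraus_family\<close> quantifies.\<close>

lemma partial_density_decomposition_infinite:
  assumes "partial_density X \<rho>"
  shows "\<exists>(K :: 'b::infinite set) v. decomposition X \<rho> K v"
proof -
  obtain N :: "nat set" and v where N: "decomposition X \<rho> N v"
    using partial_density_decomposition[OF assms] by blast
  obtain f :: "nat \<Rightarrow> 'b" where f: "inj f"
    using infinite_countable_subset[OF infinite_UNIV] by blast
  have "bij_betw (inv f) (f ` N) N" using f by (intro bij_betwI[where g = f]) auto
  from decomposition_reindex[OF N this] show ?thesis by blast
qed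

lemma psem_normal_form:
  assumes T: "\<And>m. m \<in> I \<Longrightarrow> bounded_oper (mems B) (lift B qs (T m))"
    and iso: "isometric_family (mems B) I (\<lambda>m. lift B qs (T m))"
    and \<rho>: "decomposition (mems B) \<rho> K v"
  shows "decomposition (mems B) (psem B (If qs I T (\<lambda>m. if m \<in> A then Abort else Circ CSkip)) \<rho>)
    ((I - A) \<times> K) (\<lambda>(m, k). lift B qs (T m) (v k))"
proof -
  \<comment> \<open>An aborted branch yields zero, which has a decomposition without vectors; the
    index set of the whole sum then leaves out exactly the outcomes in \<open>A\<close>.\<close>
  let ?K = "\<lambda>m. if m \<in> A then {} else K"
  have "decomposition (mems B) (psem B (if m \<in> A then Abort else Circ CSkip) (conjugate B (lift B qs (T m)) \<rho>))
      (?K m) (\<lambda>k. lift B qs (T m) (v k))" if m: "m \<in> I" for m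
    using decomposition_conjugate[OF decomposition_conjugate[OF \<rho> T[OF m]] bounded_oper_id]
    by (simp add: conjugate_def decomposition_def)
  moreover have eq: "Sigma I ?K = (I - A) \<times> K" by (auto split: if_splits)
  moreover have "(\<lambda>(m, k). (ell2_norm (mems B) (lift B qs (T m) (v k)))\<^sup>2) summable_on (I - A) \<times> K"
    by (rule summable_on_subset[OF isometric_family_summable[OF iso \<rho>]]) auto
  ultimately show ?thesis
    unfolding psem.simps eq[symmetric] by (intro decomposition_infsum)
qed

theorem theorem5p1:
  fixes B :: "'v \<Rightarrow> 'b::infinite set"
    and \<U> :: "('b set list \<times> 'b list oper) set"
    and P :: "('v, 'b) prog"
  assumes "\<And>Ts U. (Ts, U) \<in> \<U> \<Longrightarrow> unitary_oper (listset Ts) U"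
    and "is_program B \<U> P"
  shows "\<exists>N. normal_form B \<U> N \<and> prog_equiv B P N"
proof -
  have "finite (pvars P)" and wf: "well_formed B \<U> P" using assms(2) by (auto simp: is_program_def)
  then obtain qs where qs: "distinct qs" "set qs = pvars P" using finite_distinct_list by blast
  obtain I :: "'b set" and A L where "kraus_family B qs (psem B P) I A L"
    using program_kraus_family[OF assms(1) qs(1) wf] qs(2) by blast
  note D = kraus_familyD[OF this]
  show ?thesis
  proof (cases "mems B = {}")
    case True
    \<comment> \<open>Some variable has an empty label set, so the full space is zero and both sides
      vanish. The empty register still has one basis label and carries a trivial
      measurement.\<close>
    let ?N = "If [] {undefined} (\<lambda>_. id) (\<lambda>_. Abort) :: ('v, 'b) prog"
    have "measurement (reg B []) {undefined} (\<lambda>_. id)"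
      by (intro isometric_family_imp_measurement isometric_family_singleton bounded_oper_id) simp
    then have "normal_form B \<U> ?N" by (simp add: normal_form_def is_program_def)
    moreover have "psem B P \<rho> x = psem B ?N \<rho> x"
      if dens: "partial_density (mems B) \<rho>" and x: "x \<in> ell2 (mems B)" for \<rho> x
    proof -
      obtain K :: "'b set" and v where "decomposition (mems B) \<rho> K v"
        using partial_density_decomposition_infinite[OF dens] by blast
      then have "psem B P \<rho> x \<in> ell2 (mems B)" using D(4) decomposition_ell2 x by blast
      then show ?thesis using ell2_empty True by auto
    qed
    ultimately show ?thesis unfolding prog_equiv_def by blast
  next
    case False
    then obtain t where t: "t \<in> mems B" by auto
    obtain T where T: "\<And>m. m \<in> I \<Longrightarrow> bounded_oper (reg B qs) (T m)"
      and LT: "\<And>m x. m \<in> I \<Longrightarrow> x \<in> ell2 (mems B) \<Longrightarrow> L m x = lift B qs (T m) x"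
      using D(2) unfolding local_oper_def by metis
    \<comment> \<open>\<open>D(3)\<close> concerns the full space; the memory \<open>t\<close>
      brings it down to the register, where the measurement of the normal form lives.\<close>
    have iT: "isometric_family (reg B qs) I T" by (rule isometric_family_of_lift[OF qs(1) t D(3) T LT])
    let ?N = "If qs I T (\<lambda>m. if m \<in> A then Abort else Circ CSkip)"
    have "pvars (if m \<in> A then Abort else Circ CSkip :: ('v, 'b) prog) = {}" for m by simp
    then have "normal_form B \<U> ?N"
      using qs(1) isometric_family_imp_measurement[OF iT] by (auto simp: normal_form_def is_program_def)
    moreover have "psem B P \<rho> x = psem B ?N \<rho> x"
      if dens: "partial_density (mems B) \<rho>" and x: "x \<in> ell2 (mems B)" for \<rho> x
    proof
      fix s
      obtain K :: "'b set" and v where \<rho>: "decomposition (mems B) \<rho> K v"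
        using partial_density_decomposition_infinite[OF dens] by blast
      have "decomposition (mems B) (psem B ?N \<rho>) ((I - A) \<times> K) (\<lambda>(m, k). lift B qs (T m) (v k))"
        by (rule psem_normal_form[OF bounded_oper_lift[OF qs(1) T] lift_isometric_family[OF qs(1) iT] \<rho>])
      \<comment> \<open>With \<open>L\<close> in place of the extended \<open>T\<close>, both
        programs have the same decomposition, and this determines their values on
        \<open>ell2 (mems B)\<close>.\<close>
      then have N: "decomposition (mems B) (psem B ?N \<rho>) ((I - A) \<times> K) (\<lambda>(m, k). L m (v k))"
        by (rule decomposition_cong) (auto simp: LT decompositionD(1)[OF \<rho>])
      show "psem B P \<rho> x s = psem B ?N \<rho> x s"
        unfolding decompositionD(3)[OF D(4)[OF \<rho>] x] decompositionD(3)[OF N x] ..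
    qed
    ultimately show ?thesis unfolding prog_equiv_def by blast
  qed
qed

end
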